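(* Let $(S,\nu)$ be a space of homogeneous type and $(\Omega,\mu)$ a $\sigma$-finite measurable space. Suppose that $X$ is a $2$-convex Banach lattice of measurable functions on $(S\times\Omega,\nu\times\mu)$ having order continuous norm and the Fatou property. Let $T$ be an $A_2$-nondegenerate linear operator in $L_2(S\times\Omega)$. If $T$ acts boundedly in $X$, then the Hardy–Littlewood maximal operator $M$ is bounded in both $X$ and its order dual $X'$ with a suitable estimate for the constants.
   Context: A Banach lattice of measurable functions $X$ is a Banach space of (classes of) measurable functions such that $g\in X$, $|f|\le|g|$ a.e. implies $f\in X$ and $\|f\|_X\le\|g\|_X$. Fatou property: if $f_j\in X$, $\|f_j\|_X\le1$ and $f_j\to f$ a.e., then $f\in X$ and $\|f\|_X\le1$. Order continuous norm: $f_j\downarrow0$ a.e., $f_j\in X$ implies $\|f_j\|_X\to0$. $2$-convexity: $\|(\sum_j|f_j|^2)^{1/2}\|_X\le c(\sum_j\|f_j\|_X^2)^{1/2}$ for all finite families in $X$, with a constant $c$ independent of the family. The order dual $X'$ is the lattice of all measurable $g$ with $\|g\|_{X'}=\sup\{\int|fg|:\|f\|_X\le1\}<\infty$. $T$ acts boundedly in $X$ if $\|Tf\|_X\le c\|f\|_X$ for all $f\in X\cap L_2$ (a dense subset of $X$). The maximal operator acts in the first variable: $Mf(x,\omega)=\sup_{B\ni x}\frac1{\nu(B)}\int_B|f(\cdot,\omega)|\,d\nu$, the supremum being over balls $B\subset S$ containing $x$. For a weight $w\ge0$ on $S\times\Omega$, $$[w]_{A_2}=\operatorname*{ess\,sup}_{\omega\in\Omega}\sup_B\Big(\frac1{\nu(B)}\int_Bw(\cdot,\omega)\Big)\Big(\frac1{\nu(B)}\int_Bw^{-1}(\cdot,\omega)\Big),$$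 with the supremum over all balls $B\subset S$; $w\in A_2$ means $[w]_{A_2}<\infty$. $L_2(w^{-1/2})$ is the space with norm $(\int|f|^2w)^{1/2}$. $T$ is $A_2$-nondegenerate if the boundedness of $T$ in $L_2(w^{-1/2})$ implies $w\in A_2$ with an estimate for the constant $[w]_{A_2}$.
   Formalization: The linear operator T in L_2 is taken to be bounded in L_2 (for discontinuous everywhere-defined linear T the claim fails), and the constants may depend on its norm; balls of the space of homogeneous type are taken to be open, as is usual. *)

theory Defs
  imports "HOL-Analysis.Analysis"
begin

definition qball :: "'s measure \<Rightarrow> ('s \<Rightarrow> 's \<Rightarrow> real) \<Rightarrow> 's \<Rightarrow> real \<Rightarrow> 's set" where
  "qball \<nu> d x r = {y \<in> space \<nu>. d x y < r}"

text \<open>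
  The underlying set is the space of the measure. Following Coifman and Weiss, the balls of the
  quasi-metric are open in the topology that it induces (a quasi-metric alone does not guarantee
  this); this is what makes maximal functions measurable. The sigma-algebra may be larger than
  the Borel sets. Separability and sigma-finiteness follow from the doubling condition.
\<close>

definition homogeneous_type ::
  "'s measure \<Rightarrow> ('s \<Rightarrow> 's \<Rightarrow> real) \<Rightarrow> real \<Rightarrow> real \<Rightarrow> bool" where
  "homogeneous_type \<nu> d \<kappa> D \<longleftrightarrow>
     (\<forall>x\<in>space \<nu>. \<forall>y\<in>space \<nu>. 0 \<le> d x y \<and> (d x y = 0 \<longleftrightarrow> x = y) \<and> d x y = d y x) \<and>
     (\<forall>x\<in>space \<nu>. \<forall>y\<in>space \<nu>. \<forall>z\<in>space \<nu>. d x z \<le> \<kappa> * (d x y + d y z)) \<and>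
     (\<forall>x\<in>space \<nu>. \<forall>r>0. \<forall>y\<in>qball \<nu> d x r. \<exists>e>0. qball \<nu> d y e \<subseteq> qball \<nu> d x r) \<and>
     (\<forall>x\<in>space \<nu>. \<forall>r>0. qball \<nu> d x r \<in> sets \<nu> \<and>
        0 < emeasure \<nu> (qball \<nu> d x r) \<and> emeasure \<nu> (qball \<nu> d x r) < \<infinity> \<and>
        emeasure \<nu> (qball \<nu> d x (2 * r)) \<le> ennreal D * emeasure \<nu> (qball \<nu> d x r))"

definition average :: "'s measure \<Rightarrow> 's set \<Rightarrow> ('s \<Rightarrow> ennreal) \<Rightarrow> ennreal" where
  "average \<nu> B h = (\<integral>\<^sup>+u\<in>B. h u \<partial>\<nu>) / emeasure \<nu> B"

definition maximal ::
  "'s measure \<Rightarrow> ('s \<Rightarrow> 's \<Rightarrow> real) \<Rightarrow> ('s \<times> 'w \<Rightarrow> 'k::real_normed_vector)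
     \<Rightarrow> 's \<times> 'w \<Rightarrow> ennreal" where
  "maximal \<nu> d f = (\<lambda>(x, \<omega>).
     SUP (y, r) \<in> {(y, r). y \<in> space \<nu> \<and> 0 < r \<and> x \<in> qball \<nu> d y r}.
       average \<nu> (qball \<nu> d y r) (\<lambda>u. ennreal (norm (f (u, \<omega>)))))"


text \<open>
  A lattice is a set \<open>X\<close> of measurable functions together with a norm \<open>N\<close> on it. Functions are
  not quotiented: the ideal property makes \<open>X\<close> and \<open>N\<close> invariant under equality a.e.
  The scalars \<open>'k\<close> range over the finite-dimensional real normed fields, i.e. the real and the
  complex numbers.
\<close>

definition banach_lattice ::
  "'a measure \<Rightarrow> ('a \<Rightarrow> 'k::{real_normed_field,euclidean_space}) set
     \<Rightarrow> (('a \<Rightarrow> 'k) \<Rightarrow> real) \<Rightarrow> bool" where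
  "banach_lattice M X N \<longleftrightarrow>
     X \<subseteq> borel_measurable M \<and>
     (\<lambda>_. 0) \<in> X \<and>
     (\<forall>f\<in>X. \<forall>g\<in>X. (\<lambda>z. f z + g z) \<in> X \<and> N (\<lambda>z. f z + g z) \<le> N f + N g) \<and>
     (\<forall>f\<in>X. \<forall>c. (\<lambda>z. c * f z) \<in> X \<and> N (\<lambda>z. c * f z) = norm c * N f) \<and>
     (\<forall>f\<in>X. 0 \<le> N f \<and> (N f = 0 \<longrightarrow> (AE z in M. f z = 0))) \<and>
     (\<forall>g\<in>X. \<forall>f\<in>borel_measurable M.
        (AE z in M. norm (f z) \<le> norm (g z)) \<longrightarrow> f \<in> X \<and> N f \<le> N g) \<and>
     (\<forall>f::nat \<Rightarrow> 'a \<Rightarrow> 'k. range f \<subseteq> X \<longrightarrow>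
        (\<forall>e>0. \<exists>n0. \<forall>m\<ge>n0. \<forall>n\<ge>n0. N (\<lambda>z. f m z - f n z) < e) \<longrightarrow>
        (\<exists>g\<in>X. (\<lambda>n. N (\<lambda>z. f n z - g z)) \<longlonglongrightarrow> 0))"

definition fatou_property ::
  "'a measure \<Rightarrow> ('a \<Rightarrow> 'k::{real_normed_field,euclidean_space}) set
     \<Rightarrow> (('a \<Rightarrow> 'k) \<Rightarrow> real) \<Rightarrow> bool" where
  "fatou_property M X N \<longleftrightarrow>
     (\<forall>(f::nat \<Rightarrow> 'a \<Rightarrow> 'k) g. (\<forall>j. f j \<in> X \<and> N (f j) \<le> 1) \<longrightarrow> g \<in> borel_measurable M \<longrightarrow>
        (AE z in M. (\<lambda>j. f j z) \<longlonglongrightarrow> g z) \<longrightarrow> g \<in> X \<and> N g \<le> 1)"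

definition order_continuous_norm ::
  "'a measure \<Rightarrow> ('a \<Rightarrow> 'k::{real_normed_field,euclidean_space}) set
     \<Rightarrow> (('a \<Rightarrow> 'k) \<Rightarrow> real) \<Rightarrow> bool" where
  "order_continuous_norm M X N \<longleftrightarrow>
     (\<forall>f::nat \<Rightarrow> 'a \<Rightarrow> real. (\<forall>j. (\<lambda>z. of_real (f j z)) \<in> X) \<longrightarrow>
        (AE z in M. decseq (\<lambda>j. f j z) \<and> (\<lambda>j. f j z) \<longlonglongrightarrow> 0) \<longrightarrow>
        (\<lambda>j. N (\<lambda>z. of_real (f j z))) \<longlonglongrightarrow> 0)"

definition two_convex ::
  "('a \<Rightarrow> 'k::{real_normed_field,euclidean_space}) set \<Rightarrow> (('a \<Rightarrow> 'k) \<Rightarrow> real)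
     \<Rightarrow> real \<Rightarrow> bool" where
  "two_convex X N c \<longleftrightarrow>
     (\<forall>(f::nat \<Rightarrow> 'a \<Rightarrow> 'k) n. (\<forall>j<n. f j \<in> X) \<longrightarrow>
        N (\<lambda>z. of_real (sqrt (\<Sum>j<n. (norm (f j z))\<^sup>2))) \<le> c * sqrt (\<Sum>j<n. (N (f j))\<^sup>2))"

text \<open>
  The norm of the order dual is given on all measurable functions with values in \<open>[0,\<infinity>]\<close>, so
  that it applies to maximal functions. If it is finite at \<open>h\<close>, then \<open>h\<close> is finite a.e. on the
  set where any given element of \<open>X\<close> is nonzero, hence a.e. when \<open>X\<close> has full support.
\<close>

definition dual_norm ::
  "'a measure \<Rightarrow> ('a \<Rightarrow> 'k::{real_normed_field,euclidean_space}) set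
     \<Rightarrow> (('a \<Rightarrow> 'k) \<Rightarrow> real) \<Rightarrow> ('a \<Rightarrow> ennreal) \<Rightarrow> ennreal" where
  "dual_norm M X N h = (SUP f \<in> {f \<in> X. N f \<le> 1}. \<integral>\<^sup>+z. ennreal (norm (f z)) * h z \<partial>M)"

definition order_dual ::
  "'a measure \<Rightarrow> ('a \<Rightarrow> 'k::{real_normed_field,euclidean_space}) set
     \<Rightarrow> (('a \<Rightarrow> 'k) \<Rightarrow> real) \<Rightarrow> ('a \<Rightarrow> 'k) set" where
  "order_dual M X N = {g \<in> borel_measurable M. dual_norm M X N (\<lambda>z. ennreal (norm (g z))) < \<infinity>}"


text \<open>
  \<open>wL2 M w\<close> is the space \<open>L\<^sub>2(w\<^sup>-\<^sup>1\<^sup>/\<^sup>2)\<close>, with norm \<open>(\<integral>|f|\<^sup>2 w)\<^sup>1\<^sup>/\<^sup>2\<close>.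
\<close>

definition wL2 ::
  "'a measure \<Rightarrow> ('a \<Rightarrow> real) \<Rightarrow> ('a \<Rightarrow> 'k::{real_normed_field,euclidean_space}) set" where
  "wL2 M w = {f \<in> borel_measurable M. (\<integral>\<^sup>+z. ennreal ((norm (f z))\<^sup>2 * w z) \<partial>M) < \<infinity>}"

definition wL2_norm ::
  "'a measure \<Rightarrow> ('a \<Rightarrow> real) \<Rightarrow> ('a \<Rightarrow> 'k::{real_normed_field,euclidean_space}) \<Rightarrow> real" where
  "wL2_norm M w f = sqrt (enn2real (\<integral>\<^sup>+z. ennreal ((norm (f z))\<^sup>2 * w z) \<partial>M))"

abbreviation L2 :: "'a measure \<Rightarrow> ('a \<Rightarrow> 'k::{real_normed_field,euclidean_space}) set" where
  "L2 M \<equiv> wL2 M (\<lambda>_. 1)"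

abbreviation L2_norm ::
  "'a measure \<Rightarrow> ('a \<Rightarrow> 'k::{real_normed_field,euclidean_space}) \<Rightarrow> real" where
  "L2_norm M \<equiv> wL2_norm M (\<lambda>_. 1)"

definition acts_boundedly ::
  "'a measure \<Rightarrow> (('a \<Rightarrow> 'k::{real_normed_field,euclidean_space}) \<Rightarrow> ('a \<Rightarrow> 'k))
     \<Rightarrow> ('a \<Rightarrow> 'k) set \<Rightarrow> (('a \<Rightarrow> 'k) \<Rightarrow> real) \<Rightarrow> real \<Rightarrow> bool" where
  "acts_boundedly M T X N c \<longleftrightarrow>
     0 \<le> c \<and> (\<forall>f \<in> X \<inter> L2 M. T f \<in> X \<and> N (T f) \<le> c * N f)"

text \<open>
  A bounded linear operator in \<open>L\<^sub>2\<close>. Since linearity holds a.e., boundedness makes \<open>T\<close>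
  well defined on classes modulo equality a.e.
\<close>

definition linear_operator_L2 ::
  "'a measure \<Rightarrow> (('a \<Rightarrow> 'k::{real_normed_field,euclidean_space}) \<Rightarrow> ('a \<Rightarrow> 'k))
     \<Rightarrow> real \<Rightarrow> bool" where
  "linear_operator_L2 M T A \<longleftrightarrow>
     acts_boundedly M T (L2 M) (L2_norm M) A \<and>
     (\<forall>f\<in>L2 M. \<forall>g\<in>L2 M. AE z in M. T (\<lambda>z. f z + g z) z = T f z + T g z) \<and>
     (\<forall>f\<in>L2 M. \<forall>c. AE z in M. T (\<lambda>z. c * f z) z = c * T f z)"

text \<open>
  The infimum below is the essential supremum over \<open>\<omega>\<close>, written so that no measurability of the
  supremum over the balls is presupposed.
\<close>

definition A2_const ::
  "'s measure \<Rightarrow> ('s \<Rightarrow> 's \<Rightarrow> real) \<Rightarrow> 'w measure \<Rightarrow> ('s \<times> 'w \<Rightarrow> real) \<Rightarrow> ennreal" where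
  "A2_const \<nu> d \<mu> w = Inf {K. AE \<omega> in \<mu>.
     (SUP (y, r) \<in> space \<nu> \<times> {0<..}.
        average \<nu> (qball \<nu> d y r) (\<lambda>u. ennreal (w (u, \<omega>))) *
        average \<nu> (qball \<nu> d y r) (\<lambda>u. inverse (ennreal (w (u, \<omega>))))) \<le> K}"

text \<open>
  Nondegeneracy with the estimate \<open>\<Phi>\<close>: if \<open>T\<close> is bounded in \<open>L\<^sub>2(w\<^sup>-\<^sup>1\<^sup>/\<^sup>2)\<close> with constant \<open>c\<close>,
  then the \<open>A\<^sub>2\<close> constant of \<open>w\<close> is at most \<open>\<Phi> c\<close>, in particular finite. Only weights
  that are positive a.e. are considered, as these are the ones for which \<open>w\<^sup>-\<^sup>1\<^sup>/\<^sup>2\<close> is a weight.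
\<close>

definition A2_nondegenerate ::
  "'s measure \<Rightarrow> ('s \<Rightarrow> 's \<Rightarrow> real) \<Rightarrow> 'w measure
     \<Rightarrow> (('s \<times> 'w \<Rightarrow> 'k::{real_normed_field,euclidean_space}) \<Rightarrow> ('s \<times> 'w \<Rightarrow> 'k))
     \<Rightarrow> (real \<Rightarrow> real) \<Rightarrow> bool" where
  "A2_nondegenerate \<nu> d \<mu> T \<Phi> \<longleftrightarrow>
     (\<forall>w \<in> borel_measurable (\<nu> \<Otimes>\<^sub>M \<mu>). \<forall>c.
        (AE z in \<nu> \<Otimes>\<^sub>M \<mu>. 0 < w z) \<longrightarrow>
        acts_boundedly (\<nu> \<Otimes>\<^sub>M \<mu>) T (wL2 (\<nu> \<Otimes>\<^sub>M \<mu>) w) (wL2_norm (\<nu> \<Otimes>\<^sub>M \<mu>) w) c \<longrightarrow>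
        A2_const \<nu> d \<mu> w \<le> ennreal (\<Phi> c))"

definition maximal_bounded ::
  "'s measure \<Rightarrow> ('s \<Rightarrow> 's \<Rightarrow> real) \<Rightarrow> 'w measure
     \<Rightarrow> ('s \<times> 'w \<Rightarrow> 'k::{real_normed_field,euclidean_space}) set
     \<Rightarrow> (('s \<times> 'w \<Rightarrow> 'k) \<Rightarrow> real) \<Rightarrow> real \<Rightarrow> bool" where
  "maximal_bounded \<nu> d \<mu> X N C \<longleftrightarrow>
     (\<forall>f\<in>X. \<exists>h\<in>X. (AE z in \<nu> \<Otimes>\<^sub>M \<mu>. maximal \<nu> d f z = ennreal (norm (h z))) \<and> N h \<le> C * N f)"

definition maximal_bounded_dual ::
  "'s measure \<Rightarrow> ('s \<Rightarrow> 's \<Rightarrow> real) \<Rightarrow> 'w measure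
     \<Rightarrow> ('s \<times> 'w \<Rightarrow> 'k::{real_normed_field,euclidean_space}) set
     \<Rightarrow> (('s \<times> 'w \<Rightarrow> 'k) \<Rightarrow> real) \<Rightarrow> real \<Rightarrow> bool" where
  "maximal_bounded_dual \<nu> d \<mu> X N C \<longleftrightarrow>
     (\<forall>g \<in> order_dual (\<nu> \<Otimes>\<^sub>M \<mu>) X N.
        maximal \<nu> d g \<in> borel_measurable (\<nu> \<Otimes>\<^sub>M \<mu>) \<and>
        dual_norm (\<nu> \<Otimes>\<^sub>M \<mu>) X N (maximal \<nu> d g)
          \<le> ennreal C * dual_norm (\<nu> \<Otimes>\<^sub>M \<mu>) X N (\<lambda>z. ennreal (norm (g z))))"

end

theory Submission
  imports Defs
begin

text \<open>
  Let \<open>Y\<close> be the lattice of all \<open>h\<close> with \<open>\<bar>h\<bar>\<^sup>1\<^sup>/\<^sup>2 \<in> X\<close>; it is normable by 2-convexity. Its order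
  dual consists of weights \<open>v\<close> with \<open>\<integral>\<bar>f\<bar>\<^sup>2v \<le> const \<cdot> \<parallel>f\<parallel>\<^sup>2\<close> on \<open>X\<close>, and by order continuity
  all functionals on \<open>Y\<close> are of this form. For such \<open>v\<close>, the little Grothendieck
  theorem applied to \<open>T\<close>, as an operator from \<open>X\<close> to \<open>L\<^sub>2(v\<^sup>-\<^sup>1\<^sup>/\<^sup>2)\<close>, and a separation argument
  give another such weight \<open>v'\<close> with \<open>\<integral>\<bar>Tf\<bar>\<^sup>2v \<le> const \<cdot> \<integral>\<bar>f\<bar>\<^sup>2v'\<close>. Iterating and summing as
  in the Rubio de Francia algorithm yields \<open>W \<ge> v\<close> such that \<open>T\<close> is bounded in \<open>L\<^sub>2(W\<^sup>-\<^sup>1\<^sup>/\<^sup>2)\<close>.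
  Since \<open>T\<close> is also bounded in \<open>L\<^sub>2\<close>, the same is true, uniformly, for the bounded weights
  \<open>w = min(W, K) + \<epsilon>\<close>, which therefore lie in \<open>A\<^sub>2\<close> with a uniform constant. Hence any positive operator
  that is bounded in \<open>L\<^sub>2\<close> with all \<open>A\<^sub>2\<close> weights is bounded in \<open>X\<close>. This applies to the maximal
  operator, and to the adjoints of its linearizations, which gives the bound in the order dual.
\<close>

section \<open>Separation for convex cones of functions\<close>

text \<open>Two obstacles shape the argument. The norm of \<open>X\<close> measures single
  functions, weights measure integrals of squares. 2-convexity reconciles them, so every weight
  below comes from one separation statement, \<open>sandwich\<close>. Secondly, the norm of the
  square function of a family bounds no random sum of the family in \<open>X\<close>, only its
  moments at each point. Hence random sums are cut down to a multiple of the square function before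
  \<open>T\<close> acts on them, and the remainder is treated by iteration. An invariant weight
  \<open>W\<close> controls \<open>T\<close> only on \<open>X \<inter> L_2\<close>, and it may
  vanish or be infinite, whereas nondegeneracy speaks of all of
  \<open>L_2(w^(-1/2)) \<inter> L_2\<close>; this is the reason for cutting \<open>W\<close> off
  from above and below. The exponent 2 also serves duality: the class A_2 is invariant under
  \<open>w \<mapsto> 1 / w\<close>, and \<open>L_2\<close> with the weight \<open>1 / w\<close> is
  dual to \<open>L_2\<close> with the weight \<open>w\<close>. An adjoint of a linearised maximal
  operator therefore obeys the same weighted bound as the operator itself, and both conclusions
  follow from one extrapolation theorem in \<open>X\<close>.\<close>

lemma cone_separation:
  fixes \<Gamma> :: "(('a \<Rightarrow> real) \<times> real) set"
  assumes add: "\<And>h s g t. (h, s) \<in> \<Gamma> \<Longrightarrow> (g, t) \<in> \<Gamma> \<Longrightarrow> (\<lambda>z. h z + g z, s + t) \<in> \<Gamma>"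
    and scale: "\<And>h s r. (h, s) \<in> \<Gamma> \<Longrightarrow> 0 \<le> r \<Longrightarrow> (\<lambda>z. r * h z, r * s) \<in> \<Gamma>"
    and proper: "\<And>s. (\<lambda>z. 0, s) \<in> \<Gamma> \<Longrightarrow> 0 \<le> s"
    and nonempty: "\<Gamma> \<noteq> {}"
  defines "V \<equiv> {h. (\<exists>s. (h, s) \<in> \<Gamma>) \<and> (\<exists>s. (\<lambda>z. - h z, s) \<in> \<Gamma>)}"
  shows "\<exists>l :: ('a \<Rightarrow> real) \<Rightarrow> real. (\<forall>h\<in>V. \<forall>g\<in>V. l (\<lambda>z. h z + g z) = l h + l g) \<and>
    (\<forall>h\<in>V. \<forall>r. l (\<lambda>z. r * h z) = r * l h) \<and> (\<forall>h\<in>V. \<forall>s. (h, s) \<in> \<Gamma> \<longrightarrow> l h \<le> s)"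
proof -
  \<comment> \<open>A pair \<open>(h, s)\<close> records the demand that \<open>l h\<close> be at
    most \<open>s\<close>. Zorn's lemma gives a maximal convex cone of demands that contains no
    \<open>(0, s)\<close> with \<open>s < 0\<close>; its lower envelope \<open>l\<close> is linear
    where the demands bound it from both sides. This is the Hahn-Banach theorem with a sublinear
    majorant known only through its epigraph and finite only on part of the space.\<close>
  define cones where "cones = {G. \<Gamma> \<subseteq> G \<and>
    (\<forall>h s g t. (h, s) \<in> G \<longrightarrow> (g, t) \<in> G \<longrightarrow> (\<lambda>z. h z + g z, s + t) \<in> G) \<and>
    (\<forall>h s r. (h, s) \<in> G \<longrightarrow> 0 \<le> r \<longrightarrow> (\<lambda>z. r * h z, r * s) \<in> G) \<and>
    (\<forall>s. (\<lambda>z. 0, s) \<in> G \<longrightarrow> 0 \<le> s)}"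
  have "\<Gamma> \<in> cones"
    unfolding cones_def using add scale proper by auto
  have chain: "\<Union>\<C> \<in> cones" if ne: "\<C> \<noteq> {}" and "subset.chain cones \<C>" for \<C>
  proof -
    have sub: "\<C> \<subseteq> cones" and lin: "\<And>G H. G \<in> \<C> \<Longrightarrow> H \<in> \<C> \<Longrightarrow> G \<subseteq> H \<or> H \<subseteq> G"
      using that(2) unfolding subset.chain_def by auto
    have "(\<lambda>z. h z + g z, s + t) \<in> \<Union>\<C>" if hg: "(h, s) \<in> \<Union>\<C>" "(g, t) \<in> \<Union>\<C>" for h s g t
    proof -
      obtain G H where GH: "G \<in> \<C>" "H \<in> \<C>" "(h, s) \<in> G" "(g, t) \<in> H" using hg by auto
      then obtain K where K: "K \<in> \<C>" "(h, s) \<in> K" "(g, t) \<in> K" using lin[of G H] by auto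
      then have "(\<lambda>z. h z + g z, s + t) \<in> K" using sub unfolding cones_def by auto
      then show ?thesis using K by auto
    qed
    moreover have "\<Gamma> \<subseteq> \<Union>\<C>"
    proof -
      obtain G where "G \<in> \<C>" using ne by auto
      moreover from this have "\<Gamma> \<subseteq> G" using sub unfolding cones_def by blast
      ultimately show ?thesis by auto
    qed
    moreover have "(\<lambda>z. r * h z, r * s) \<in> \<Union>\<C>" if hr: "(h, s) \<in> \<Union>\<C>" "0 \<le> r" for h s r
    proof -
      obtain G where G: "G \<in> \<C>" "(h, s) \<in> G" using hr by auto
      then have "(\<lambda>z. r * h z, r * s) \<in> G" using sub hr(2) unfolding cones_def by auto
      then show ?thesis using G by auto
    qed
    moreover have "0 \<le> s" if s: "(\<lambda>z. 0, s) \<in> \<Union>\<C>" for s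
    proof -
      obtain G where G: "G \<in> \<C>" "(\<lambda>z. 0, s) \<in> G" using s by auto
      then show ?thesis using sub unfolding cones_def by auto
    qed
    ultimately show ?thesis unfolding cones_def by simp
  qed
  obtain G where G: "G \<in> cones" and max: "\<And>H. H \<in> cones \<Longrightarrow> G \<subseteq> H \<Longrightarrow> H = G"
  proof -
    have "\<exists>G\<in>cones. \<forall>H\<in>cones. G \<subseteq> H \<longrightarrow> H = G"
      using subset_Zorn_nonempty[of cones] \<open>\<Gamma> \<in> cones\<close> chain by blast
    then show thesis using that by blast
  qed
  have G_sub: "\<Gamma> \<subseteq> G"
    and G_add: "\<And>h s g t. (h, s) \<in> G \<Longrightarrow> (g, t) \<in> G \<Longrightarrow> (\<lambda>z. h z + g z, s + t) \<in> G"
    and G_scale: "\<And>h s r. (h, s) \<in> G \<Longrightarrow> 0 \<le> r \<Longrightarrow> (\<lambda>z. r * h z, r * s) \<in> G"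
    and G_proper: "\<And>s. (\<lambda>z. 0, s) \<in> G \<Longrightarrow> 0 \<le> s"
    using G unfolding cones_def by auto
  obtain h0 s0 where "(h0, s0) \<in> G" using nonempty G_sub by auto
  from G_scale[OF this, of 0] have G_zero: "(\<lambda>z. 0, 0) \<in> G" by simp
  \<comment> \<open>Maximality at work: adjoining the ray of \<open>(h, r)\<close> destroys
    properness, so some \<open>g + t * h = 0\<close> comes with a negative bound
    \<open>s' + t * r\<close>. Here \<open>t\<close> cannot vanish, and division by \<open>t\<close>
    yields a demand on \<open>- h\<close> below \<open>- r\<close>.\<close>
  have total: "\<exists>s. s < - r \<and> (\<lambda>z. - h z, s) \<in> G" if h: "(h, r) \<notin> G" for h r
  proof -
    define H where "H = {(\<lambda>z. g z + t * h z, s + t * r) |g s t. (g, s) \<in> G \<and> 0 \<le> t}"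
    have HI: "(k, s) \<in> H" if "(g, s') \<in> G" "0 \<le> t" "k = (\<lambda>z. g z + t * h z)" "s = s' + t * r"
      for k g s s' t unfolding H_def using that by auto
    have "G \<subseteq> H" by (auto intro: HI[where t = 0])
    have "(h, r) \<in> H" by (rule HI[OF G_zero, of 1]) auto
    then have "H \<notin> cones" using max[OF _ \<open>G \<subseteq> H\<close>] h by auto
    moreover have "(\<lambda>z. k z + l z, s + t) \<in> H" if "(k, s) \<in> H" "(l, t) \<in> H" for k l s t
    proof -
      from that obtain g s' p g' t' p' where *: "(g, s') \<in> G" "0 \<le> p" "k = (\<lambda>z. g z + p * h z)" "s = s' + p * r"
        "(g', t') \<in> G" "0 \<le> p'" "l = (\<lambda>z. g' z + p' * h z)" "t = t' + p' * r"
        unfolding H_def by auto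
      show ?thesis by (rule HI[OF G_add[OF *(1,5)], of "p + p'"]) (auto simp: * algebra_simps)
    qed
    moreover have "(\<lambda>z. q * k z, q * s) \<in> H" if "(k, s) \<in> H" "0 \<le> q" for k s q
    proof -
      from that obtain g s' p where *: "(g, s') \<in> G" "0 \<le> p" "k = (\<lambda>z. g z + p * h z)" "s = s' + p * r"
        unfolding H_def by auto
      show ?thesis by (rule HI[OF G_scale[OF *(1) \<open>0 \<le> q\<close>], of "q * p"]) (auto simp: * that algebra_simps)
    qed
    moreover have "\<Gamma> \<subseteq> H" using \<open>G \<subseteq> H\<close> G_sub by (rule order_trans[rotated])
    ultimately have "\<not> (\<forall>s. (\<lambda>z. 0, s) \<in> H \<longrightarrow> 0 \<le> s)"
      unfolding cones_def mem_Collect_eq by blast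
    then obtain s where "(\<lambda>z. 0, s) \<in> H" "s < 0" by (auto simp: not_le)
    then obtain g s' t where *: "(g, s') \<in> G" "0 \<le> t" "(\<lambda>z. 0) = (\<lambda>z. g z + t * h z)" "s = s' + t * r"
      unfolding H_def by auto
    have g: "g z = - (t * h z)" for z using fun_cong[OF *(3), of z] by simp
    have "t \<noteq> 0"
    proof
      assume "t = 0"
      then have "g = (\<lambda>z. 0)" using g by auto
      then show False using G_proper[of s] *(1,4) \<open>t = 0\<close> \<open>s < 0\<close> by auto
    qed
    then have "t > 0" using *(2) by simp
    have "(\<lambda>z. 1 / t * g z, 1 / t * s') \<in> G" using G_scale[OF *(1), of "1 / t"] \<open>t > 0\<close> by simp
    moreover have "(\<lambda>z. 1 / t * g z) = (\<lambda>z. - h z)" using \<open>t > 0\<close> by (auto simp: g)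
    moreover have "1 / t * s' < - r" using *(4) \<open>s < 0\<close> \<open>t > 0\<close> by (simp add: field_simps)
    ultimately show ?thesis by auto
  qed
  define l where "l = (\<lambda>h. Inf {s. (h, s) \<in> G})"
  define W where "W = {h. (\<exists>s. (h, s) \<in> G) \<and> (\<exists>s. (\<lambda>z. - h z, s) \<in> G)}"
  have VW: "V \<subseteq> W" unfolding V_def W_def using G_sub by auto
  have bdd: "bdd_below {s. (h, s) \<in> G}" if "h \<in> W" for h
  proof -
    from that obtain s' where s': "(\<lambda>z. - h z, s') \<in> G" unfolding W_def by auto
    have "- s' \<le> s" if "(h, s) \<in> G" for s
    proof -
      have "(\<lambda>z. 0, s + s') \<in> G" using G_add[OF that s'] by simp
      from G_proper[OF this] show ?thesis by simp
    qed
    then show ?thesis by (intro bdd_belowI[of _ "- s'"]) auto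
  qed
  have l_le: "l h \<le> s" if "h \<in> W" "(h, s) \<in> G" for h s
    unfolding l_def using that bdd by (intro cInf_lower) auto
  have l_ge: "r \<le> l h" if "h \<in> W" "\<And>s. (h, s) \<in> G \<Longrightarrow> r \<le> s" for h r
    unfolding l_def using that by (intro cInf_greatest) (auto simp: W_def)
  have W_add: "(\<lambda>z. h z + g z) \<in> W" if "h \<in> W" "g \<in> W" for h g
  proof -
    from that obtain s t s' t' where "(h, s) \<in> G" "(g, t) \<in> G" "(\<lambda>z. - h z, s') \<in> G" "(\<lambda>z. - g z, t') \<in> G"
      unfolding W_def by auto
    from G_add[OF this(1,2)] G_add[OF this(3,4)] show ?thesis unfolding W_def by auto
  qed
  have W_neg: "(\<lambda>z. - h z) \<in> W" if "h \<in> W" for h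
    using that unfolding W_def by auto
  have W_scale: "(\<lambda>z. r * h z) \<in> W" if "h \<in> W" "0 \<le> r" for h r
  proof -
    from that obtain s s' where "(h, s) \<in> G" "(\<lambda>z. - h z, s') \<in> G" unfolding W_def by auto
    from G_scale[OF this(1) \<open>0 \<le> r\<close>] G_scale[OF this(2) \<open>0 \<le> r\<close>] show ?thesis unfolding W_def by auto
  qed
  have sub: "l (\<lambda>z. h z + g z) \<le> l h + l g" if hg: "h \<in> W" "g \<in> W" for h g
  proof -
    have "l (\<lambda>z. h z + g z) - t \<le> l h" if t: "(g, t) \<in> G" for t
    proof (rule l_ge[OF hg(1)])
      fix s assume "(h, s) \<in> G"
      from l_le[OF W_add[OF hg] G_add[OF this t]] show "l (\<lambda>z. h z + g z) - t \<le> s" by simp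
    qed
    then have "l (\<lambda>z. h z + g z) - l h \<le> l g" by (intro l_ge hg) (simp add: algebra_simps)
    then show ?thesis by simp
  qed
  have zero_W: "(\<lambda>z. 0) \<in> W" using G_zero unfolding W_def by auto
  have l0: "l (\<lambda>z. 0) = 0"
    by (intro antisym l_le[OF zero_W G_zero] l_ge[OF zero_W] G_proper)
  \<comment> \<open>Sublinearity yields only one inequality; \<open>total\<close> supplies the other
    and thus turns the sublinear \<open>l\<close> into a linear one.\<close>
  have neg: "l (\<lambda>z. - h z) = - l h" if h: "h \<in> W" for h
  proof (rule antisym)
    have "l (\<lambda>z. - h z) \<le> - r" if "r < l h" for r
    proof -
      have "(h, r) \<notin> G" using l_le[OF h, of r] that by auto
      then obtain s where "s < - r" "(\<lambda>z. - h z, s) \<in> G" using total by blast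
      then show ?thesis using l_le[OF W_neg[OF h], of s] by simp
    qed
    then have "r \<le> - l (\<lambda>z. - h z)" if "r < l h" for r using that by (simp add: le_minus_iff)
    then show "l (\<lambda>z. - h z) \<le> - l h" using dense_le[of "l h" "- l (\<lambda>z. - h z)"] by simp
    show "- l h \<le> l (\<lambda>z. - h z)" using sub[OF h W_neg[OF h]] l0 by simp
  qed
  have l_add: "l (\<lambda>z. h z + g z) = l h + l g" if hg: "h \<in> W" "g \<in> W" for h g
  proof (rule antisym[OF sub[OF hg]])
    have "l (\<lambda>z. (h z + g z) + - g z) \<le> l (\<lambda>z. h z + g z) + l (\<lambda>z. - g z)"
      by (intro sub W_add W_neg hg)
    then show "l h + l g \<le> l (\<lambda>z. h z + g z)" using neg[OF hg(2)] by simp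
  qed
  have le_scale: "l (\<lambda>z. r * h z) \<le> r * l h" if h: "h \<in> W" "0 < r" for h r
  proof -
    have "1 / r * l (\<lambda>z. r * h z) \<le> l h"
    proof (rule l_ge[OF h(1)])
      fix s assume "(h, s) \<in> G"
      from l_le[OF W_scale[OF h(1), of r] G_scale[OF this, of r]] h(2)
      show "1 / r * l (\<lambda>z. r * h z) \<le> s" by (simp add: field_simps)
    qed
    then show ?thesis using h(2) by (simp add: field_simps)
  qed
  have pos_scale: "l (\<lambda>z. r * h z) = r * l h" if h: "h \<in> W" "0 \<le> r" for h r
  proof (cases "r = 0")
    case False
    then have r: "0 < r" using h by simp
    have "l (\<lambda>z. (1 / r) * (r * h z)) \<le> (1 / r) * l (\<lambda>z. r * h z)"
      by (rule le_scale) (use r h W_scale in auto)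
    then have "r * l h \<le> l (\<lambda>z. r * h z)" using r by (simp add: field_simps)
    then show ?thesis using le_scale[OF h(1) r] by simp
  qed (simp add: l0)
  have all_scale: "l (\<lambda>z. r * h z) = r * l h" if h: "h \<in> W" for h r
  proof (cases "0 \<le> r")
    case False
    then show ?thesis using pos_scale[OF W_neg[OF h], of "- r"] neg[OF h] by simp
  qed (use pos_scale h in auto)
  show ?thesis
  proof (intro exI[of _ l] conjI ballI allI impI)
    show "l (\<lambda>z. h z + g z) = l h + l g" if "h \<in> V" "g \<in> V" for h g using that VW l_add by auto
    show "l (\<lambda>z. r * h z) = r * l h" if "h \<in> V" for h r using that VW all_scale by auto
    show "l h \<le> s" if "h \<in> V" "(h, s) \<in> \<Gamma>" for h s using that VW l_le G_sub by auto
  qed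
qed

section \<open>Banach lattices of measurable functions\<close>

lemma ennreal_SUP_min_nat: "(SUP n::nat. min x (ennreal (real (Suc n)))) = x" for x :: ennreal
proof (rule antisym)
  show "x \<le> (SUP n::nat. min x (ennreal (real (Suc n))))"
  proof (rule dense_le)
    fix y assume "y < x"
    then obtain r where r: "y = ennreal r" "0 \<le> r" by (cases y) auto
    obtain n where "r \<le> real n" using real_arch_simple by blast
    then have "y \<le> ennreal (real (Suc n))" unfolding r by (intro ennreal_leI) simp
    then have "y \<le> min x (ennreal (real (Suc n)))" using \<open>y < x\<close> by simp
    then show "y \<le> (SUP n::nat. min x (ennreal (real (Suc n))))" by (rule SUP_upper2[rotated]) simp
  qed
qed (auto intro: SUP_least)

lemma ennreal_double_sum:
  "0 \<le> x \<Longrightarrow> 0 \<le> y \<Longrightarrow> 2 * ennreal x + 2 * ennreal y = ennreal (2 * x + 2 * y)"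
  by (simp add: ennreal_plus ennreal_mult)

lemma ennreal_le_by_eps_mult:
  fixes x y b :: ennreal
  assumes "\<And>e::real. 0 < e \<Longrightarrow> x \<le> y + ennreal e * b" and "b < \<infinity>"
  shows "x \<le> y"
proof (rule ennreal_le_epsilon)
  fix e :: real assume "0 < e"
  obtain r where r: "b = ennreal r" "0 \<le> r" using assms(2) by (cases b) auto
  have "x \<le> y + ennreal (e / (r + 1)) * b" using assms(1) \<open>0 < e\<close> r(2) by simp
  also have "ennreal (e / (r + 1)) * b \<le> ennreal e"
    using \<open>0 < e\<close> r by (simp flip: ennreal_mult add: field_simps ennreal_leI)
  finally show "x \<le> y + ennreal e" by (simp add: add_left_mono)
qed

text \<open>The bound \<open>1 \<le> c\<close> is a normalisation that permits division by
  \<open>c^2\<close>: a constant of 2-convexity may be enlarged, and the final interpretation uses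
  \<open>max c 1\<close>.\<close>

locale convex_lattice = sigma_finite_measure M for M :: "'a measure" +
  fixes X :: "('a \<Rightarrow> 'k::{real_normed_field,euclidean_space}) set"
    and N :: "('a \<Rightarrow> 'k) \<Rightarrow> real" and c :: real
  assumes lattice: "banach_lattice M X N"
    and convex: "two_convex X N c"
    and oc_norm: "order_continuous_norm M X N"
    and fatou: "fatou_property M X N"
    and c_ge_1: "1 \<le> c"
begin

lemma X_measurable [measurable_dest]: "f \<in> X \<Longrightarrow> f \<in> borel_measurable M"
  using lattice unfolding banach_lattice_def by blast

lemma X_zero: "(\<lambda>_. 0) \<in> X"
  and X_add: "f \<in> X \<Longrightarrow> g \<in> X \<Longrightarrow> (\<lambda>z. f z + g z) \<in> X"
  and X_scale: "f \<in> X \<Longrightarrow> (\<lambda>z. a * f z) \<in> X"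
  and N_scale: "f \<in> X \<Longrightarrow> N (\<lambda>z. a * f z) = norm a * N f"
  and N_nonneg: "f \<in> X \<Longrightarrow> 0 \<le> N f"
  and N_eq_0: "f \<in> X \<Longrightarrow> N f = 0 \<Longrightarrow> AE z in M. f z = 0"
  using lattice unfolding banach_lattice_def by blast+

lemma X_ideal: "g \<in> X \<Longrightarrow> f \<in> borel_measurable M \<Longrightarrow> AE z in M. norm (f z) \<le> norm (g z) \<Longrightarrow> f \<in> X"
  and N_mono: "g \<in> X \<Longrightarrow> f \<in> borel_measurable M \<Longrightarrow> AE z in M. norm (f z) \<le> norm (g z) \<Longrightarrow> N f \<le> N g"
proof -
  have "\<forall>g\<in>X. \<forall>f\<in>borel_measurable M. (AE z in M. norm (f z) \<le> norm (g z)) \<longrightarrow> f \<in> X \<and> N f \<le> N g"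
    using lattice unfolding banach_lattice_def by (elim conjE)
  then show "g \<in> X \<Longrightarrow> f \<in> borel_measurable M \<Longrightarrow> AE z in M. norm (f z) \<le> norm (g z) \<Longrightarrow> f \<in> X"
    "g \<in> X \<Longrightarrow> f \<in> borel_measurable M \<Longrightarrow> AE z in M. norm (f z) \<le> norm (g z) \<Longrightarrow> N f \<le> N g"
    by blast+
qed

lemma N_cong_norm:
  assumes f: "f \<in> X" and g: "g \<in> borel_measurable M" and eq: "AE z in M. norm (f z) = norm (g z)"
  shows "g \<in> X" "N g = N f"
proof -
  show g': "g \<in> X" by (rule X_ideal[OF f g]) (use eq in auto)
  show "N g = N f"
    by (intro antisym N_mono f g g' X_measurable) (use eq in auto)
qed

lemma X_norm: "f \<in> X \<Longrightarrow> (\<lambda>z. of_real (norm (f z))) \<in> X"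
  and N_norm: "f \<in> X \<Longrightarrow> N (\<lambda>z. of_real (norm (f z))) = N f"
proof -
  assume f: "f \<in> X"
  have m: "(\<lambda>z. of_real (norm (f z)) :: 'k) \<in> borel_measurable M"
    using f by measurable
  show "(\<lambda>z. of_real (norm (f z))) \<in> X" "N (\<lambda>z. of_real (norm (f z))) = N f"
    by (rule N_cong_norm[OF f m], simp)+
qed

lemma X_sum: "finite I \<Longrightarrow> (\<And>i. i \<in> I \<Longrightarrow> f i \<in> X) \<Longrightarrow> (\<lambda>z. \<Sum>i\<in>I. f i z) \<in> X"
  by (induction I rule: finite_induct) (auto intro: X_add X_zero)

section \<open>Square functions of finite families in \<open>X\<close>\<close>

definition ssq :: "nat \<Rightarrow> (nat \<Rightarrow> 'a \<Rightarrow> 'k) \<Rightarrow> 'a \<Rightarrow> real" where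
  "ssq n f z = sqrt (\<Sum>j<n. (norm (f j z))\<^sup>2)"

lemma ssq_nonneg: "0 \<le> ssq n f z"
  unfolding ssq_def by (simp add: sum_nonneg)

lemma ssq_square: "(ssq n f z)\<^sup>2 = (\<Sum>j<n. (norm (f j z))\<^sup>2)"
  unfolding ssq_def by (simp add: sum_nonneg)

lemma norm_le_ssq: "j < n \<Longrightarrow> norm (f j z) \<le> ssq n f z"
  unfolding ssq_def by (rule real_le_rsqrt) (auto intro: member_le_sum)

lemma ssq_le_sum: "ssq n f z \<le> (\<Sum>j<n. norm (f j z))"
  using L2_set_le_sum[of "{..<n}" "\<lambda>j. norm (f j z)"] unfolding ssq_def L2_set_def by simp

lemma X_ssq:
  assumes "\<And>j. j < n \<Longrightarrow> f j \<in> X"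
  shows "(\<lambda>z. of_real (ssq n f z)) \<in> X"
proof (rule X_ideal)
  show "(\<lambda>z. \<Sum>j<n. of_real (norm (f j z))) \<in> X"
    by (rule X_sum) (auto intro: X_norm assms)
  show "(\<lambda>z. of_real (ssq n f z) :: 'k) \<in> borel_measurable M"
  proof -
    have "(\<lambda>z. \<Sum>j<n. (norm (f j z))\<^sup>2) \<in> borel_measurable M"
      by (intro borel_measurable_sum borel_measurable_power measurable_compose[OF _ borel_measurable_norm] X_measurable assms) auto
    from measurable_compose[OF measurable_compose[OF this borel_measurable_sqrt] borel_measurable_of_real]
    show ?thesis unfolding ssq_def .
  qed
  show "AE z in M. norm (of_real (ssq n f z) :: 'k) \<le> norm (\<Sum>j<n. of_real (norm (f j z)) :: 'k)"
    using ssq_le_sum by (simp add: ssq_nonneg sum_nonneg flip: of_real_sum)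
qed

lemma N_ssq:
  assumes "\<And>j. j < n \<Longrightarrow> f j \<in> X"
  shows "(N (\<lambda>z. of_real (ssq n f z)))\<^sup>2 \<le> c\<^sup>2 * (\<Sum>j<n. (N (f j))\<^sup>2)"
proof -
  have "N (\<lambda>z. of_real (ssq n f z)) \<le> c * sqrt (\<Sum>j<n. (N (f j))\<^sup>2)"
    using convex assms unfolding two_convex_def ssq_def by blast
  from power_mono[OF this N_nonneg[OF X_ssq[OF assms]], of 2]
  show ?thesis by (simp add: power_mult_distrib sum_nonneg)
qed

lemma X_indicator_Un:
  assumes "(\<lambda>z. of_real (indicator A z)) \<in> X" "(\<lambda>z. of_real (indicator B z)) \<in> X"
    and "A \<in> sets M" "B \<in> sets M"
  shows "(\<lambda>z. of_real (indicator (A \<union> B) z)) \<in> X"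
proof (rule X_ideal[OF X_add[OF assms(1,2)]])
  show "AE z in M. norm (of_real (indicator (A \<union> B) z) :: 'k)
      \<le> norm (of_real (indicator A z) + of_real (indicator B z) :: 'k)"
    by (auto simp: indicator_def norm_of_real simp flip: of_real_add)
qed (use assms in measurable)

text \<open>\<open>X\<close> is not assumed to have full support, so its support is found by
  maximality. Sets of finite measure with indicator in \<open>X\<close> are closed under finite
  unions; a sequence of them is chosen whose union is as large as possible for a finite measure
  \<open>P\<close> with the same null sets as \<open>M\<close>. A further such set disjoint from
  this union must be null, and the part of a set \<open>|f| > 1 / (k + 1)\<close> that lies off the
  union and inside a set of finite measure is of this kind.\<close>

lemma exhaustion:
  obtains A :: "nat \<Rightarrow> 'a set"
  where "incseq A" "\<And>n. A n \<in> sets M" "\<And>n. emeasure M (A n) < \<infinity>"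
    "\<And>n. (\<lambda>z. of_real (indicator (A n) z)) \<in> X"
    "\<And>f. f \<in> X \<Longrightarrow> AE z in M. z \<notin> (\<Union>n. A n) \<longrightarrow> f z = 0"
proof -
  obtain p where p [measurable]: "p \<in> borel_measurable M" and p_fin: "integral\<^sup>N M p \<noteq> \<infinity>"
    and p_pos: "\<And>z. z \<in> space M \<Longrightarrow> 0 < p z"
    using Ex_finite_integrable_function by blast
  define P where "P = density M p"
  have sP [simp, measurable_cong]: "sets P = sets M" "space P = space M" unfolding P_def by simp_all
  have P_fin: "emeasure P (space M) < \<infinity>"
    using p_fin unfolding P_def by (subst emeasure_density) (auto simp: top.not_eq_extremum cong: nn_integral_cong)
  have P_fin': "emeasure P B < \<infinity>" if "B \<in> sets M" for B
    using emeasure_mono[of B "space M" P] sets.sets_into_space[OF that] P_fin by (auto intro: le_less_trans)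
  define \<S> where "\<S> = {B \<in> sets M. emeasure M B < \<infinity> \<and> (\<lambda>z. of_real (indicator B z)) \<in> X}"
  have empty: "{} \<in> \<S>" unfolding \<S>_def using X_zero by simp
  have Un: "B \<union> C \<in> \<S>" if "B \<in> \<S>" "C \<in> \<S>" for B C
  proof -
    have "emeasure M (B \<union> C) \<le> emeasure M B + emeasure M C"
      using that unfolding \<S>_def by (intro emeasure_subadditive) auto
    also have "\<dots> < \<infinity>" using that unfolding \<S>_def by simp
    finally show ?thesis using that X_indicator_Un[of B C] unfolding \<S>_def by auto
  qed
  obtain b :: "nat \<Rightarrow> ennreal" where b: "range b \<subseteq> emeasure P ` \<S>" "Sup (emeasure P ` \<S>) = (SUP n. b n)"
    using ennreal_SUP_countable_SUP[of \<S> "emeasure P"] empty by auto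
  then have "\<forall>n. \<exists>B\<in>\<S>. b n = emeasure P B" by auto
  then obtain B where B: "\<And>n. B n \<in> \<S>" "\<And>n. b n = emeasure P (B n)" by metis
  define A where "A n = (\<Union>i\<le>n. B i)" for n
  have A: "A n \<in> \<S>" for n
    by (induction n) (auto simp: A_def atMost_Suc B intro: Un)
  have inc: "incseq A" unfolding A_def by (intro monoI) (auto intro: order_trans)
  have A_meas: "A n \<in> sets M" for n using A unfolding \<S>_def by auto
  define E where "E = (\<Union>n. A n)"
  have E_meas: "E \<in> sets M" unfolding E_def using A_meas by auto
  have sup_le: "emeasure P C \<le> emeasure P E" if "C \<in> \<S>" for C
  proof -
    have "emeasure P C \<le> Sup (emeasure P ` \<S>)" using that by (auto intro: Sup_upper)
    also have "\<dots> = (SUP n. emeasure P (B n))" using b B by simp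
    also have "\<dots> \<le> emeasure P E"
      using E_meas by (intro SUP_least emeasure_mono) (auto simp: E_def A_def)
    finally show ?thesis .
  qed
  have null: "emeasure M D = 0" if D: "D \<in> \<S>" "D \<inter> E = {}" for D
  proof -
    have D_meas: "D \<in> sets M" using D unfolding \<S>_def by auto
    have "emeasure P (A n \<union> D) \<le> emeasure P E" for n by (intro sup_le Un A D)
    moreover have "(\<lambda>n. emeasure P (A n \<union> D)) \<longlonglongrightarrow> emeasure P (\<Union>n. A n \<union> D)"
      using inc A_meas D_meas by (intro Lim_emeasure_incseq) (auto simp: incseq_def)
    ultimately have "emeasure P (\<Union>n. A n \<union> D) \<le> emeasure P E" using LIMSEQ_le_const2 by blast
    also have "(\<Union>n. A n \<union> D) = E \<union> D" unfolding E_def by auto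
    also have "emeasure P (E \<union> D) = emeasure P E + emeasure P D"
      using D E_meas D_meas by (intro plus_emeasure[symmetric]) auto
    finally have "emeasure P D = 0"
      using P_fin'[OF E_meas] by (cases "emeasure P E"; cases "emeasure P D") (auto simp: top_unique simp flip: ennreal_plus)
    then have "AE z in M. z \<in> D \<longrightarrow> p z = 0"
      unfolding P_def using D_meas by (subst (asm) emeasure_density) (auto simp: nn_integral_0_iff_AE indicator_def)
    then have "AE z in M. z \<notin> D" using AE_space by eventually_elim (metis p_pos less_irrefl)
    then show ?thesis using D_meas by (simp add: AE_iff_null[where P = "\<lambda>z. z \<notin> D"] null_sets_def Int_def[symmetric])
  qed
  obtain F :: "nat \<Rightarrow> 'a set" where F: "range F \<subseteq> sets M" "(\<Union>i. F i) = space M" "\<And>i. emeasure M (F i) \<noteq> \<infinity>"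
    using sigma_finite by blast
  have "AE z in M. z \<notin> E \<longrightarrow> f z = 0" if f: "f \<in> X" for f
  proof -
    have [measurable]: "f \<in> borel_measurable M" using f by (rule X_measurable)
    define D where "D k j = {z \<in> space M. 1 / real (Suc k) < norm (f z)} \<inter> F j - E" for k j
    have D: "D k j \<in> \<S>" for k j
    proof -
      have [measurable]: "F j \<in> sets M" "E \<in> sets M" using F(1) E_meas by auto
      have m: "D k j \<in> sets M" unfolding D_def by measurable
      have "emeasure M (D k j) \<le> emeasure M (F j)" using F(1) by (intro emeasure_mono) (auto simp: D_def)
      then have "emeasure M (D k j) < \<infinity>" using F(3)[of j] by (auto simp: less_top intro: le_less_trans)
      moreover have "(\<lambda>z. of_real (indicator (D k j) z)) \<in> X"
      proof (rule X_ideal[OF X_scale[OF f, of "of_real (real (Suc k))"]])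
        have "norm (of_real (indicator (D k j) z) :: 'k) \<le> norm (of_real (real (Suc k)) * f z)" for z
        proof (cases "z \<in> D k j")
          case True
          then have "1 / real (Suc k) < norm (f z)" by (auto simp: D_def)
          then have "1 \<le> real (Suc k) * norm (f z)" by (simp add: field_simps)
          then show ?thesis using True unfolding norm_mult norm_of_real by simp
        qed simp
        then show "AE z in M. norm (of_real (indicator (D k j) z) :: 'k) \<le> norm (of_real (real (Suc k)) * f z)"
          by simp
      qed (use m in measurable)
      ultimately show ?thesis using m unfolding \<S>_def by auto
    qed
    have "D k j \<in> null_sets M" for k j
      using null[OF D] D[of k j] unfolding \<S>_def by (auto simp: D_def null_sets_def)
    then have "AE z in M. \<forall>k j. z \<notin> D k j"
      unfolding AE_all_countable by (auto intro: AE_not_in)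
    then show ?thesis
    proof (rule AE_mp, intro AE_I2 impI)
      fix z assume z: "z \<in> space M" "\<forall>k j. z \<notin> D k j" "z \<notin> E"
      obtain j where j: "z \<in> F j" using F(2) z(1) by auto
      show "f z = 0"
      proof (rule ccontr)
        assume "f z \<noteq> 0"
        then have "0 < norm (f z)" by simp
        from reals_Archimedean[OF this] obtain k where "inverse (real (Suc k)) < norm (f z)" by blast
        then have "z \<in> D k j" using z j unfolding D_def by (simp add: inverse_eq_divide)
        then show False using z by simp
      qed
    qed
  qed
  then show thesis using that[of A] inc A unfolding \<S>_def E_def by auto
qed

end

section \<open>Order continuous functionals\<close>

context convex_lattice
begin

text \<open>The 2-concavification of \<open>X\<close>, that is, the lattice \<open>Y\<close> of the
  overview. Real functions suffice because only squares \<open>|f|^2\<close> and their combinations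
  are paired with weights. The quantity \<open>(N (sqrt |h|))^2\<close> is used in place of a norm;
  2-convexity gives its triangle inequality up to the factor \<open>c^2\<close>.\<close>

definition real_ideal :: "('a \<Rightarrow> real) set" where
  "real_ideal = {h \<in> borel_measurable M. (\<lambda>z. of_real (sqrt \<bar>h z\<bar>)) \<in> X}"

lemma real_ideal_measurable [measurable_dest]: "h \<in> real_ideal \<Longrightarrow> h \<in> borel_measurable M"
  unfolding real_ideal_def by auto

lemma real_ideal_mono:
  assumes "g \<in> real_ideal" and [measurable]: "h \<in> borel_measurable M"
    and "AE z in M. \<bar>h z\<bar> \<le> \<bar>g z\<bar>"
  shows "h \<in> real_ideal"
proof -
  have g: "(\<lambda>z. of_real (sqrt \<bar>g z\<bar>)) \<in> X" using assms unfolding real_ideal_def by auto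
  have "(\<lambda>z. of_real (sqrt \<bar>h z\<bar>)) \<in> X"
  proof (rule X_ideal[OF g])
    show "AE z in M. norm (of_real (sqrt \<bar>h z\<bar>) :: 'k) \<le> norm (of_real (sqrt \<bar>g z\<bar>) :: 'k)"
      using assms(3) by eventually_elim simp
  qed measurable
  then show ?thesis unfolding real_ideal_def by auto
qed

lemma real_ideal_of_X:
  assumes "f \<in> X"
  shows "(\<lambda>z. (norm (f z))\<^sup>2) \<in> real_ideal"
  using X_norm[OF assms] X_measurable[OF assms] unfolding real_ideal_def by simp

lemma real_ideal_add:
  assumes "h \<in> real_ideal" "g \<in> real_ideal"
  shows "(\<lambda>z. h z + g z) \<in> real_ideal"
proof -
  have m [measurable]: "h \<in> borel_measurable M" "g \<in> borel_measurable M"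
    using assms by (auto intro: real_ideal_measurable)
  have hg: "(\<lambda>z. of_real (sqrt \<bar>h z\<bar>)) \<in> X" "(\<lambda>z. of_real (sqrt \<bar>g z\<bar>)) \<in> X"
    using assms unfolding real_ideal_def by auto
  have le: "sqrt \<bar>h z + g z\<bar> \<le> sqrt \<bar>h z\<bar> + sqrt \<bar>g z\<bar>" for z
  proof -
    have "sqrt \<bar>h z + g z\<bar> \<le> sqrt (\<bar>h z\<bar> + \<bar>g z\<bar>)" by simp
    also have "\<dots> \<le> sqrt \<bar>h z\<bar> + sqrt \<bar>g z\<bar>" by (rule sqrt_add_le_add_sqrt) auto
    finally show ?thesis .
  qed
  have "(\<lambda>z. of_real (sqrt \<bar>h z + g z\<bar>)) \<in> X"
  proof (rule X_ideal[OF X_add[OF hg]])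
    show "AE z in M. norm (of_real (sqrt \<bar>h z + g z\<bar>) :: 'k)
        \<le> norm (of_real (sqrt \<bar>h z\<bar>) + of_real (sqrt \<bar>g z\<bar>) :: 'k)"
      using le by (simp flip: of_real_add)
  qed measurable
  then show ?thesis using m unfolding real_ideal_def by auto
qed

lemma real_ideal_scale:
  assumes "h \<in> real_ideal"
  shows "(\<lambda>z. r * h z) \<in> real_ideal"
proof -
  have "(\<lambda>z. of_real (sqrt \<bar>h z\<bar>)) \<in> X" using assms unfolding real_ideal_def by auto
  from X_scale[OF this, of "of_real (sqrt \<bar>r\<bar>)"] real_ideal_measurable[OF assms]
  show ?thesis unfolding real_ideal_def by (simp add: abs_mult real_sqrt_mult)
qed

lemma real_ideal_zero: "(\<lambda>_. 0) \<in> real_ideal"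
  unfolding real_ideal_def using X_zero by simp

lemma real_ideal_diff:
  assumes "h \<in> real_ideal" "g \<in> real_ideal"
  shows "(\<lambda>z. h z - g z) \<in> real_ideal"
  using real_ideal_add[OF assms(1) real_ideal_scale[OF assms(2), of "- 1"]] by simp

lemma real_ideal_indicator:
  assumes "(\<lambda>z. of_real (indicator A z)) \<in> X" "A \<in> sets M"
  shows "indicator A \<in> real_ideal"
proof -
  have "sqrt \<bar>indicator A z\<bar> = indicator A z" for z :: 'a by (auto simp: indicator_def)
  then show ?thesis using assms unfolding real_ideal_def by simp
qed

text \<open>Order continuity of \<open>N\<close> makes \<open>l\<close> continuous along sequences
  decreasing to zero, hence countably additive on indicators, and the Radon-Nikodym theorem gives
  the density. Indicators need not lie in \<open>real_ideal\<close>, so the measure is assembled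
  from the disjoint pieces \<open>D n\<close> of the support of \<open>X\<close> and is zero
  elsewhere. Positivity makes \<open>l\<close> blind to null sets, which gives absolute
  continuity.\<close>

lemma functional_density:
  fixes l :: "('a \<Rightarrow> real) \<Rightarrow> real" and \<beta> :: real
  assumes l_add: "\<And>h g. h \<in> real_ideal \<Longrightarrow> g \<in> real_ideal \<Longrightarrow> l (\<lambda>z. h z + g z) = l h + l g"
    and l_scale: "\<And>h r. h \<in> real_ideal \<Longrightarrow> l (\<lambda>z. r * h z) = r * l h"
    and l_pos: "\<And>h. h \<in> real_ideal \<Longrightarrow> AE z in M. 0 \<le> h z \<Longrightarrow> 0 \<le> l h"
    and l_bound: "\<And>h. h \<in> real_ideal \<Longrightarrow> l h \<le> \<beta> * (N (\<lambda>z. of_real (sqrt \<bar>h z\<bar>)))\<^sup>2"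
  shows "\<exists>w\<in>borel_measurable M. \<forall>h\<in>real_ideal. (\<forall>z. 0 \<le> h z) \<longrightarrow>
    (\<integral>\<^sup>+z. ennreal (h z) * w z \<partial>M) = ennreal (l h)"
proof -
  have l_diff: "l (\<lambda>z. h z - g z) = l h - l g" if "h \<in> real_ideal" "g \<in> real_ideal" for h g
    using l_add[OF that(1) real_ideal_scale[OF that(2), of "- 1"]] l_scale[OF that(2), of "- 1"] by simp
  have l_mono: "l h \<le> l g" if "h \<in> real_ideal" "g \<in> real_ideal" "AE z in M. h z \<le> g z" for h g
    using l_pos[OF real_ideal_diff[OF that(2,1)]] l_diff[OF that(2,1)] that(3) by simp
  have l_cong: "l h = l g" if "h \<in> real_ideal" "g \<in> real_ideal" "AE z in M. h z = g z" for h g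
    using that(3) by (intro antisym l_mono that(1,2)) (auto elim: eventually_mono)
  have l_zero: "l (\<lambda>_. 0) = 0" using l_scale[OF real_ideal_zero, of 0] by simp
  have l_sum: "l (\<lambda>z. \<Sum>i\<in>I. h i z) = (\<Sum>i\<in>I. l (h i)) \<and> (\<lambda>z. \<Sum>i\<in>I. h i z) \<in> real_ideal"
    if "finite I" "\<And>i. i \<in> I \<Longrightarrow> h i \<in> real_ideal" for I :: "'i set" and h
    using that by (induction I rule: finite_induct) (auto simp: l_zero l_add intro: real_ideal_zero real_ideal_add)
  have l_cont: "(\<lambda>i. l (h i)) \<longlonglongrightarrow> 0"
    if h: "\<And>i. h i \<in> real_ideal" and lim: "AE z in M. decseq (\<lambda>i. h i z) \<and> (\<lambda>i. h i z) \<longlonglongrightarrow> 0"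
    for h :: "nat \<Rightarrow> 'a \<Rightarrow> real"
  proof -
    have nn: "AE z in M. 0 \<le> h i z" for i
      using lim by eventually_elim (auto intro: decseq_ge)
    have "AE z in M. decseq (\<lambda>i. sqrt \<bar>h i z\<bar>) \<and> (\<lambda>i. sqrt \<bar>h i z\<bar>) \<longlonglongrightarrow> 0"
      using lim
    proof eventually_elim
      case (elim z)
      have "0 \<le> h i z" for i using elim by (auto intro: decseq_ge)
      then have "decseq (\<lambda>i. sqrt \<bar>h i z\<bar>)" using elim by (auto simp: decseq_def)
      moreover have "(\<lambda>i. sqrt \<bar>h i z\<bar>) \<longlonglongrightarrow> sqrt \<bar>0\<bar>"
        using elim by (intro tendsto_real_sqrt tendsto_rabs) auto
      ultimately show ?case by simp
    qed
    then have "(\<lambda>i. N (\<lambda>z. of_real (sqrt \<bar>h i z\<bar>))) \<longlonglongrightarrow> 0"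
      using h oc_norm[unfolded order_continuous_norm_def, rule_format, of "\<lambda>i z. sqrt \<bar>h i z\<bar>"]
      unfolding real_ideal_def by auto
    then have "(\<lambda>i. \<beta> * (N (\<lambda>z. of_real (sqrt \<bar>h i z\<bar>)))\<^sup>2) \<longlonglongrightarrow> \<beta> * 0\<^sup>2"
      by (intro tendsto_intros)
    then have "(\<lambda>i. \<beta> * (N (\<lambda>z. of_real (sqrt \<bar>h i z\<bar>)))\<^sup>2) \<longlonglongrightarrow> 0" by simp
    show ?thesis
      by (rule tendsto_sandwich[OF _ _ tendsto_const \<open>(\<lambda>i. \<beta> * (N (\<lambda>z. of_real (sqrt \<bar>h i z\<bar>)))\<^sup>2) \<longlonglongrightarrow> 0\<close>])
        (auto intro!: always_eventually l_bound h l_pos nn)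
  qed
  have sub_ind: "indicator B \<in> real_ideal"
    if "indicator C \<in> real_ideal" "B \<in> sets M" "B \<subseteq> C" for B C :: "'a set"
    using that by (intro real_ideal_mono[OF that(1)]) (auto simp: indicator_def)
  have disj: "(\<Sum>i. ennreal (l (indicator (B i)))) = ennreal (l (indicator (\<Union>i. B i)))"
    if B: "range B \<subseteq> sets M" "disjoint_family B" "indicator (\<Union>i. B i) \<in> real_ideal" for B :: "nat \<Rightarrow> 'a set"
  proof -
    define U where "U = (\<Union>i. B i)"
    have Bm: "B i \<in> sets M" for i using B by auto
    have Um: "U \<in> sets M" unfolding U_def using B by auto
    have U: "indicator U \<in> real_ideal" using B(3) unfolding U_def .
    have Bi: "indicator (B i) \<in> real_ideal" for i by (rule sub_ind[OF U Bm]) (auto simp: U_def)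
    \<comment> \<open>Tails of the disjoint union: their indicators decrease to zero, so
      \<open>l_cont\<close> upgrades finite to countable additivity.\<close>
    define R where "R k = U - (\<Union>i<k. B i)" for k
    have Rm: "R k \<in> sets M" for k unfolding R_def using Um Bm by auto
    have Ri: "indicator (R k) \<in> real_ideal" for k by (rule sub_ind[OF U Rm]) (auto simp: R_def)
    have part: "l (indicator U) - l (indicator (R k)) = (\<Sum>i<k. l (indicator (B i)))" for k
    proof -
      have "(\<Sum>i<k. indicator (B i) z) = (indicator U z - indicator (R k) z :: real)" for z
      proof -
        have "(\<Sum>i<k. indicator (B i) z) = (indicator (\<Union>i<k. B i) z :: real)"
          using B(2) by (intro indicator_UN_disjoint[symmetric]) (auto simp: disjoint_family_on_def)
        also have "\<dots> = indicator U z - indicator (R k) z"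
          unfolding R_def by (auto simp: indicator_def U_def)
        finally show ?thesis .
      qed
      then have "(\<lambda>z. indicator U z - indicator (R k) z) = (\<lambda>z. \<Sum>i<k. indicator (B i) z :: real)" by auto
      then show ?thesis using l_diff[OF U Ri[of k]] l_sum[of "{..<k}" "\<lambda>i. indicator (B i)"] Bi by simp
    qed
    have "(\<lambda>k. l (indicator (R k))) \<longlonglongrightarrow> 0"
    proof (rule l_cont[OF Ri], intro AE_I2 conjI)
      fix z
      show "decseq (\<lambda>k. indicator (R k) z :: real)"
        by (intro monotoneI) (auto simp: R_def indicator_def)
      show "(\<lambda>k. indicator (R k) z :: real) \<longlonglongrightarrow> 0"
      proof (cases "z \<in> U")
        case True
        then obtain i where "z \<in> B i" unfolding U_def by auto
        then have "\<And>k. Suc i \<le> k \<Longrightarrow> z \<notin> R k" unfolding R_def by auto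
        then have "\<forall>\<^sub>F k in sequentially. indicator (R k) z = (0 :: real)"
          unfolding eventually_sequentially by (intro exI[of _ "Suc i"]) auto
        then show ?thesis by (rule tendsto_eventually)
      qed (auto simp: R_def)
    qed
    then have "(\<lambda>k. l (indicator U) - l (indicator (R k))) \<longlonglongrightarrow> l (indicator U) - 0"
      by (intro tendsto_intros)
    then have "(\<lambda>i. l (indicator (B i))) sums l (indicator U)"
      unfolding sums_def part by simp
    then show ?thesis
      unfolding U_def[symmetric] by (intro suminf_ennreal_eq) (auto intro!: l_pos Bi)
  qed
  obtain A where A: "incseq A" "\<And>n. A n \<in> sets M" "\<And>n. (\<lambda>z. of_real (indicator (A n) z)) \<in> X"
    "\<And>f. f \<in> X \<Longrightarrow> AE z in M. z \<notin> (\<Union>n. A n) \<longrightarrow> f z = 0"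
    by (rule exhaustion) blast
  define D where "D = disjointed A"
  have D_meas: "D n \<in> sets M" for n
    unfolding D_def using sets.range_disjointed_sets[of A M] A(2) by auto
  have D_disj: "disjoint_family D" unfolding D_def by (rule disjoint_family_disjointed)
  have D_UN: "(\<Union>n. D n) = (\<Union>n. A n)" unfolding D_def by (rule UN_disjointed_eq)
  have D_ind: "indicator (B \<inter> D n) \<in> real_ideal" if "B \<in> sets M" for B n
    by (rule sub_ind[OF real_ideal_indicator[OF A(3,2)[of n]]])
      (use that D_meas in \<open>auto simp: D_def disjointed_def\<close>)
  define m where "m B = (\<Sum>n. ennreal (l (indicator (B \<inter> D n))))" for B
  define Q where "Q = measure_of (space M) (sets M) m"
  have Q_sets: "sets Q = sets M" and Q_space: "space Q = space M" unfolding Q_def by simp_all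
  have "countably_additive (sets M) m"
    unfolding countably_additive_def
  proof safe
    fix B :: "nat \<Rightarrow> 'a set" assume B: "range B \<subseteq> sets M" "disjoint_family B"
    have swap: "(\<Sum>i. \<Sum>n. t i n) = (\<Sum>n. \<Sum>i. t i n)" for t :: "nat \<Rightarrow> nat \<Rightarrow> ennreal"
      using nn_integral_suminf[of "\<lambda>n i. t i n" "count_space UNIV"]
      by (simp add: nn_integral_count_space_nat)
    have "(\<Sum>i. m (B i)) = (\<Sum>n. \<Sum>i. ennreal (l (indicator (B i \<inter> D n))))"
      unfolding m_def by (rule swap)
    also have "\<dots> = (\<Sum>n. ennreal (l (indicator (\<Union>i. B i \<inter> D n))))"
    proof (intro suminf_cong disj)
      fix n
      show "range (\<lambda>i. B i \<inter> D n) \<subseteq> sets M" using B D_meas by auto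
      show "disjoint_family (\<lambda>i. B i \<inter> D n)" using B(2) by (auto simp: disjoint_family_on_def)
      have "(\<Union>i. B i) \<in> sets M" using B by auto
      from D_ind[OF this] show "indicator (\<Union>i. B i \<inter> D n) \<in> real_ideal" by simp
    qed
    also have "\<dots> = m (\<Union>i. B i)" unfolding m_def by simp
    finally show "(\<Sum>i. m (B i)) = m (\<Union>i. B i)" .
  qed
  moreover have "positive (sets M) m"
  proof -
    have "indicator {} = (\<lambda>_::'a. 0 :: real)" by (simp add: fun_eq_iff)
    then show ?thesis unfolding positive_def m_def by (simp add: l_zero)
  qed
  ultimately have Q_m: "emeasure Q B = m B" if "B \<in> sets M" for B
    unfolding Q_def using that by (intro emeasure_measure_of_sigma sets.sigma_algebra_axioms)
  \<comment> \<open>\<open>Q\<close> only sees \<open>C \<inter> (\<Union>n. A n)\<close>. Nothing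
    is lost, because an indicator in \<open>real_ideal\<close> vanishes a.e. off the support of
    \<open>X\<close>.\<close>
  have Q_ind: "emeasure Q C = ennreal (l (indicator C))"
    if C: "C \<in> sets M" "indicator C \<in> real_ideal" for C
  proof -
    have UN: "(\<Union>n. C \<inter> D n) = C \<inter> (\<Union>n. A n)" using D_UN by auto
    have CA: "indicator (C \<inter> (\<Union>n. A n)) \<in> real_ideal"
      by (rule sub_ind[OF C(2)]) (use C(1) A(2) in auto)
    have "emeasure Q C = ennreal (l (indicator (\<Union>n. C \<inter> D n)))"
      unfolding Q_m[OF C(1)] m_def
      by (rule disj) (use C D_meas D_disj CA UN in \<open>auto simp: disjoint_family_on_def\<close>)
    also have "l (indicator (\<Union>n. C \<inter> D n)) = l (indicator C)"
      unfolding UN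
    proof (rule l_cong[OF CA C(2)])
      have "AE z in M. z \<notin> (\<Union>n. A n) \<longrightarrow> (of_real (sqrt \<bar>indicator C z\<bar>) :: 'k) = 0"
        by (rule A(4)) (use C in \<open>auto simp: real_ideal_def\<close>)
      then show "AE z in M. indicator (C \<inter> (\<Union>n. A n)) z = (indicator C z :: real)"
        by eventually_elim (auto simp: indicator_def split: if_splits)
    qed
    finally show ?thesis .
  qed
  have "absolutely_continuous M Q"
    unfolding absolutely_continuous_def
  proof safe
    fix B assume B: "B \<in> null_sets M"
    then have Bm: "B \<in> sets M" by auto
    have "AE z in M. z \<notin> B" using B by (rule AE_not_in)
    then have "AE z in M. indicator (B \<inter> D n) z = (0::real)" for n
      by eventually_elim (auto simp: indicator_def)
    then have "l (indicator (B \<inter> D n)) = 0" for n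
      using l_cong[OF D_ind[OF Bm] real_ideal_zero] l_zero by simp
    then have "emeasure Q B = 0" using Q_m[OF Bm] by (simp add: m_def)
    then show "B \<in> null_sets Q" using Bm Q_sets by (auto simp: null_sets_def)
  qed
  from Radon_Nikodym[OF this Q_sets] obtain w where w [measurable]: "w \<in> borel_measurable M"
    and Q: "density M w = Q" by blast
  have "(\<integral>\<^sup>+z. ennreal (h z) * w z \<partial>M) = ennreal (l h)" if h: "h \<in> real_ideal" and nn: "\<And>z. 0 \<le> h z" for h
  proof -
    have hm [measurable]: "h \<in> borel_measurable M" using h by (rule real_ideal_measurable)
    obtain s where s: "\<And>i. simple_function M (s i)" "incseq s" "\<And>i z. s i z < top"
      "\<And>z. (SUP i. s i z) = ennreal (h z)"
      using borel_measurable_implies_simple_function_sequence'[of "\<lambda>z. ennreal (h z)" M] by auto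
    define r where "r i z = enn2real (s i z)" for i z
    have sr: "s i z = ennreal (r i z)" for i z unfolding r_def using s(3) by simp
    have r_nn: "0 \<le> r i z" for i z unfolding r_def by simp
    have r_simple: "simple_function M (r i)" for i
      unfolding r_def using simple_function_compose1[OF s(1)] .
    have r_le: "r i z \<le> h z" for i z
    proof -
      have "ennreal (r i z) \<le> ennreal (h z)" unfolding sr[symmetric] s(4)[symmetric] by (rule SUP_upper) auto
      then show ?thesis using nn by simp
    qed
    have r_meas [measurable]: "r i \<in> borel_measurable M" for i
      using r_simple by (rule borel_measurable_simple_function)
    have r_inc: "incseq (\<lambda>i. r i z)" for z
      using s(2) s(3) unfolding r_def incseq_def le_fun_def by (auto intro: enn2real_mono)
    have r_lim: "(\<lambda>i. r i z) \<longlonglongrightarrow> h z" for z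
    proof -
      have "(\<lambda>i. s i z) \<longlonglongrightarrow> ennreal (h z)"
        unfolding s(4)[symmetric] using s(2) by (intro LIMSEQ_SUP) (auto simp: incseq_def le_fun_def)
      then show ?thesis unfolding sr using r_nn nn by (simp add: tendsto_ennreal_iff)
    qed
    have r_RI: "r i \<in> real_ideal" for i
      by (rule real_ideal_mono[OF h r_meas]) (use r_le r_nn nn in auto)
    have int_r: "(\<integral>\<^sup>+z. ennreal (r i z) \<partial>Q) = ennreal (l (r i))" for i
    proof -
      define Y where "Y = r i ` space M - {0}"
      have fin: "finite Y" using r_simple[of i] unfolding Y_def simple_function_def by auto
      define C where "C y = r i -` {y} \<inter> space M" for y
      have Cm: "C y \<in> sets M" for y unfolding C_def by measurable
      have Y_pos: "0 < y" if "y \<in> Y" for y using that r_nn unfolding Y_def by (auto simp: less_le)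
      have CI: "indicator (C y) \<in> real_ideal" if "y \<in> Y" for y
      proof (rule real_ideal_mono[OF real_ideal_scale[OF h, of "1 / y"]])
        have "indicator (C y) z \<le> \<bar>1 / y * h z\<bar>" for z
          using Y_pos[OF that] r_le[of i z] by (auto simp: C_def indicator_def field_simps abs_if)
        then show "AE z in M. \<bar>indicator (C y) z\<bar> \<le> \<bar>1 / y * h z\<bar>" by simp
      qed (use Cm in measurable)
      have rep: "r i z = (\<Sum>y\<in>Y. y * indicator (C y) z)" if z: "z \<in> space M" for z
      proof -
        have "(\<Sum>y\<in>Y. y * indicator (C y) z) = (\<Sum>y\<in>Y. if y = r i z then y else 0)"
          using z by (intro sum.cong) (auto simp: C_def indicator_def)
        also have "\<dots> = r i z" using fin z by (auto simp: Y_def)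
        finally show ?thesis by simp
      qed
      have "(\<integral>\<^sup>+z. ennreal (r i z) \<partial>Q) = (\<integral>\<^sup>+z. (\<Sum>y\<in>Y. ennreal y * indicator (C y) z) \<partial>Q)"
      proof (rule nn_integral_cong)
        fix z assume "z \<in> space Q"
        then show "ennreal (r i z) = (\<Sum>y\<in>Y. ennreal y * indicator (C y) z)"
          using Y_pos unfolding Q_space
          by (subst rep) (auto simp: sum_ennreal[symmetric] ennreal_mult less_imp_le ennreal_indicator simp del: sum_ennreal intro!: sum.cong)
      qed
      also have "\<dots> = (\<Sum>y\<in>Y. ennreal y * emeasure Q (C y))"
        using Cm Q_sets by (subst nn_integral_sum) (auto simp: nn_integral_cmult_indicator)
      also have "\<dots> = (\<Sum>y\<in>Y. ennreal (y * l (indicator (C y))))"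
        using Y_pos CI by (intro sum.cong) (auto simp: Q_ind Cm ennreal_mult'' l_pos less_imp_le intro!: ennreal_mult[symmetric])
      also have "\<dots> = ennreal (\<Sum>y\<in>Y. y * l (indicator (C y)))"
        using Y_pos CI by (intro sum_ennreal) (auto intro!: mult_nonneg_nonneg l_pos simp: less_imp_le)
      also have "(\<Sum>y\<in>Y. y * l (indicator (C y))) = l (\<lambda>z. \<Sum>y\<in>Y. y * indicator (C y) z)"
        using l_sum[OF fin, of "\<lambda>y z. y * indicator (C y) z"] CI by (simp add: l_scale real_ideal_scale)
      also have "\<dots> = l (r i)"
        using l_sum[OF fin, of "\<lambda>y z. y * indicator (C y) z"] CI
        by (intro l_cong r_RI) (auto simp: real_ideal_scale rep)
      finally show ?thesis .
    qed
    \<comment> \<open>\<open>h - r i\<close> decreases to zero, so \<open>l (r i)\<close> tends to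
      \<open>l h\<close> by order continuity, while the integrals of \<open>r i\<close> converge
      monotonically to that of \<open>h\<close>.\<close>
    have "(\<lambda>i. l (\<lambda>z. h z - r i z)) \<longlonglongrightarrow> 0"
    proof (rule l_cont)
      show "(\<lambda>z. h z - r i z) \<in> real_ideal" for i by (rule real_ideal_diff[OF h r_RI])
      have "decseq (\<lambda>i. h z - r i z)" for z using r_inc by (auto simp: decseq_def incseq_def)
      moreover have "(\<lambda>i. h z - r i z) \<longlonglongrightarrow> h z - h z" for z by (intro tendsto_intros r_lim)
      ultimately show "AE z in M. decseq (\<lambda>i. h z - r i z) \<and> (\<lambda>i. h z - r i z) \<longlonglongrightarrow> 0" by simp
    qed
    then have "(\<lambda>i. l h - (l h - l (r i))) \<longlonglongrightarrow> l h - 0"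
      unfolding l_diff[OF h r_RI] by (intro tendsto_intros)
    then have lim1: "(\<lambda>i. ennreal (l (r i))) \<longlonglongrightarrow> ennreal (l h)"
      by (intro tendsto_ennrealI) simp
    have "(\<lambda>i. \<integral>\<^sup>+z. s i z \<partial>Q) \<longlonglongrightarrow> (SUP i. \<integral>\<^sup>+z. s i z \<partial>Q)"
      using s(2) by (intro LIMSEQ_SUP) (auto simp: incseq_def le_fun_def intro!: nn_integral_mono)
    also have "(SUP i. \<integral>\<^sup>+z. s i z \<partial>Q) = (\<integral>\<^sup>+z. (SUP i. s i z) \<partial>Q)"
      by (rule nn_integral_monotone_convergence_SUP[symmetric, OF s(2)])
        (simp add: measurable_cong_sets[OF Q_sets refl] borel_measurable_simple_function[OF s(1)])
    also have "\<dots> = (\<integral>\<^sup>+z. ennreal (h z) \<partial>Q)" unfolding s(4) ..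
    finally have "(\<lambda>i. ennreal (l (r i))) \<longlonglongrightarrow> (\<integral>\<^sup>+z. ennreal (h z) \<partial>Q)"
      unfolding sr int_r .
    then have "(\<integral>\<^sup>+z. ennreal (h z) \<partial>Q) = ennreal (l h)" using lim1 by (rule LIMSEQ_unique)
    moreover have "(\<integral>\<^sup>+z. ennreal (h z) \<partial>Q) = (\<integral>\<^sup>+z. w z * ennreal (h z) \<partial>M)"
      unfolding Q[symmetric] by (rule nn_integral_density) auto
    ultimately show ?thesis by (simp add: mult.commute)
  qed
  with w show ?thesis by blast
qed

end

section \<open>Existence of dual weights\<close>

lemma sum_append_families:
  fixes m n :: nat and \<phi> :: "'b \<Rightarrow> 'c::comm_monoid_add"
  shows "(\<Sum>j<n + m. \<phi> (if j < n then F j else F' (j - n))) = (\<Sum>j<n. \<phi> (F j)) + (\<Sum>j<m. \<phi> (F' j))"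
  by (induction m) (simp_all add: add.assoc)

context convex_lattice
begin

text \<open>The weight has to meet upper bounds on all of \<open>X\<close> and the lower bounds
  \<open>t\<close> listed in \<open>G\<close>. Hypothesis \<open>dom\<close> says that the lower
  bounds do not conflict with norms of square functions; 2-convexity turns this into compatibility
  with the upper bounds, at the price of the factor \<open>c^2\<close>. Separation then gives a
  positive functional between the two, and \<open>functional_density\<close> represents it by a
  weight.\<close>

lemma sandwich:
  fixes G :: "(('a \<Rightarrow> 'k) \<times> real) set" and R :: real
  assumes R: "0 \<le> R"
    and G_X: "\<And>f t. (f, t) \<in> G \<Longrightarrow> f \<in> X"
    and G_scale: "\<And>f t s. (f, t) \<in> G \<Longrightarrow> 0 \<le> s \<Longrightarrow> (\<lambda>z. of_real s * f z, s\<^sup>2 * t) \<in> G"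
    and dom: "\<And>n f t. (\<And>j. j < n \<Longrightarrow> (f j, t j) \<in> G) \<Longrightarrow>
      (\<Sum>j<n. t j) \<le> R * (N (\<lambda>z. of_real (ssq n f z)))\<^sup>2"
  shows "\<exists>w\<in>borel_measurable M.
    (\<forall>f\<in>X. (\<integral>\<^sup>+z. ennreal ((norm (f z))\<^sup>2) * w z \<partial>M) \<le> ennreal (c\<^sup>2 * R * (N f)\<^sup>2)) \<and>
    (\<forall>(f, t)\<in>G. ennreal t \<le> (\<integral>\<^sup>+z. ennreal ((norm (f z))\<^sup>2) * w z \<partial>M))"
proof -
  \<comment> \<open>All demands on \<open>l\<close> that follow from the upper bounds for
    \<open>l (|F j|^2)\<close>, the lower bounds for \<open>l (|f i|^2)\<close> and the positivity
    of \<open>l\<close>; the inequality a.e. encodes the last.\<close>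
  define \<Gamma> where "\<Gamma> = {(h, s). \<exists>(n::nat) F (m::nat) f t. (\<forall>j<n. F j \<in> X) \<and> (\<forall>i<m. (f i, t i) \<in> G) \<and>
    (AE z in M. h z \<le> (\<Sum>j<n. (norm (F j z))\<^sup>2) - (\<Sum>i<m. (norm (f i z))\<^sup>2)) \<and>
    c\<^sup>2 * R * (\<Sum>j<n. (N (F j))\<^sup>2) - (\<Sum>i<m. t i) \<le> s}"
  have \<Gamma>I: "(h, s) \<in> \<Gamma>" if "\<And>j. j < n \<Longrightarrow> F j \<in> X" "\<And>i. i < m \<Longrightarrow> (f i, t i) \<in> G"
    "AE z in M. h z \<le> (\<Sum>j<n. (norm (F j z))\<^sup>2) - (\<Sum>i<m. (norm (f i z))\<^sup>2)"
    "c\<^sup>2 * R * (\<Sum>j<n. (N (F j))\<^sup>2) - (\<Sum>i<m. t i) \<le> s" for h s and n m :: nat and F f t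
    unfolding \<Gamma>_def mem_Collect_eq prod.case
    by (intro exI[of _ n] exI[of _ F] exI[of _ m] exI[of _ f] exI[of _ t] conjI allI impI) (use that in auto)
  have \<Gamma>E: "\<exists>(n::nat) F (m::nat) f t. (\<forall>j<n. F j \<in> X) \<and> (\<forall>i<m. (f i, t i) \<in> G) \<and>
    (AE z in M. h z \<le> (\<Sum>j<n. (norm (F j z))\<^sup>2) - (\<Sum>i<m. (norm (f i z))\<^sup>2)) \<and>
    c\<^sup>2 * R * (\<Sum>j<n. (N (F j))\<^sup>2) - (\<Sum>i<m. t i) \<le> s" if "(h, s) \<in> \<Gamma>" for h s
    using that unfolding \<Gamma>_def mem_Collect_eq prod.case .
  have add: "(\<lambda>z. h z + g z, s + t) \<in> \<Gamma>" if hs: "(h, s) \<in> \<Gamma>" and gt: "(g, t) \<in> \<Gamma>" for h s g t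
  proof -
    from \<Gamma>E[OF hs] obtain n m :: nat and F f u where *: "\<forall>j<n. F j \<in> X" "\<forall>i<m. (f i, u i) \<in> G"
      "AE z in M. h z \<le> (\<Sum>j<n. (norm (F j z))\<^sup>2) - (\<Sum>i<m. (norm (f i z))\<^sup>2)"
      "c\<^sup>2 * R * (\<Sum>j<n. (N (F j))\<^sup>2) - (\<Sum>i<m. u i) \<le> s" by blast
    note 1 = *[rule_format]
    from \<Gamma>E[OF gt] obtain n' m' :: nat and F' f' u' where *: "\<forall>j<n'. F' j \<in> X" "\<forall>i<m'. (f' i, u' i) \<in> G"
      "AE z in M. g z \<le> (\<Sum>j<n'. (norm (F' j z))\<^sup>2) - (\<Sum>i<m'. (norm (f' i z))\<^sup>2)"
      "c\<^sup>2 * R * (\<Sum>j<n'. (N (F' j))\<^sup>2) - (\<Sum>i<m'. u' i) \<le> t" by blast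
    note 2 = *[rule_format]
    define F2 where "F2 = (\<lambda>j. if j < n then F j else F' (j - n))"
    define f2 where "f2 = (\<lambda>j. if j < m then f j else f' (j - m))"
    define u2 where "u2 = (\<lambda>j. if j < m then u j else u' (j - m))"
    show ?thesis
    proof (rule \<Gamma>I[of "n + n'" F2 "m + m'" f2 u2])
      show "F2 j \<in> X" if "j < n + n'" for j using that 1(1) 2(1) unfolding F2_def by auto
      show "(f2 i, u2 i) \<in> G" if "i < m + m'" for i using that 1(2) 2(2) unfolding f2_def u2_def by auto
      have "(\<Sum>j<n + n'. (norm (F2 j z))\<^sup>2) = (\<Sum>j<n. (norm (F j z))\<^sup>2) + (\<Sum>j<n'. (norm (F' j z))\<^sup>2)" for z
        unfolding F2_def by (rule sum_append_families[of "\<lambda>k. (norm (k z))\<^sup>2"])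
      moreover have "(\<Sum>j<m + m'. (norm (f2 j z))\<^sup>2) = (\<Sum>j<m. (norm (f j z))\<^sup>2) + (\<Sum>j<m'. (norm (f' j z))\<^sup>2)" for z
        unfolding f2_def by (rule sum_append_families[of "\<lambda>k. (norm (k z))\<^sup>2"])
      ultimately have eq: "(\<Sum>j<n + n'. (norm (F2 j z))\<^sup>2) - (\<Sum>i<m + m'. (norm (f2 i z))\<^sup>2) =
          ((\<Sum>j<n. (norm (F j z))\<^sup>2) - (\<Sum>i<m. (norm (f i z))\<^sup>2)) +
          ((\<Sum>j<n'. (norm (F' j z))\<^sup>2) - (\<Sum>i<m'. (norm (f' i z))\<^sup>2))" for z by simp
      show "AE z in M. h z + g z \<le> (\<Sum>j<n + n'. (norm (F2 j z))\<^sup>2) - (\<Sum>i<m + m'. (norm (f2 i z))\<^sup>2)"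
        using 1(3) 2(3) unfolding eq by eventually_elim (rule add_mono)
      have "(\<Sum>j<n + n'. (N (F2 j))\<^sup>2) = (\<Sum>j<n. (N (F j))\<^sup>2) + (\<Sum>j<n'. (N (F' j))\<^sup>2)"
        unfolding F2_def by (rule sum_append_families[of "\<lambda>k. (N k)\<^sup>2"])
      moreover have "(\<Sum>j<m + m'. u2 j) = (\<Sum>j<m. u j) + (\<Sum>j<m'. u' j)"
        unfolding u2_def by (rule sum_append_families[of "\<lambda>k. k"])
      ultimately show "c\<^sup>2 * R * (\<Sum>j<n + n'. (N (F2 j))\<^sup>2) - (\<Sum>i<m + m'. u2 i) \<le> s + t"
        using 1(4) 2(4) by (simp add: algebra_simps)
    qed
  qed
  have scale: "(\<lambda>z. r * h z, r * s) \<in> \<Gamma>" if hs: "(h, s) \<in> \<Gamma>" and r: "0 \<le> r" for h s r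
  proof -
    from \<Gamma>E[OF hs] obtain n m :: nat and F f u where *: "\<forall>j<n. F j \<in> X" "\<forall>i<m. (f i, u i) \<in> G"
      "AE z in M. h z \<le> (\<Sum>j<n. (norm (F j z))\<^sup>2) - (\<Sum>i<m. (norm (f i z))\<^sup>2)"
      "c\<^sup>2 * R * (\<Sum>j<n. (N (F j))\<^sup>2) - (\<Sum>i<m. u i) \<le> s" by blast
    note 1 = *[rule_format]
    show ?thesis
    proof (rule \<Gamma>I[of n "\<lambda>j z. of_real (sqrt r) * F j z" m "\<lambda>j z. of_real (sqrt r) * f j z" "\<lambda>j. r * u j"])
      show "(\<lambda>z. of_real (sqrt r) * F j z) \<in> X" if "j < n" for j using X_scale 1(1) that by auto
      show "(\<lambda>z. of_real (sqrt r) * f i z, r * u i) \<in> G" if "i < m" for i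
        using G_scale[OF 1(2)[OF that], of "sqrt r"] r by simp
      show "AE z in M. r * h z \<le> (\<Sum>j<n. (norm (of_real (sqrt r) * F j z))\<^sup>2) - (\<Sum>i<m. (norm (of_real (sqrt r) * f i z))\<^sup>2)"
        using 1(3)
      proof eventually_elim
        case (elim z)
        from mult_left_mono[OF this r] show ?case
          using r by (simp add: norm_mult power_mult_distrib sum_distrib_left[symmetric] right_diff_distrib)
      qed
      have "(\<Sum>j<n. (N (\<lambda>z. of_real (sqrt r) * F j z))\<^sup>2) = r * (\<Sum>j<n. (N (F j))\<^sup>2)"
        unfolding sum_distrib_left using r 1(1) by (intro sum.cong) (auto simp: N_scale power_mult_distrib)
      then show "c\<^sup>2 * R * (\<Sum>j<n. (N (\<lambda>z. of_real (sqrt r) * F j z))\<^sup>2) - (\<Sum>i<m. r * u i) \<le> r * s"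
        using mult_left_mono[OF 1(4) r] by (simp add: sum_distrib_left[symmetric] algebra_simps)
    qed
  qed
  \<comment> \<open>If the demands cancel, \<open>ssq m f\<close> is dominated by
    \<open>ssq n F\<close>. The sum of the lower bounds is controlled by the norm of the former
    through \<open>dom\<close>, and the norm of the latter by the norms of the \<open>F j\<close>
    through 2-convexity.\<close>
  have proper: "0 \<le> s" if s: "(\<lambda>z. 0, s) \<in> \<Gamma>" for s
  proof -
    from \<Gamma>E[OF s] obtain n m :: nat and F f u where *: "\<forall>j<n. F j \<in> X" "\<forall>i<m. (f i, u i) \<in> G"
      "AE z in M. 0 \<le> (\<Sum>j<n. (norm (F j z))\<^sup>2) - (\<Sum>i<m. (norm (f i z))\<^sup>2)"
      "c\<^sup>2 * R * (\<Sum>j<n. (N (F j))\<^sup>2) - (\<Sum>i<m. u i) \<le> s" by blast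
    note 1 = *[rule_format]
    have fX: "f i \<in> X" if "i < m" for i using G_X 1(2) that by blast
    have "N (\<lambda>z. of_real (ssq m f z)) \<le> N (\<lambda>z. of_real (ssq n F z))"
    proof (rule N_mono)
      show "(\<lambda>z. of_real (ssq n F z)) \<in> X" by (rule X_ssq[OF 1(1)])
      show "(\<lambda>z. of_real (ssq m f z) :: 'k) \<in> borel_measurable M" by (rule X_measurable[OF X_ssq[OF fX]])
      show "AE z in M. norm (of_real (ssq m f z) :: 'k) \<le> norm (of_real (ssq n F z) :: 'k)"
        using 1(3) by eventually_elim (simp add: ssq_def sum_nonneg)
    qed
    then have "(N (\<lambda>z. of_real (ssq m f z)))\<^sup>2 \<le> (N (\<lambda>z. of_real (ssq n F z)))\<^sup>2"
      by (rule power_mono) (rule N_nonneg[OF X_ssq[OF fX]])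
    also have "\<dots> \<le> c\<^sup>2 * (\<Sum>j<n. (N (F j))\<^sup>2)" by (rule N_ssq[OF 1(1)])
    finally have "R * (N (\<lambda>z. of_real (ssq m f z)))\<^sup>2 \<le> R * (c\<^sup>2 * (\<Sum>j<n. (N (F j))\<^sup>2))"
      using R by (rule mult_left_mono)
    then show ?thesis using dom[of m f u] 1(2,4) by (simp add: algebra_simps)
  qed
  have "\<Gamma> \<noteq> {}" using \<Gamma>I[of 0 "\<lambda>_ _. 0" 0 "\<lambda>_ _. 0" "\<lambda>_. 0" "\<lambda>_. 0" 0] by auto
  define V where "V = {h. (\<exists>s. (h, s) \<in> \<Gamma>) \<and> (\<exists>s. (\<lambda>z. - h z, s) \<in> \<Gamma>)}"
  have "\<exists>l. (\<forall>h\<in>V. \<forall>g\<in>V. l (\<lambda>z. h z + g z) = l h + l g) \<and>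
    (\<forall>h\<in>V. \<forall>r. l (\<lambda>z. r * h z) = r * l h) \<and> (\<forall>h\<in>V. \<forall>s. (h, s) \<in> \<Gamma> \<longrightarrow> l h \<le> s)"
    unfolding V_def by (rule cone_separation) (fact add scale proper \<open>\<Gamma> \<noteq> {}\<close>)+
  then obtain l where l: "\<And>h g. h \<in> V \<Longrightarrow> g \<in> V \<Longrightarrow> l (\<lambda>z. h z + g z) = l h + l g"
    "\<And>h r. h \<in> V \<Longrightarrow> l (\<lambda>z. r * h z) = r * l h"
    "\<And>h s. h \<in> V \<Longrightarrow> (h, s) \<in> \<Gamma> \<Longrightarrow> l h \<le> s"
    by blast
  \<comment> \<open>The single function \<open>sqrt |h|\<close> bounds \<open>l h\<close> from
    above; applied to \<open>h\<close> and \<open>- h\<close> this puts all of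
    \<open>real_ideal\<close> into \<open>V\<close>.\<close>
  have up: "(h, c\<^sup>2 * R * (N (\<lambda>z. of_real (sqrt \<bar>h z\<bar>)))\<^sup>2) \<in> \<Gamma>" if "h \<in> real_ideal" for h
    by (rule \<Gamma>I[of 1 "\<lambda>_ z. of_real (sqrt \<bar>h z\<bar>)" 0])
      (use that in \<open>auto simp: real_ideal_def abs_le_iff\<close>)
  have neg: "(\<lambda>z. - h z) \<in> real_ideal" if "h \<in> real_ideal" for h
    using real_ideal_scale[OF that, of "- 1"] by simp
  have V: "h \<in> V" if "h \<in> real_ideal" for h
    using up[OF that] up[OF neg[OF that]] unfolding V_def by blast
  have l_neg: "l (\<lambda>z. - h z) = - l h" if "h \<in> real_ideal" for h
    using l(2)[OF V[OF that], of "- 1"] by simp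
  have "\<exists>w\<in>borel_measurable M. \<forall>h\<in>real_ideal. (\<forall>z. 0 \<le> h z) \<longrightarrow>
    (\<integral>\<^sup>+z. ennreal (h z) * w z \<partial>M) = ennreal (l h)"
  proof (rule functional_density[of l "c\<^sup>2 * R"])
    show "l (\<lambda>z. h z + g z) = l h + l g" if "h \<in> real_ideal" "g \<in> real_ideal" for h g
      using that by (intro l(1) V)
    show "l (\<lambda>z. r * h z) = r * l h" if "h \<in> real_ideal" for h r using that by (intro l(2) V)
    show "l h \<le> c\<^sup>2 * R * (N (\<lambda>z. of_real (sqrt \<bar>h z\<bar>)))\<^sup>2" if "h \<in> real_ideal" for h
      using that by (intro l(3) V up)
    show "0 \<le> l h" if h: "h \<in> real_ideal" "AE z in M. 0 \<le> h z" for h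
    proof -
      have "(\<lambda>z. - h z, 0) \<in> \<Gamma>" by (rule \<Gamma>I[of 0 _ 0]) (use h(2) in auto)
      from l(3)[OF V[OF neg[OF h(1)]] this] show ?thesis using l_neg[OF h(1)] by simp
    qed
  qed
  then obtain w where w: "w \<in> borel_measurable M"
    "\<And>h. h \<in> real_ideal \<Longrightarrow> (\<And>z. 0 \<le> h z) \<Longrightarrow> (\<integral>\<^sup>+z. ennreal (h z) * w z \<partial>M) = ennreal (l h)"
    by blast
  have rep: "(\<integral>\<^sup>+z. ennreal ((norm (f z))\<^sup>2) * w z \<partial>M) = ennreal (l (\<lambda>z. (norm (f z))\<^sup>2))" if "f \<in> X" for f
    using w(2)[OF real_ideal_of_X[OF that]] by simp
    have 1: "(\<integral>\<^sup>+z. ennreal ((norm (f z))\<^sup>2) * w z \<partial>M) \<le> ennreal (c\<^sup>2 * R * (N f)\<^sup>2)" if f: "f \<in> X" for f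
    proof -
      have "l (\<lambda>z. (norm (f z))\<^sup>2) \<le> c\<^sup>2 * R * (N f)\<^sup>2"
        using l(3)[OF V[OF real_ideal_of_X[OF f]] up[OF real_ideal_of_X[OF f]]] N_norm[OF f] by simp
      then show ?thesis unfolding rep[OF f] by (rule ennreal_leI)
    qed
    have 2: "ennreal t \<le> (\<integral>\<^sup>+z. ennreal ((norm (f z))\<^sup>2) * w z \<partial>M)" if ft: "(f, t) \<in> G" for f t
    proof -
      note f = G_X[OF ft]
      have "(\<lambda>z. - (norm (f z))\<^sup>2, - t) \<in> \<Gamma>"
        by (rule \<Gamma>I[of 0 _ 1 "\<lambda>_. f" "\<lambda>_. t"]) (use ft in auto)
      from l(3)[OF V[OF neg[OF real_ideal_of_X[OF f]]] this] 
      have "t \<le> l (\<lambda>z. (norm (f z))\<^sup>2)" using l_neg[OF real_ideal_of_X[OF f]] by simp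
      then show ?thesis unfolding rep[OF f] by (rule ennreal_leI)
    qed
  show ?thesis using w(1) 1 2 by blast
qed

text \<open>\<open>sandwich\<close> is applied to the ray through \<open>h\<close> with
  \<open>R = 1\<close>: square functions of elements of the ray are multiples of \<open>|h|\<close>,
  so \<open>dom\<close> holds with equality. Division by \<open>c^2\<close> normalises the upper
  bound and moves the loss into the lower one.\<close>

lemma norming_weight:
  assumes h: "h \<in> X"
  obtains v :: "'a \<Rightarrow> ennreal" where "v \<in> borel_measurable M"
    and "\<And>f. f \<in> X \<Longrightarrow> (\<integral>\<^sup>+z. ennreal ((norm (f z))\<^sup>2) * v z \<partial>M) \<le> ennreal ((N f)\<^sup>2)"
    and "ennreal ((N h)\<^sup>2) \<le> ennreal (c\<^sup>2) * (\<integral>\<^sup>+z. ennreal ((norm (h z))\<^sup>2) * v z \<partial>M)"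
proof -
  define G where "G = {(\<lambda>z. of_real s * h z, s\<^sup>2 * (N h)\<^sup>2) |s. 0 \<le> s}"
  have GI: "(f, t) \<in> G" if "0 \<le> s" "f = (\<lambda>z. of_real s * h z)" "t = s\<^sup>2 * (N h)\<^sup>2" for f t s
    unfolding G_def using that by blast
  have "\<exists>w\<in>borel_measurable M.
    (\<forall>f\<in>X. (\<integral>\<^sup>+z. ennreal ((norm (f z))\<^sup>2) * w z \<partial>M) \<le> ennreal (c\<^sup>2 * 1 * (N f)\<^sup>2)) \<and>
    (\<forall>(f, t)\<in>G. ennreal t \<le> (\<integral>\<^sup>+z. ennreal ((norm (f z))\<^sup>2) * w z \<partial>M))"
  proof (rule sandwich)
    show "f \<in> X" if "(f, t) \<in> G" for f t using that X_scale[OF h] unfolding G_def by auto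
    show "(\<lambda>z. of_real s * f z, s\<^sup>2 * t) \<in> G" if ft: "(f, t) \<in> G" "0 \<le> s" for f t s
    proof -
      from ft obtain r where "0 \<le> r" "f = (\<lambda>z. of_real r * h z)" "t = r\<^sup>2 * (N h)\<^sup>2" unfolding G_def by auto
      then show ?thesis using ft(2) by (intro GI[of "s * r"]) (auto simp: power_mult_distrib)
    qed
    show "(\<Sum>j<n. t j) \<le> 1 * (N (\<lambda>z. of_real (ssq n f z)))\<^sup>2" if ft: "\<And>j. j < n \<Longrightarrow> (f j, t j) \<in> G" for n f t
    proof -
      have "\<forall>j. \<exists>s. j < n \<longrightarrow> f j = (\<lambda>z. of_real s * h z) \<and> t j = s\<^sup>2 * (N h)\<^sup>2"
        using ft unfolding G_def by blast
      then obtain s where s: "\<And>j. j < n \<Longrightarrow> f j = (\<lambda>z. of_real (s j) * h z)" "\<And>j. j < n \<Longrightarrow> t j = (s j)\<^sup>2 * (N h)\<^sup>2"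
        by metis
      define \<sigma> where "\<sigma> = (\<Sum>j<n. (s j)\<^sup>2)"
      have \<sigma>: "0 \<le> \<sigma>" unfolding \<sigma>_def by (simp add: sum_nonneg)
      have "ssq n f z = sqrt \<sigma> * norm (h z)" for z
        unfolding ssq_def \<sigma>_def using s(1)
        by (simp add: norm_mult power_mult_distrib sum_distrib_right[symmetric] real_sqrt_mult)
      then have "(\<lambda>z. of_real (ssq n f z)) = (\<lambda>z. of_real (sqrt \<sigma>) * of_real (norm (h z)) :: 'k)" by simp
      then have "N (\<lambda>z. of_real (ssq n f z)) = sqrt \<sigma> * N h"
        using N_scale[OF X_norm[OF h], of "of_real (sqrt \<sigma>)"] N_norm[OF h] \<sigma> by simp
      moreover have "(\<Sum>j<n. t j) = \<sigma> * (N h)\<^sup>2"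
        unfolding \<sigma>_def sum_distrib_right using s(2) by (intro sum.cong) auto
      ultimately show ?thesis using \<sigma> by (simp add: power_mult_distrib)
    qed
    show "(0 :: real) \<le> 1" by simp
  qed
  then obtain w where w: "w \<in> borel_measurable M"
    "\<And>f. f \<in> X \<Longrightarrow> (\<integral>\<^sup>+z. ennreal ((norm (f z))\<^sup>2) * w z \<partial>M) \<le> ennreal (c\<^sup>2 * 1 * (N f)\<^sup>2)"
    "\<And>f t. (f, t) \<in> G \<Longrightarrow> ennreal t \<le> (\<integral>\<^sup>+z. ennreal ((norm (f z))\<^sup>2) * w z \<partial>M)"
    by blast
  have c0: "0 < c\<^sup>2" using c_ge_1 by simp
  define v where "v z = ennreal (1 / c\<^sup>2) * w z" for z
  have v_int: "(\<integral>\<^sup>+z. ennreal ((norm (f z))\<^sup>2) * v z \<partial>M) = ennreal (1 / c\<^sup>2) * (\<integral>\<^sup>+z. ennreal ((norm (f z))\<^sup>2) * w z \<partial>M)"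
    if "f \<in> X" for f
    unfolding v_def using w(1) X_measurable[OF that]
    by (subst nn_integral_cmult[symmetric]) (auto simp: ac_simps)
  show thesis
  proof (rule that[of v])
    show "v \<in> borel_measurable M" unfolding v_def using w(1) by measurable
    show "(\<integral>\<^sup>+z. ennreal ((norm (f z))\<^sup>2) * v z \<partial>M) \<le> ennreal ((N f)\<^sup>2)" if f: "f \<in> X" for f
    proof -
      have "ennreal (1 / c\<^sup>2) * (\<integral>\<^sup>+z. ennreal ((norm (f z))\<^sup>2) * w z \<partial>M) \<le> ennreal (1 / c\<^sup>2) * ennreal (c\<^sup>2 * 1 * (N f)\<^sup>2)"
        by (intro mult_left_mono w(2) f) auto
      also have "\<dots> = ennreal ((N f)\<^sup>2)" using c0 by (simp flip: ennreal_mult)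
      finally show ?thesis unfolding v_int[OF f] .
    qed
    have "ennreal ((N h)\<^sup>2) \<le> (\<integral>\<^sup>+z. ennreal ((norm (h z))\<^sup>2) * w z \<partial>M)"
      by (rule w(3)) (rule GI[of 1], auto)
    also have "\<dots> = ennreal (c\<^sup>2) * (ennreal (1 / c\<^sup>2) * (\<integral>\<^sup>+z. ennreal ((norm (h z))\<^sup>2) * w z \<partial>M))"
      using c0 unfolding mult.assoc[symmetric] by (simp flip: ennreal_mult)
    finally show "ennreal ((N h)\<^sup>2) \<le> ennreal (c\<^sup>2) * (\<integral>\<^sup>+z. ennreal ((norm (h z))\<^sup>2) * v z \<partial>M)"
      unfolding v_int[OF h] .
  qed
qed

end

section \<open>Random signs\<close>

text \<open>A choice of signs is encoded by the set of indices with sign \<open>+1\<close>; the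
  expectation over independent signs is the sum over \<open>Pow {..<n}\<close> divided by
  \<open>2 ^ n\<close>.\<close>

definition sgn_of :: "nat set \<Rightarrow> nat \<Rightarrow> real" where
  "sgn_of A j = (if j \<in> A then 1 else - 1)"

lemma sum_Pow_Suc:
  fixes \<phi> :: "nat set \<Rightarrow> 'b::comm_monoid_add"
  shows "(\<Sum>A\<in>Pow {..<Suc n}. \<phi> A) = (\<Sum>A\<in>Pow {..<n}. \<phi> A + \<phi> (insert n A))"
proof -
  have "Pow {..<Suc n} = Pow {..<n} \<union> insert n ` Pow {..<n}"
    by (simp add: lessThan_Suc Pow_insert)
  moreover have "Pow {..<n} \<inter> insert n ` Pow {..<n} = {}" by auto
  moreover have "inj_on (insert n) (Pow {..<n})" by (auto simp: inj_on_def)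
  ultimately show ?thesis
    by (simp add: sum.union_disjoint sum.reindex sum.distrib o_def)
qed

lemma sgn_of_square [simp]: "sgn_of A j * sgn_of A j = 1"
  unfolding sgn_of_def by simp

lemma sgn_of_insert: "j \<noteq> n \<Longrightarrow> sgn_of (insert n A) j = sgn_of A j" "sgn_of (insert n A) n = 1"
  unfolding sgn_of_def by auto

lemma sgn_of_new: "A \<subseteq> {..<n} \<Longrightarrow> sgn_of A n = - 1"
  unfolding sgn_of_def by auto

lemma sum_sgn_of_orthogonal:
  "i < n \<Longrightarrow> j < n \<Longrightarrow> (\<Sum>A\<in>Pow {..<n}. sgn_of A i * sgn_of A j) = (if i = j then 2 ^ n else 0)"
proof (induction n)
  case (Suc n)
  show ?case
  proof (cases "i = j")
    case True
    then show ?thesis by (simp add: card_Pow)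
  next
    case False
    have "(\<Sum>A\<in>Pow {..<Suc n}. sgn_of A i * sgn_of A j) = 0"
    proof (cases "i < n \<and> j < n")
      case True
      then have "sgn_of (insert n A) i = sgn_of A i" "sgn_of (insert n A) j = sgn_of A j" for A
        by (auto simp: sgn_of_insert)
      then show ?thesis using Suc.IH True \<open>i \<noteq> j\<close> by (simp add: sum_Pow_Suc sum_distrib_left[symmetric])
    next
      case False
      with Suc.prems \<open>i \<noteq> j\<close> consider "i = n" "j < n" | "j = n" "i < n" by fastforce
      then have "sgn_of A i * sgn_of A j + sgn_of (insert n A) i * sgn_of (insert n A) j = 0"
        if "A \<in> Pow {..<n}" for A
        using that by cases (auto simp: sgn_of_insert sgn_of_new)
      then show ?thesis by (simp add: sum_Pow_Suc)
    qed
    then show ?thesis using False by simp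
  qed
qed simp

lemma sum_sgn_of_Suc:
  fixes x :: "nat \<Rightarrow> 'b::real_vector"
  shows "A \<subseteq> {..<n} \<Longrightarrow> (\<Sum>j<Suc n. sgn_of A j *\<^sub>R x j) = (\<Sum>j<n. sgn_of A j *\<^sub>R x j) - x n"
    and "(\<Sum>j<Suc n. sgn_of (insert n A) j *\<^sub>R x j) = (\<Sum>j<n. sgn_of A j *\<^sub>R x j) + x n"
  by (simp_all add: sgn_of_new sgn_of_insert)

lemma norm_diff_sum_square:
  fixes u v :: "'b::real_inner"
  shows "(norm (u - v))\<^sup>2 = (norm u)\<^sup>2 - 2 * (u \<bullet> v) + (norm v)\<^sup>2"
    and "(norm (u + v))\<^sup>2 = (norm u)\<^sup>2 + 2 * (u \<bullet> v) + (norm v)\<^sup>2"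
  unfolding power2_norm_eq_inner
  by (simp_all add: inner_add_left inner_add_right inner_diff_left inner_diff_right inner_commute[of v u])

lemma sum_sgn_of_second_moment:
  fixes x :: "nat \<Rightarrow> 'b::real_inner"
  shows "(\<Sum>A\<in>Pow {..<n}. (norm (\<Sum>j<n. sgn_of A j *\<^sub>R x j))\<^sup>2) = 2 ^ n * (\<Sum>j<n. (norm (x j))\<^sup>2)"
proof (induction n)
  case (Suc n)
  have par: "(norm (u - v))\<^sup>2 + (norm (u + v))\<^sup>2 = 2 * (norm u)\<^sup>2 + 2 * (norm v)\<^sup>2" for u v :: 'b
    by (simp add: power2_norm_eq_inner inner_add_left inner_add_right inner_diff_left inner_diff_right)
  have "(\<Sum>A\<in>Pow {..<Suc n}. (norm (\<Sum>j<Suc n. sgn_of A j *\<^sub>R x j))\<^sup>2) =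
    (\<Sum>A\<in>Pow {..<n}. 2 * (norm (\<Sum>j<n. sgn_of A j *\<^sub>R x j))\<^sup>2 + 2 * (norm (x n))\<^sup>2)"
    unfolding sum_Pow_Suc sum_sgn_of_Suc(2)
    by (intro sum.cong refl, subst sum_sgn_of_Suc(1)) (auto simp: par)
  also have "\<dots> = 2 ^ Suc n * (\<Sum>j<Suc n. (norm (x j))\<^sup>2)"
    by (simp add: sum.distrib sum_distrib_left[symmetric] Suc.IH card_Pow algebra_simps)
  finally show ?case .
qed simp

text \<open>Khintchine's inequality for the exponent 4, with constant 3. Let \<open>s\<close> be the
  sum of squares so far and \<open>r\<close> the norm of the new vector. Averaging over the new
  sign, with Cauchy-Schwarz for the mixed term, leads from \<open>3 s^2\<close> to
  \<open>3 s^2 + 6 s r^2 + r^4\<close>, which is at most \<open>3 (s + r^2)^2\<close>.\<close>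

lemma sum_sgn_of_fourth_moment:
  fixes x :: "nat \<Rightarrow> 'b::real_inner"
  shows "(\<Sum>A\<in>Pow {..<n}. (norm (\<Sum>j<n. sgn_of A j *\<^sub>R x j)) ^ 4) \<le> 3 * 2 ^ n * (\<Sum>j<n. (norm (x j))\<^sup>2)\<^sup>2"
proof (induction n)
  case (Suc n)
  have par: "norm (u - v) ^ 4 + norm (u + v) ^ 4 \<le> 2 * norm u ^ 4 + 12 * (norm u)\<^sup>2 * (norm v)\<^sup>2 + 2 * norm v ^ 4"
    for u v :: 'b
  proof -
    have 4: "r ^ 4 = (r\<^sup>2)\<^sup>2" for r :: real by simp
    have "norm (u - v) ^ 4 + norm (u + v) ^ 4 = 2 * ((norm u)\<^sup>2 + (norm v)\<^sup>2)\<^sup>2 + 8 * (u \<bullet> v)\<^sup>2"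
      unfolding 4 norm_diff_sum_square by (simp add: power2_eq_square algebra_simps)
    moreover have "(u \<bullet> v)\<^sup>2 \<le> (norm u)\<^sup>2 * (norm v)\<^sup>2"
      using Cauchy_Schwarz_ineq[of u v] by (simp add: power2_norm_eq_inner)
    ultimately show ?thesis unfolding 4 by (simp add: power2_eq_square algebra_simps)
  qed
  define s where "s = (\<Sum>j<n. (norm (x j))\<^sup>2)"
  define r where "r = norm (x n)"
  have "(\<Sum>A\<in>Pow {..<Suc n}. (norm (\<Sum>j<Suc n. sgn_of A j *\<^sub>R x j)) ^ 4) \<le>
    (\<Sum>A\<in>Pow {..<n}. 2 * (norm (\<Sum>j<n. sgn_of A j *\<^sub>R x j)) ^ 4 + 
      12 * (norm (\<Sum>j<n. sgn_of A j *\<^sub>R x j))\<^sup>2 * (norm (x n))\<^sup>2 + 2 * norm (x n) ^ 4)"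
    unfolding sum_Pow_Suc sum_sgn_of_Suc(2)
    by (intro sum_mono, subst sum_sgn_of_Suc(1)) (auto simp: par)
  also have "\<dots> = 2 * (\<Sum>A\<in>Pow {..<n}. (norm (\<Sum>j<n. sgn_of A j *\<^sub>R x j)) ^ 4) +
      12 * (2 ^ n * s) * r\<^sup>2 + 2 ^ n * (2 * r ^ 4)"
    unfolding s_def r_def sum_sgn_of_second_moment[symmetric]
    by (simp add: sum.distrib sum_distrib_left sum_distrib_right card_Pow mult.assoc)
  also have "\<dots> \<le> 2 * (3 * 2 ^ n * s\<^sup>2) + 12 * (2 ^ n * s) * r\<^sup>2 + 2 ^ n * (2 * r ^ 4)"
    using Suc.IH unfolding s_def by simp
  also have "\<dots> \<le> 3 * 2 ^ Suc n * (s + r\<^sup>2)\<^sup>2"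
  proof -
    have "r ^ 4 = r\<^sup>2 * r\<^sup>2" by (simp add: power4_eq_xxxx power2_eq_square)
    moreover have "0 \<le> (2::real) ^ n * (r\<^sup>2 * r\<^sup>2)" by simp
    ultimately show ?thesis by (simp add: power2_sum power2_eq_square[of s] power2_eq_square[of "r\<^sup>2"] algebra_simps)
  qed
  finally show ?case unfolding s_def r_def by simp
qed simp

text \<open>The signs are orthogonal functions on \<open>Pow {..<n}\<close> of squared norm
  \<open>2 ^ n\<close>, and the sums on the left are the coefficients of \<open>y\<close>. The
  squared distance from \<open>y\<close> to its projection is expanded; the second moment computes
  the norm of the projection.\<close>

lemma sum_sgn_of_Bessel:
  fixes y :: "nat set \<Rightarrow> 'b::real_inner"
  shows "(\<Sum>j<n. (norm (\<Sum>A\<in>Pow {..<n}. sgn_of A j *\<^sub>R y A))\<^sup>2) \<le> 2 ^ n * (\<Sum>A\<in>Pow {..<n}. (norm (y A))\<^sup>2)"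
proof -
  define S where "S j = (\<Sum>A\<in>Pow {..<n}. sgn_of A j *\<^sub>R y A)" for j
  define t :: real where "t = 1 / 2 ^ n"
  define q where "q = (\<Sum>j<n. (norm (S j))\<^sup>2)"
  have "0 \<le> (\<Sum>A\<in>Pow {..<n}. (norm (y A - t *\<^sub>R (\<Sum>j<n. sgn_of A j *\<^sub>R S j)))\<^sup>2)"
    by (intro sum_nonneg) auto
  also have "\<dots> = (\<Sum>A\<in>Pow {..<n}. (norm (y A))\<^sup>2 - 2 * t * (y A \<bullet> (\<Sum>j<n. sgn_of A j *\<^sub>R S j)) +
      t\<^sup>2 * (norm (\<Sum>j<n. sgn_of A j *\<^sub>R S j))\<^sup>2)"
    unfolding norm_diff_sum_square by (intro sum.cong refl) (simp add: power_mult_distrib)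
  also have "\<dots> = (\<Sum>A\<in>Pow {..<n}. (norm (y A))\<^sup>2) -
      2 * t * (\<Sum>A\<in>Pow {..<n}. y A \<bullet> (\<Sum>j<n. sgn_of A j *\<^sub>R S j)) +
      t\<^sup>2 * (\<Sum>A\<in>Pow {..<n}. (norm (\<Sum>j<n. sgn_of A j *\<^sub>R S j))\<^sup>2)"
    by (simp add: sum.distrib sum_subtractf sum_distrib_left)
  also have "(\<Sum>A\<in>Pow {..<n}. y A \<bullet> (\<Sum>j<n. sgn_of A j *\<^sub>R S j)) = q"
  proof -
    have "(\<Sum>A\<in>Pow {..<n}. y A \<bullet> (\<Sum>j<n. sgn_of A j *\<^sub>R S j)) =
      (\<Sum>A\<in>Pow {..<n}. \<Sum>j<n. (sgn_of A j *\<^sub>R y A) \<bullet> S j)" by (simp add: inner_sum_right)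
    also have "\<dots> = (\<Sum>j<n. \<Sum>A\<in>Pow {..<n}. (sgn_of A j *\<^sub>R y A) \<bullet> S j)" by (rule sum.swap)
    also have "\<dots> = q"
      unfolding q_def inner_sum_left[symmetric] by (simp add: power2_norm_eq_inner flip: S_def)
    finally show ?thesis .
  qed
  also have "(\<Sum>A\<in>Pow {..<n}. (norm (\<Sum>j<n. sgn_of A j *\<^sub>R S j))\<^sup>2) = 2 ^ n * q"
    unfolding q_def by (rule sum_sgn_of_second_moment)
  finally have "2 * t * q - t\<^sup>2 * (2 ^ n * q) \<le> (\<Sum>A\<in>Pow {..<n}. (norm (y A))\<^sup>2)" by simp
  moreover have "t\<^sup>2 * (2 ^ n * q) = t * q" unfolding t_def by (simp add: power2_eq_square)
  ultimately have "t * q \<le> (\<Sum>A\<in>Pow {..<n}. (norm (y A))\<^sup>2)" by linarith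
  then show ?thesis unfolding t_def q_def S_def by (simp add: field_simps)
qed

section \<open>The little Grothendieck theorem for 2-convex lattices\<close>

locale lattice_operator = convex_lattice M X N c
  for M :: "'a measure" and X :: "('a \<Rightarrow> 'k::{real_normed_field,euclidean_space}) set" and N c +
  fixes T :: "('a \<Rightarrow> 'k) \<Rightarrow> ('a \<Rightarrow> 'k)" and A a :: real
  assumes T_L2: "linear_operator_L2 M T A" and T_X: "acts_boundedly M T X N a"
begin

abbreviation sqint :: "('a \<Rightarrow> ennreal) \<Rightarrow> ('a \<Rightarrow> 'k) \<Rightarrow> ennreal" where
  "sqint v f \<equiv> \<integral>\<^sup>+z. ennreal ((norm (f z))\<^sup>2) * v z \<partial>M"

abbreviation LL :: "('a \<Rightarrow> 'k) set" where
  "LL \<equiv> L2 M"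

section \<open>Elementary facts on weighted square integrals, on \<open>L2\<close> and on
  \<open>T\<close>\<close>

lemma L2_iff: "f \<in> LL \<longleftrightarrow> f \<in> borel_measurable M \<and> sqint (\<lambda>_. 1) f < \<infinity>"
  unfolding wL2_def by simp

lemma L2_measurable [measurable_dest]: "f \<in> LL \<Longrightarrow> f \<in> borel_measurable M"
  unfolding L2_iff by simp

lemma norm_add_square_le: "(norm (x + y))\<^sup>2 \<le> 2 * (norm x)\<^sup>2 + 2 * (norm y)\<^sup>2" for x y :: 'k
proof -
  have "(norm (x + y))\<^sup>2 + (norm (x - y))\<^sup>2 = 2 * (norm x)\<^sup>2 + 2 * (norm y)\<^sup>2"
    unfolding norm_diff_sum_square by simp
  then show ?thesis using zero_le_power2[of "norm (x - y)"] by linarith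
qed

lemma sqint_add_le:
  assumes [measurable]: "v \<in> borel_measurable M" "f \<in> borel_measurable M" "g \<in> borel_measurable M"
  shows "sqint v (\<lambda>z. f z + g z) \<le> 2 * sqint v f + 2 * sqint v g"
proof -
  have "ennreal ((norm (f z + g z))\<^sup>2) \<le> 2 * ennreal ((norm (f z))\<^sup>2) + 2 * ennreal ((norm (g z))\<^sup>2)" for z
  proof -
    have "ennreal ((norm (f z + g z))\<^sup>2) \<le> ennreal (2 * (norm (f z))\<^sup>2 + 2 * (norm (g z))\<^sup>2)"
      by (intro ennreal_leI norm_add_square_le)
    then show ?thesis by (simp add: ennreal_plus ennreal_mult)
  qed
  then have "sqint v (\<lambda>z. f z + g z) \<le>
    (\<integral>\<^sup>+z. (2 * ennreal ((norm (f z))\<^sup>2) + 2 * ennreal ((norm (g z))\<^sup>2)) * v z \<partial>M)"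
    by (intro nn_integral_mono mult_right_mono) auto
  also have "\<dots> = (\<integral>\<^sup>+z. 2 * (ennreal ((norm (f z))\<^sup>2) * v z) + 2 * (ennreal ((norm (g z))\<^sup>2) * v z) \<partial>M)"
    by (simp add: distrib_right mult.assoc)
  also have "\<dots> = 2 * sqint v f + 2 * sqint v g"
    by (simp add: nn_integral_add nn_integral_cmult)
  finally show ?thesis .
qed

lemma sqint_scale:
  assumes [measurable]: "v \<in> borel_measurable M" "f \<in> borel_measurable M"
  shows "sqint v (\<lambda>z. r * f z) = ennreal ((norm r)\<^sup>2) * sqint v f"
  by (subst nn_integral_cmult[symmetric]) (auto simp: norm_mult power_mult_distrib ennreal_mult mult.assoc)

lemma sqint_mono:
  assumes "AE z in M. norm (f z) \<le> norm (g z)"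
  shows "sqint v f \<le> sqint v g"
  using assms by (intro nn_integral_mono_AE) (auto elim!: eventually_mono intro!: mult_right_mono ennreal_leI power_mono)

lemma sqint_cong_AE:
  assumes "AE z in M. f z = g z"
  shows "sqint v f = sqint v g"
  using assms by (intro nn_integral_cong_AE) (auto elim!: eventually_mono)

lemma L2_add: "f \<in> LL \<Longrightarrow> g \<in> LL \<Longrightarrow> (\<lambda>z. f z + g z) \<in> LL"
  using sqint_add_le[of "\<lambda>_. 1" f g] unfolding L2_iff
  by (auto simp: ennreal_mult_less_top elim!: le_less_trans)

lemma L2_scale: "f \<in> LL \<Longrightarrow> (\<lambda>z. r * f z) \<in> LL"
  using sqint_scale[of "\<lambda>_. 1" f r] unfolding L2_iff by (auto simp: ennreal_mult_less_top)

lemma L2_ideal: "g \<in> LL \<Longrightarrow> f \<in> borel_measurable M \<Longrightarrow> AE z in M. norm (f z) \<le> norm (g z) \<Longrightarrow> f \<in> LL"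
  using sqint_mono[of f g "\<lambda>_. 1"] unfolding L2_iff by auto

lemma L2_zero: "(\<lambda>_. 0) \<in> LL"
  unfolding L2_iff by simp

lemma L2_sum: "finite I \<Longrightarrow> (\<And>i. i \<in> I \<Longrightarrow> f i \<in> LL) \<Longrightarrow> (\<lambda>z. \<Sum>i\<in>I. f i z) \<in> LL"
  by (induction I rule: finite_induct) (auto intro: L2_add L2_zero)

lemma T_in_L2: "f \<in> LL \<Longrightarrow> T f \<in> LL"
  using T_L2 unfolding linear_operator_L2_def acts_boundedly_def by auto

lemma T_L2_bound:
  assumes f: "f \<in> LL"
  shows "sqint (\<lambda>_. 1) (T f) \<le> ennreal (A\<^sup>2) * sqint (\<lambda>_. 1) f"
proof -
  have fin: "sqint (\<lambda>_. 1) f < \<infinity>" "sqint (\<lambda>_. 1) (T f) < \<infinity>" using f T_in_L2[OF f] unfolding L2_iff by auto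
  have "sqrt (enn2real (sqint (\<lambda>_. 1) (T f))) \<le> A * sqrt (enn2real (sqint (\<lambda>_. 1) f))"
    using T_L2 f unfolding linear_operator_L2_def acts_boundedly_def wL2_norm_def by simp
  from power_mono[OF this, of 2] have "enn2real (sqint (\<lambda>_. 1) (T f)) \<le> A\<^sup>2 * enn2real (sqint (\<lambda>_. 1) f)"
    by (simp add: power_mult_distrib)
  from ennreal_leI[OF this] show ?thesis using fin by (simp add: ennreal_mult less_top)
qed

lemma T_add: "f \<in> LL \<Longrightarrow> g \<in> LL \<Longrightarrow> AE z in M. T (\<lambda>z. f z + g z) z = T f z + T g z"
  and T_scale: "f \<in> LL \<Longrightarrow> AE z in M. T (\<lambda>z. r * f z) z = r * T f z"
  using T_L2 unfolding linear_operator_L2_def by blast+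

lemma T_zero: "AE z in M. T (\<lambda>_. 0) z = 0"
  using T_scale[OF L2_zero, of 0] by simp

lemma T_sum:
  "finite I \<Longrightarrow> (\<And>i. i \<in> I \<Longrightarrow> f i \<in> LL) \<Longrightarrow>
    AE z in M. T (\<lambda>z. \<Sum>i\<in>I. r i * f i z) z = (\<Sum>i\<in>I. r i * T (f i) z)"
proof (induction I rule: finite_induct)
  case empty
  then show ?case using T_zero by simp
next
  case (insert i I)
  have "AE z in M. T (\<lambda>z. r i * f i z + (\<Sum>i\<in>I. r i * f i z)) z =
      T (\<lambda>z. r i * f i z) z + T (\<lambda>z. \<Sum>i\<in>I. r i * f i z) z"
    using insert by (intro T_add L2_sum L2_scale) auto
  moreover have "AE z in M. T (\<lambda>z. r i * f i z) z = r i * T (f i) z"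
    using insert by (intro T_scale) auto
  moreover have "AE z in M. T (\<lambda>z. \<Sum>i\<in>I. r i * f i z) z = (\<Sum>i\<in>I. r i * T (f i) z)"
    using insert by auto
  ultimately show ?case using insert(1,2) by (auto elim: eventually_elim2)
qed

lemma T_in_X: "f \<in> X \<Longrightarrow> f \<in> LL \<Longrightarrow> T f \<in> X"
  and T_X_bound: "f \<in> X \<Longrightarrow> f \<in> LL \<Longrightarrow> N (T f) \<le> a * N f"
  using T_X unfolding acts_boundedly_def by auto

text \<open>The unit ball of the order dual of \<open>Y\<close>, expressed through squares of
  elements of \<open>X\<close>. Infinite values of \<open>v\<close> are allowed.\<close>

definition subunit :: "('a \<Rightarrow> ennreal) \<Rightarrow> bool" where
  "subunit v \<longleftrightarrow> v \<in> borel_measurable M \<and> (\<forall>f\<in>X. sqint v f \<le> ennreal ((N f)\<^sup>2))"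

lemma subunitD: "subunit v \<Longrightarrow> v \<in> borel_measurable M" "subunit v \<Longrightarrow> f \<in> X \<Longrightarrow> sqint v f \<le> ennreal ((N f)\<^sup>2)"
  unfolding subunit_def by auto

lemma subunit_T:
  assumes "subunit v" "f \<in> X" "f \<in> LL"
  shows "sqint v (T f) \<le> ennreal (a\<^sup>2 * (N f)\<^sup>2)"
proof -
  have "sqint v (T f) \<le> ennreal ((N (T f))\<^sup>2)" by (intro subunitD assms T_in_X)
  also have "(N (T f))\<^sup>2 \<le> (a * N f)\<^sup>2" by (intro power_mono T_X_bound N_nonneg T_in_X assms)
  finally show ?thesis by (simp add: power_mult_distrib ennreal_leI)
qed

text \<open>
  One step of the proof of the little Grothendieck theorem. Each \<open>f\<^sub>j\<close> is the correlation of the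
  \<open>j\<close>-th sign with the random sum \<open>\<Sum> \<plusminus>f\<^sub>j\<close>. Truncating this sum at the level
  \<open>sqrt 12\<close> times the square function leaves a remainder whose square function has halved, by
  Bessel's inequality and the fourth moment of the random sum.
\<close>

lemma square_function_step:
  fixes n :: nat and S :: real
  assumes v: "subunit v" and S: "0 \<le> S"
    and hyp: "\<And>f. (\<And>j. j < n \<Longrightarrow> f j \<in> X \<inter> LL) \<Longrightarrow>
      (\<Sum>j<n. sqint v (T (f j))) \<le> ennreal (S * (N (\<lambda>z. of_real (ssq n f z)))\<^sup>2)"
    and f: "\<And>j. j < n \<Longrightarrow> f j \<in> X \<inter> LL"
  shows "(\<Sum>j<n. sqint v (T (f j))) \<le> ennreal ((24 * a\<^sup>2 + S / 2) * (N (\<lambda>z. of_real (ssq n f z)))\<^sup>2)"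
proof -
  have v_meas [measurable]: "v \<in> borel_measurable M" using v by (rule subunitD)
  define U where "U = ssq n f"
  \<comment> \<open>At this level the fourth moment \<open>3 U^4\<close>, divided by
    \<open>\<Lambda>^2 U^2 = 12 U^2\<close>, leaves \<open>U^2 / 4\<close>.\<close>
  define \<Lambda> :: real where "\<Lambda> = sqrt 12"
  have \<Lambda>: "\<Lambda>\<^sup>2 = 12" "0 < \<Lambda>" unfolding \<Lambda>_def by simp_all
  have U_nn: "0 \<le> U z" for z unfolding U_def by (rule ssq_nonneg)
  have f_X: "f j \<in> X" and f_L2: "f j \<in> LL" if "j < n" for j using f[OF that] by auto
  have f_meas: "f j \<in> borel_measurable M" if "j < n" for j using f_X[OF that] by (rule X_measurable)
  have U_X: "(\<lambda>z. of_real (U z)) \<in> X" unfolding U_def by (rule X_ssq[OF f_X])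
  have U_meas [measurable]: "U \<in> borel_measurable M"
  proof -
    have "(\<lambda>z. norm (of_real (U z) :: 'k)) \<in> borel_measurable M"
      using X_measurable[OF U_X] by measurable
    then show ?thesis using U_nn by simp
  qed
  have U_L2: "(\<lambda>z. of_real (U z)) \<in> LL"
  proof (rule L2_ideal)
    show "(\<lambda>z. \<Sum>j<n. of_real (norm (f j z))) \<in> LL"
      by (rule L2_sum, simp, rule L2_ideal[OF f_L2])
        (auto intro!: measurable_compose[OF measurable_compose[OF f_meas borel_measurable_norm] borel_measurable_of_real])
    show "(\<lambda>z. of_real (U z) :: 'k) \<in> borel_measurable M" using U_X by (rule X_measurable)
    have "U z \<le> (\<Sum>j<n. norm (f j z))" for z unfolding U_def by (rule ssq_le_sum)
    then show "AE z in M. norm (of_real (U z) :: 'k) \<le> norm (\<Sum>j<n. of_real (norm (f j z)) :: 'k)"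
      by (simp add: U_nn sum_nonneg flip: of_real_sum)
  qed
  define F where "F B z = (\<Sum>j<n. sgn_of B j *\<^sub>R f j z)" for B z
  have F_meas [measurable]: "F B \<in> borel_measurable M" for B
    unfolding F_def by (intro borel_measurable_sum borel_measurable_scaleR borel_measurable_const f_meas) auto
  define \<tau> where "\<tau> B z = (if norm (F B z) \<le> \<Lambda> * U z then 1 else \<Lambda> * U z / norm (F B z))" for B z
  have \<tau>_meas [measurable]: "\<tau> B \<in> borel_measurable M" for B unfolding \<tau>_def by measurable
  define P where "P B z = \<tau> B z *\<^sub>R F B z" for B z
  define G where "G B z = F B z - P B z" for B z
  have P_meas [measurable]: "P B \<in> borel_measurable M" for B unfolding P_def by measurable
  have G_meas [measurable]: "G B \<in> borel_measurable M" for B unfolding G_def by measurable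
  have P_le: "norm (P B z) \<le> \<Lambda> * U z" for B z
    using \<Lambda>(2) U_nn[of z] unfolding P_def \<tau>_def by auto
  \<comment> \<open>The remainder vanishes unless \<open>|F| > \<Lambda> * U\<close>, and there one
    factor \<open>|F|^2\<close> pays for \<open>12 * U^2\<close>.\<close>
  have G_le: "(norm (G B z))\<^sup>2 * (12 * (U z)\<^sup>2) \<le> norm (F B z) ^ 4" for B z
  proof (cases "norm (F B z) \<le> \<Lambda> * U z")
    case False
    then have pos: "0 < norm (F B z)" using mult_nonneg_nonneg[OF less_imp_le[OF \<Lambda>(2)] U_nn[of z]] by linarith
    have chi: "0 \<le> \<tau> B z" "\<tau> B z \<le> 1"
      using False pos \<Lambda>(2) U_nn[of z] unfolding \<tau>_def by (auto simp: divide_le_eq)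
    have "G B z = (1 - \<tau> B z) *\<^sub>R F B z" unfolding G_def P_def by (simp add: scaleR_left_diff_distrib)
    then have "norm (G B z) \<le> norm (F B z)"
      using chi by (simp add: mult_left_le_one_le)
    then have "(norm (G B z))\<^sup>2 * (\<Lambda> * U z)\<^sup>2 \<le> (norm (F B z))\<^sup>2 * (norm (F B z))\<^sup>2"
      using False \<Lambda>(2) U_nn[of z] by (intro mult_mono power_mono) auto
    moreover have "(\<Lambda> * U z)\<^sup>2 = 12 * (U z)\<^sup>2" by (simp add: power_mult_distrib \<Lambda>)
    moreover have "norm (F B z) ^ 4 = (norm (F B z))\<^sup>2 * (norm (F B z))\<^sup>2"
      by (simp add: power4_eq_xxxx power2_eq_square mult.assoc)
    ultimately show ?thesis by (simp only:)
  qed (simp add: G_def P_def \<tau>_def)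
  have P_dom: "AE z in M. norm (P B z) \<le> norm (of_real \<Lambda> * of_real (U z) :: 'k)" for B
  proof (rule AE_I2)
    fix z
    have "norm (of_real \<Lambda> * of_real (U z) :: 'k) = \<Lambda> * U z"
      unfolding norm_mult norm_of_real using U_nn[of z] \<Lambda>(2) by simp
    then show "norm (P B z) \<le> norm (of_real \<Lambda> * of_real (U z) :: 'k)" using P_le[of B z] by simp
  qed
  have P_X: "P B \<in> X" for B by (rule X_ideal[OF X_scale[OF U_X] P_meas P_dom])
  have P_L2: "P B \<in> LL" for B by (rule L2_ideal[OF L2_scale[OF U_L2] P_meas P_dom])
  have N_P: "(N (P B))\<^sup>2 \<le> 12 * (N (\<lambda>z. of_real (U z)))\<^sup>2" for B
  proof -
    have "N (P B) \<le> \<Lambda> * N (\<lambda>z. of_real (U z))"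
      using N_mono[OF X_scale[OF U_X] P_meas P_dom] N_scale[OF U_X] \<Lambda>(2) by simp
    from power_mono[OF this N_nonneg[OF P_X], of 2] show ?thesis by (simp add: power_mult_distrib \<Lambda>)
  qed
  define t :: real where "t = 1 / 2 ^ n"
  have t: "0 < t" "t * 2 ^ n = 1" unfolding t_def by simp_all
  define p where "p j z = t *\<^sub>R (\<Sum>B\<in>Pow {..<n}. sgn_of B j *\<^sub>R P B z)" for j z
  define r where "r j z = t *\<^sub>R (\<Sum>B\<in>Pow {..<n}. sgn_of B j *\<^sub>R G B z)" for j z
  have p_sum: "p j = (\<lambda>z. \<Sum>B\<in>Pow {..<n}. of_real (t * sgn_of B j) * P B z)" for j
    unfolding p_def by (simp add: sum_distrib_left scaleR_conv_of_real mult.assoc)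
  have p_X: "p j \<in> X" for j unfolding p_sum by (intro X_sum X_scale P_X) auto
  have p_L2: "p j \<in> LL" for j unfolding p_sum by (intro L2_sum L2_scale P_L2) auto
  have split: "f j z = p j z + r j z" if j: "j < n" for j z
  proof -
    have "p j z + r j z = t *\<^sub>R (\<Sum>B\<in>Pow {..<n}. sgn_of B j *\<^sub>R F B z)"
      unfolding p_def r_def scaleR_right_distrib[symmetric] sum.distrib[symmetric] by (simp add: G_def)
    also have "(\<Sum>B\<in>Pow {..<n}. sgn_of B j *\<^sub>R F B z) =
        (\<Sum>B\<in>Pow {..<n}. \<Sum>i<n. (sgn_of B i * sgn_of B j) *\<^sub>R f i z)"
      unfolding F_def scaleR_sum_right by (simp add: mult.commute)
    also have "\<dots> = (\<Sum>i<n. (\<Sum>B\<in>Pow {..<n}. sgn_of B i * sgn_of B j) *\<^sub>R f i z)"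
      unfolding scaleR_sum_left by (rule sum.swap)
    also have "\<dots> = (\<Sum>i<n. (if i = j then 2 ^ n *\<^sub>R f i z else 0))"
      using j by (intro sum.cong) (auto simp: sum_sgn_of_orthogonal)
    also have "\<dots> = 2 ^ n *\<^sub>R f j z" using j by simp
    finally show ?thesis using t(2) by simp
  qed
  have r_eq: "r j = (\<lambda>z. f j z + - 1 * p j z)" if "j < n" for j
    using split[OF that] by (simp add: fun_eq_iff)
  have r_X: "r j \<in> X" if "j < n" for j unfolding r_eq[OF that] by (intro X_add X_scale p_X f_X that)
  have r_L2: "r j \<in> LL" if "j < n" for j unfolding r_eq[OF that] by (intro L2_add L2_scale p_L2 f_L2 that)
  have r_le: "ssq n r z \<le> U z / 2" for z
  proof -
    have Usq: "(U z)\<^sup>2 = (\<Sum>j<n. (norm (f j z))\<^sup>2)" unfolding U_def by (rule ssq_square)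
    have "(\<Sum>j<n. (norm (r j z))\<^sup>2) = t\<^sup>2 * (\<Sum>j<n. (norm (\<Sum>B\<in>Pow {..<n}. sgn_of B j *\<^sub>R G B z))\<^sup>2)"
      unfolding r_def by (simp add: power_mult_distrib sum_distrib_left)
    also have "\<dots> \<le> t\<^sup>2 * (2 ^ n * (\<Sum>B\<in>Pow {..<n}. (norm (G B z))\<^sup>2))"
      by (intro mult_left_mono sum_sgn_of_Bessel) auto
    also have "\<dots> = t * (\<Sum>B\<in>Pow {..<n}. (norm (G B z))\<^sup>2)" by (simp add: t_def power2_eq_square)
    finally have 1: "(ssq n r z)\<^sup>2 \<le> t * (\<Sum>B\<in>Pow {..<n}. (norm (G B z))\<^sup>2)" unfolding ssq_square .
    have "(ssq n r z)\<^sup>2 * (12 * (U z)\<^sup>2) \<le> t * (\<Sum>B\<in>Pow {..<n}. (norm (G B z))\<^sup>2) * (12 * (U z)\<^sup>2)"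
      using 1 by (intro mult_right_mono) auto
    also have "\<dots> = t * (\<Sum>B\<in>Pow {..<n}. (norm (G B z))\<^sup>2 * (12 * (U z)\<^sup>2))"
      by (simp only: sum_distrib_right mult.assoc)
    also have "\<dots> \<le> t * (\<Sum>B\<in>Pow {..<n}. norm (F B z) ^ 4)"
      using t(1) by (intro mult_left_mono sum_mono G_le) auto
    also have "\<dots> \<le> t * (3 * 2 ^ n * (\<Sum>j<n. (norm (f j z))\<^sup>2)\<^sup>2)"
      using t(1) unfolding F_def by (intro mult_left_mono sum_sgn_of_fourth_moment) auto
    also have "\<dots> = 3 * ((U z)\<^sup>2)\<^sup>2" unfolding Usq by (simp add: t_def)
    finally have 2: "4 * (ssq n r z)\<^sup>2 * (U z)\<^sup>2 \<le> (U z)\<^sup>2 * (U z)\<^sup>2"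
      by (simp add: power2_eq_square algebra_simps)
    show ?thesis
    proof (cases "U z = 0")
      case True
      then have f0: "f j z = 0" if "j < n" for j
        using norm_le_ssq[OF that, of f z] unfolding U_def by simp
      then have "F B z = 0" for B unfolding F_def by simp
      then have "r j z = 0" for j unfolding r_def G_def P_def by simp
      then show ?thesis using True by (simp add: ssq_def)
    next
      case False
      then have "0 < (U z)\<^sup>2" by simp
      with 2 have "4 * (ssq n r z)\<^sup>2 \<le> (U z)\<^sup>2" by (rule mult_right_le_imp_le)
      then have "(ssq n r z)\<^sup>2 \<le> (U z / 2)\<^sup>2" by (simp add: power_divide)
      then show ?thesis by (rule power2_le_imp_le) (use U_nn[of z] in simp)
    qed
  qed
  have "N (\<lambda>z. of_real (ssq n r z)) \<le> N (\<lambda>z. of_real (1 / 2) * of_real (U z))"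
  proof (rule N_mono[OF X_scale[OF U_X]])
    show "(\<lambda>z. of_real (ssq n r z) :: 'k) \<in> borel_measurable M" by (rule X_measurable[OF X_ssq[OF r_X]])
    show "AE z in M. norm (of_real (ssq n r z) :: 'k) \<le> norm (of_real (1 / 2) * of_real (U z) :: 'k)"
      unfolding norm_mult norm_of_real using r_le U_nn by (simp add: ssq_nonneg)
  qed
  also have "\<dots> = 1 / 2 * N (\<lambda>z. of_real (U z))"
    using N_scale[OF U_X, of "of_real (1 / 2)"] unfolding norm_of_real by simp
  finally have "(N (\<lambda>z. of_real (ssq n r z)))\<^sup>2 \<le> (1 / 2 * N (\<lambda>z. of_real (U z)))\<^sup>2"
    by (rule power_mono) (rule N_nonneg[OF X_ssq[OF r_X]])
  then have N_r: "(N (\<lambda>z. of_real (ssq n r z)))\<^sup>2 \<le> 1 / 4 * (N (\<lambda>z. of_real (U z)))\<^sup>2"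
    by (simp add: power2_eq_square)
  \<comment> \<open>The hypothesis is reused for the family \<open>r\<close>. Halving the square
    function divides its squared norm by 4, and the factor 2 from splitting \<open>T (f j)\<close>
    later leaves \<open>S / 2\<close>.\<close>
  have bound_r: "(\<Sum>j<n. sqint v (T (r j))) \<le> ennreal (S / 4 * (N (\<lambda>z. of_real (U z)))\<^sup>2)"
  proof -
    have "(\<Sum>j<n. sqint v (T (r j))) \<le> ennreal (S * (N (\<lambda>z. of_real (ssq n r z)))\<^sup>2)"
      by (rule hyp) (use r_X r_L2 in auto)
    also have "\<dots> \<le> ennreal (S * (1 / 4 * (N (\<lambda>z. of_real (U z)))\<^sup>2))"
      by (intro ennreal_leI mult_left_mono N_r S)
    finally show ?thesis by simp
  qed
  have T_meas: "T (P B) \<in> borel_measurable M" "T (p j) \<in> borel_measurable M" for B j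
    using T_in_L2[OF P_L2] T_in_L2[OF p_L2] by (auto intro: L2_measurable)
  \<comment> \<open>Bessel's inequality at each point bounds the sum over \<open>j\<close> by the
    average over signs. Then boundedness of \<open>T\<close> in \<open>X\<close> applies to every
    single \<open>P B\<close>, because each of them is dominated by \<open>\<Lambda> * U\<close>;
    the untruncated \<open>F B\<close> are not.\<close>
  have bound_p: "(\<Sum>j<n. sqint v (T (p j))) \<le> ennreal (12 * a\<^sup>2 * (N (\<lambda>z. of_real (U z)))\<^sup>2)"
  proof -
    have "AE z in M. \<forall>j\<in>{..<n}. T (p j) z = (\<Sum>B\<in>Pow {..<n}. of_real (t * sgn_of B j) * T (P B) z)"
      unfolding p_sum by (intro AE_finite_allI T_sum P_L2) auto
    then have AEp: "AE z in M. (\<Sum>j<n. (norm (T (p j) z))\<^sup>2) \<le> t * (\<Sum>B\<in>Pow {..<n}. (norm (T (P B) z))\<^sup>2)"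
    proof eventually_elim
      case (elim z)
      have "(\<Sum>j<n. (norm (T (p j) z))\<^sup>2) = (\<Sum>j<n. (norm (t *\<^sub>R (\<Sum>B\<in>Pow {..<n}. sgn_of B j *\<^sub>R T (P B) z)))\<^sup>2)"
        using elim by (intro sum.cong) (simp_all add: sum_distrib_left scaleR_conv_of_real mult.assoc)
      also have "\<dots> = t\<^sup>2 * (\<Sum>j<n. (norm (\<Sum>B\<in>Pow {..<n}. sgn_of B j *\<^sub>R T (P B) z))\<^sup>2)"
        by (simp add: power_mult_distrib sum_distrib_left)
      also have "\<dots> \<le> t\<^sup>2 * (2 ^ n * (\<Sum>B\<in>Pow {..<n}. (norm (T (P B) z))\<^sup>2))"
        by (intro mult_left_mono sum_sgn_of_Bessel) auto
      also have "\<dots> = t * (\<Sum>B\<in>Pow {..<n}. (norm (T (P B) z))\<^sup>2)" by (simp add: t_def power2_eq_square)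
      finally show ?case .
    qed
    have "(\<Sum>j<n. sqint v (T (p j))) = (\<integral>\<^sup>+z. (\<Sum>j<n. ennreal ((norm (T (p j) z))\<^sup>2) * v z) \<partial>M)"
      by (rule nn_integral_sum[symmetric]) (use T_meas in measurable)
    also have "\<dots> = (\<integral>\<^sup>+z. ennreal (\<Sum>j<n. (norm (T (p j) z))\<^sup>2) * v z \<partial>M)"
      by (simp add: sum_distrib_right[symmetric])
    also have "\<dots> \<le> (\<integral>\<^sup>+z. ennreal (t * (\<Sum>B\<in>Pow {..<n}. (norm (T (P B) z))\<^sup>2)) * v z \<partial>M)"
      using AEp by (intro nn_integral_mono_AE) (auto elim!: eventually_mono intro!: mult_right_mono ennreal_leI)
    also have "\<dots> = (\<integral>\<^sup>+z. (\<Sum>B\<in>Pow {..<n}. ennreal t * (ennreal ((norm (T (P B) z))\<^sup>2) * v z)) \<partial>M)"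
      using t(1) by (simp add: sum_distrib_left[symmetric] sum_distrib_right[symmetric] ennreal_mult sum_nonneg mult.assoc)
    also have "\<dots> = (\<Sum>B\<in>Pow {..<n}. ennreal t * sqint v (T (P B)))"
      using T_meas by (subst nn_integral_sum) (auto intro!: sum.cong nn_integral_cmult)
    also have "\<dots> \<le> (\<Sum>B\<in>Pow {..<n}. ennreal t * ennreal (a\<^sup>2 * (12 * (N (\<lambda>z. of_real (U z)))\<^sup>2)))"
    proof (intro sum_mono mult_left_mono)
      fix B
      have "sqint v (T (P B)) \<le> ennreal (a\<^sup>2 * (N (P B))\<^sup>2)" by (rule subunit_T[OF v P_X P_L2])
      also have "\<dots> \<le> ennreal (a\<^sup>2 * (12 * (N (\<lambda>z. of_real (U z)))\<^sup>2))"
        by (intro ennreal_leI mult_left_mono N_P) auto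
      finally show "sqint v (T (P B)) \<le> ennreal (a\<^sup>2 * (12 * (N (\<lambda>z. of_real (U z)))\<^sup>2))" .
    qed auto
    also have "\<dots> = ennreal (12 * a\<^sup>2 * (N (\<lambda>z. of_real (U z)))\<^sup>2)"
      using t by (simp add: card_Pow ennreal_mult[symmetric] ennreal_of_nat_eq_real_of_nat del: of_nat_power)
        (simp add: ennreal_mult'' [symmetric] mult.assoc[symmetric] mult.commute)
    finally show ?thesis .
  qed
  have "sqint v (T (f j)) \<le> 2 * sqint v (T (p j)) + 2 * sqint v (T (r j))" if j: "j < n" for j
  proof -
    have "f j = (\<lambda>z. p j z + r j z)" using split[OF j] by auto
    then have "AE z in M. T (f j) z = T (p j) z + T (r j) z" using T_add[OF p_L2 r_L2[OF j]] by simp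
    then have "sqint v (T (f j)) = sqint v (\<lambda>z. T (p j) z + T (r j) z)" by (rule sqint_cong_AE)
    also have "\<dots> \<le> 2 * sqint v (T (p j)) + 2 * sqint v (T (r j))"
      by (intro sqint_add_le v_meas T_meas L2_measurable T_in_L2 r_L2 j)
    finally show ?thesis .
  qed
  then have "(\<Sum>j<n. sqint v (T (f j))) \<le> (\<Sum>j<n. 2 * sqint v (T (p j)) + 2 * sqint v (T (r j)))"
    by (intro sum_mono) auto
  also have "\<dots> = 2 * (\<Sum>j<n. sqint v (T (p j))) + 2 * (\<Sum>j<n. sqint v (T (r j)))"
    by (simp add: sum.distrib sum_distrib_left)
  also have "\<dots> \<le> 2 * ennreal (12 * a\<^sup>2 * (N (\<lambda>z. of_real (U z)))\<^sup>2) + 2 * ennreal (S / 4 * (N (\<lambda>z. of_real (U z)))\<^sup>2)"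
    by (intro add_mono mult_left_mono bound_p bound_r) auto
  also have "\<dots> = ennreal (2 * (12 * a\<^sup>2 * (N (\<lambda>z. of_real (U z)))\<^sup>2) + 2 * (S / 4 * (N (\<lambda>z. of_real (U z)))\<^sup>2))"
    by (rule ennreal_double_sum) (use S in auto)
  also have "2 * (12 * a\<^sup>2 * (N (\<lambda>z. of_real (U z)))\<^sup>2) + 2 * (S / 4 * (N (\<lambda>z. of_real (U z)))\<^sup>2) =
      (24 * a\<^sup>2 + S / 2) * (N (\<lambda>z. of_real (U z)))\<^sup>2" by (simp add: algebra_simps)
  finally show ?thesis unfolding U_def .
qed

text \<open>\<open>48 * a^2\<close> is the fixed point of the map
  \<open>S \<mapsto> 24 * a^2 + S / 2\<close> given by \<open>square_function_step\<close>. The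
  iteration starts from the crude estimate of \<open>n\<close> separate terms; the excess, which
  depends on \<open>n\<close>, is halved in each round and disappears in the limit.\<close>

lemma square_function_bound:
  fixes n :: nat
  assumes v: "subunit v" and f: "\<And>j. j < n \<Longrightarrow> f j \<in> X \<inter> LL"
  shows "(\<Sum>j<n. sqint v (T (f j))) \<le> ennreal (48 * a\<^sup>2 * (N (\<lambda>z. of_real (ssq n f z)))\<^sup>2)"
proof -
  have iter: "(\<Sum>j<n. sqint v (T (g j))) \<le>
      ennreal ((48 * a\<^sup>2 + n * a\<^sup>2 * (1 / 2) ^ k) * (N (\<lambda>z. of_real (ssq n g z)))\<^sup>2)"
    if g: "\<And>j. j < n \<Longrightarrow> g j \<in> X \<inter> LL" for g k
    using g
  proof (induction k arbitrary: g)
    case 0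
    have gX: "g j \<in> X" if "j < n" for j using 0[OF that] by simp
    have "sqint v (T (g j)) \<le> ennreal (a\<^sup>2 * (N (\<lambda>z. of_real (ssq n g z)))\<^sup>2)" if j: "j < n" for j
    proof -
      have "sqint v (T (g j)) \<le> ennreal (a\<^sup>2 * (N (g j))\<^sup>2)" using 0[OF j] by (intro subunit_T[OF v]) auto
      also have "\<dots> \<le> ennreal (a\<^sup>2 * (N (\<lambda>z. of_real (ssq n g z)))\<^sup>2)"
      proof (intro ennreal_leI mult_left_mono power_mono N_nonneg gX j)
        show "N (g j) \<le> N (\<lambda>z. of_real (ssq n g z))"
          using norm_le_ssq[OF j] by (intro N_mono X_ssq gX X_measurable j) (auto simp: ssq_nonneg)
      qed auto
      finally show ?thesis .
    qed
    then have "(\<Sum>j<n. sqint v (T (g j))) \<le> (\<Sum>j<n. ennreal (a\<^sup>2 * (N (\<lambda>z. of_real (ssq n g z)))\<^sup>2))"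
      by (intro sum_mono) auto
    also have "\<dots> = ennreal (\<Sum>j<n. a\<^sup>2 * (N (\<lambda>z. of_real (ssq n g z)))\<^sup>2)" by (rule sum_ennreal) simp
    also have "\<dots> \<le> ennreal ((48 * a\<^sup>2 + n * a\<^sup>2 * (1 / 2) ^ 0) * (N (\<lambda>z. of_real (ssq n g z)))\<^sup>2)"
      by (intro ennreal_leI) (simp add: algebra_simps)
    finally show ?case .
  next
    case (Suc k)
    have "(\<Sum>j<n. sqint v (T (g j))) \<le>
      ennreal ((24 * a\<^sup>2 + (48 * a\<^sup>2 + n * a\<^sup>2 * (1 / 2) ^ k) / 2) * (N (\<lambda>z. of_real (ssq n g z)))\<^sup>2)"
      by (rule square_function_step[OF v _ Suc.IH Suc.prems]) auto
    also have "24 * a\<^sup>2 + (48 * a\<^sup>2 + n * a\<^sup>2 * (1 / 2) ^ k) / 2 = 48 * a\<^sup>2 + n * a\<^sup>2 * (1 / 2) ^ Suc k" by simp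
    finally show ?case .
  qed
  have iter_f: "(\<Sum>j<n. sqint v (T (f j))) \<le>
      ennreal ((48 * a\<^sup>2 + n * a\<^sup>2 * (1 / 2) ^ k) * (N (\<lambda>z. of_real (ssq n f z)))\<^sup>2)" for k
    by (rule iter) (rule f)
  have "(\<lambda>k. ennreal ((48 * a\<^sup>2 + n * a\<^sup>2 * (1 / 2) ^ k) * (N (\<lambda>z. of_real (ssq n f z)))\<^sup>2)) \<longlonglongrightarrow>
      ennreal ((48 * a\<^sup>2 + n * a\<^sup>2 * 0) * (N (\<lambda>z. of_real (ssq n f z)))\<^sup>2)"
    by (intro tendsto_ennrealI tendsto_intros LIMSEQ_realpow_zero) auto
  from LIMSEQ_le_const[OF this] show ?thesis using iter_f by auto
qed

end

section \<open>Invariant weights\<close>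

context lattice_operator
begin

text \<open>The constant of \<open>sandwich\<close> for \<open>R = 48 * a^2 + 1\<close>; the summand
  1 keeps it positive when \<open>a = 0\<close>, so that one may divide by it.\<close>

definition \<beta> :: real where "\<beta> = c\<^sup>2 * (48 * a\<^sup>2 + 1)"

lemma \<beta>_pos: "0 < \<beta>"
  unfolding \<beta>_def using c_ge_1 by (simp add: add_nonneg_pos)

text \<open>\<open>sandwich\<close> with the lower bounds \<open>sqint v (T f)\<close>, whose
  consistency is exactly \<open>square_function_bound\<close>. This is a Maurey-type factorization:
  an inequality for square functions of families becomes a weighted inequality for single
  functions.\<close>

lemma dominating_weight:
  assumes v: "subunit v"
  shows "\<exists>v'. subunit v' \<and> (\<forall>f\<in>X \<inter> LL. sqint v (T f) \<le> ennreal \<beta> * sqint v' f)"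
proof -
  note vm [measurable] = subunitD(1)[OF v]
  define G where "G = {(f, t). f \<in> X \<inter> LL \<and> 0 \<le> t \<and> ennreal t = sqint v (T f)}"
  have "\<exists>w\<in>borel_measurable M.
    (\<forall>f\<in>X. sqint w f \<le> ennreal (c\<^sup>2 * (48 * a\<^sup>2 + 1) * (N f)\<^sup>2)) \<and> (\<forall>(f, t)\<in>G. ennreal t \<le> sqint w f)"
  proof (rule sandwich)
    show "f \<in> X" if "(f, t) \<in> G" for f t using that unfolding G_def by auto
    show "(\<lambda>z. of_real s * f z, s\<^sup>2 * t) \<in> G" if "(f, t) \<in> G" and s: "0 \<le> s" for f t s
    proof -
      have f: "f \<in> X" "f \<in> LL" "0 \<le> t" "ennreal t = sqint v (T f)" using that unfolding G_def by auto
      have "sqint v (T (\<lambda>z. of_real s * f z)) = sqint v (\<lambda>z. of_real s * T f z)"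
        by (rule sqint_cong_AE[OF T_scale[OF f(2)]])
      also have "\<dots> = ennreal (s\<^sup>2) * sqint v (T f)"
        using sqint_scale[OF vm L2_measurable[OF T_in_L2[OF f(2)]], of "of_real s"] by simp
      also have "\<dots> = ennreal (s\<^sup>2 * t)" using f(3,4) by (simp add: ennreal_mult)
      finally show ?thesis unfolding G_def using f X_scale L2_scale by auto
    qed
    show "(\<Sum>j<n. t j) \<le> (48 * a\<^sup>2 + 1) * (N (\<lambda>z. of_real (ssq n f z)))\<^sup>2"
      if fG: "\<And>j. j < n \<Longrightarrow> (f j, t j) \<in> G" for n f t
    proof -
      have f: "f j \<in> X \<inter> LL" "0 \<le> t j" "ennreal (t j) = sqint v (T (f j))" if "j < n" for j
        using fG[OF that] unfolding G_def by auto
      have "ennreal (\<Sum>j<n. t j) = (\<Sum>j<n. ennreal (t j))" using f(2) by (intro sum_ennreal[symmetric]) auto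
      also have "\<dots> = (\<Sum>j<n. sqint v (T (f j)))" using f(3) by (intro sum.cong) auto
      also have "\<dots> \<le> ennreal (48 * a\<^sup>2 * (N (\<lambda>z. of_real (ssq n f z)))\<^sup>2)"
        by (rule square_function_bound[OF v f(1)])
      finally have "(\<Sum>j<n. t j) \<le> 48 * a\<^sup>2 * (N (\<lambda>z. of_real (ssq n f z)))\<^sup>2" by (simp add: ennreal_le_iff)
      then show ?thesis
        using zero_le_power2[of "N (\<lambda>z. of_real (ssq n f z))"] unfolding distrib_right mult_1 by linarith
    qed
  qed simp
  then obtain w where w [measurable]: "w \<in> borel_measurable M"
    and w_X: "\<And>f. f \<in> X \<Longrightarrow> sqint w f \<le> ennreal (\<beta> * (N f)\<^sup>2)"
    and w_G: "\<And>f t. (f, t) \<in> G \<Longrightarrow> ennreal t \<le> sqint w f"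
    unfolding \<beta>_def by blast
  define v' where "v' z = ennreal (1 / \<beta>) * w z" for z
  have v'_meas: "v' \<in> borel_measurable M" unfolding v'_def by measurable
  have v'_int: "sqint v' f = ennreal (1 / \<beta>) * sqint w f" if "f \<in> X" for f
    unfolding v'_def using X_measurable[OF that]
    by (subst nn_integral_cmult[symmetric]) (auto simp: ac_simps)
  have "sqint v' f \<le> ennreal ((N f)\<^sup>2)" if f: "f \<in> X" for f
  proof -
    have "sqint v' f \<le> ennreal (1 / \<beta>) * ennreal (\<beta> * (N f)\<^sup>2)"
      unfolding v'_int[OF f] by (intro mult_left_mono w_X f) auto
    also have "\<dots> = ennreal ((N f)\<^sup>2)" using \<beta>_pos by (simp flip: ennreal_mult)
    finally show ?thesis .
  qed
  then have "subunit v'" unfolding subunit_def using v'_meas by auto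
  moreover have "sqint v (T f) \<le> ennreal \<beta> * sqint v' f" if f: "f \<in> X \<inter> LL" for f
  proof -
    have "sqint v (T f) \<le> ennreal (a\<^sup>2 * (N f)\<^sup>2)" using f by (intro subunit_T[OF v]) auto
    then obtain t where t: "0 \<le> t" "sqint v (T f) = ennreal t"
      by (cases "sqint v (T f)") (auto simp: top_unique)
    then have "(f, t) \<in> G" unfolding G_def using f by auto
    then have "sqint v (T f) \<le> sqint w f" using w_G t(2) by simp
    also have "\<dots> = ennreal \<beta> * sqint v' f"
      using f \<beta>_pos by (simp add: v'_int mult.assoc[symmetric] flip: ennreal_mult)
    finally show ?thesis .
  qed
  ultimately show ?thesis by blast
qed

text \<open>\<open>V (Suc n)\<close> dominates \<open>V n\<close> under \<open>T\<close> at the cost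
  \<open>\<beta>\<close>, so \<open>T\<close> shifts the series of \<open>(1/2)^n * V n\<close> by
  one place; since \<open>(1/2)^n\<close> is twice the next coefficient, the total cost is
  \<open>2 * \<beta>\<close>. The coefficients sum to 2, whence the bound
  \<open>2 * (N f)^2\<close>, and the term \<open>n = 0\<close> gives
  \<open>v \<le> W\<close>.\<close>

lemma invariant_weight:
  assumes v: "subunit v"
  shows "\<exists>W\<in>borel_measurable M. (\<forall>z. v z \<le> W z) \<and> (\<forall>f\<in>X. sqint W f \<le> ennreal (2 * (N f)\<^sup>2)) \<and>
    (\<forall>f\<in>X \<inter> LL. sqint W (T f) \<le> ennreal (2 * \<beta>) * sqint W f)"
proof -
  define P where "P = (\<lambda>u u'. \<forall>f\<in>X \<inter> LL. sqint u (T f) \<le> ennreal \<beta> * sqint u' f)"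
  have "\<exists>V. \<forall>n::nat. (subunit (V n) \<and> (n = 0 \<longrightarrow> V n = v)) \<and> P (V n) (V (Suc n))"
  proof (rule dependent_nat_choice)
    show "\<exists>u. subunit u \<and> ((0::nat) = 0 \<longrightarrow> u = v)" using v by auto
    show "\<exists>u'. (subunit u' \<and> (Suc n = 0 \<longrightarrow> u' = v)) \<and> P u u'" if "subunit u \<and> (n = 0 \<longrightarrow> u = v)" for u n
      using dominating_weight[of u] that unfolding P_def by auto
  qed
  then obtain V where V: "\<And>n. subunit (V n)" "V 0 = v" "\<And>n. P (V n) (V (Suc n))" by blast
  have Vm [measurable]: "V n \<in> borel_measurable M" for n using subunitD(1)[OF V(1)] .
  define e where "e n = ennreal ((1 / 2) ^ n)" for n :: nat
  define W where "W z = (\<Sum>n. e n * V n z)" for z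
  have Wm: "W \<in> borel_measurable M" unfolding W_def by measurable
  have Wint: "sqint W f = (\<Sum>n. e n * sqint (V n) f)" if [measurable]: "f \<in> borel_measurable M" for f
  proof -
    have "sqint W f = (\<integral>\<^sup>+z. (\<Sum>n. e n * (ennreal ((norm (f z))\<^sup>2) * V n z)) \<partial>M)"
      unfolding W_def ennreal_suminf_cmult[symmetric] by (simp add: mult.left_commute)
    also have "\<dots> = (\<Sum>n. e n * sqint (V n) f)"
      by (subst nn_integral_suminf) (auto intro!: suminf_cong nn_integral_cmult)
    finally show ?thesis .
  qed
  have esum: "(\<Sum>n. e n) = 2"
    unfolding e_def by (subst suminf_ennreal_eq[of _ 2]) (use power_half_series geometric_sums[of "1/2::real"] in auto)
  show ?thesis
  proof (intro bexI[OF _ Wm] conjI ballI allI)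
    fix z
    have "e 0 * V 0 z \<le> W z" unfolding W_def
      using sum_le_suminf[of "\<lambda>n. e n * V n z" "{0}"] by simp
    then show "v z \<le> W z" by (simp add: e_def V(2))
  next
    fix f assume f: "f \<in> X"
    have "sqint W f \<le> (\<Sum>n. e n * ennreal ((N f)\<^sup>2))"
      unfolding Wint[OF X_measurable[OF f]] by (intro suminf_le mult_left_mono subunitD V f) auto
    also have "\<dots> = ennreal (2 * (N f)\<^sup>2)" by (simp add: esum ennreal_mult)
    finally show "sqint W f \<le> ennreal (2 * (N f)\<^sup>2)" .
  next
    fix f assume f: "f \<in> X \<inter> LL"
    then have [measurable]: "f \<in> borel_measurable M" "T f \<in> borel_measurable M"
      using X_measurable X_measurable[OF T_in_X] by auto
    have "sqint W (T f) \<le> (\<Sum>n. e n * (ennreal \<beta> * sqint (V (Suc n)) f))"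
      unfolding Wint[OF \<open>T f \<in> borel_measurable M\<close>] using V(3) f
      by (intro suminf_le mult_left_mono) (auto simp: P_def)
    also have "\<dots> = (\<Sum>n. ennreal (2 * \<beta>) * (e (Suc n) * sqint (V (Suc n)) f))"
    proof (intro suminf_cong)
      fix n
      have "e n * ennreal \<beta> = ennreal (2 * \<beta>) * e (Suc n)"
        unfolding e_def using \<beta>_pos by (simp flip: ennreal_mult)
      then show "e n * (ennreal \<beta> * sqint (V (Suc n)) f) = ennreal (2 * \<beta>) * (e (Suc n) * sqint (V (Suc n)) f)"
        by (simp add: mult.assoc[symmetric])
    qed
    also have "\<dots> = ennreal (2 * \<beta>) * (\<Sum>n. e (Suc n) * sqint (V (Suc n)) f)" by simp
    also have "\<dots> \<le> ennreal (2 * \<beta>) * sqint W f"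
    proof (rule mult_left_mono)
      have "(\<Sum>n. e n * sqint (V n) f) = (\<Sum>n. e (n + 1) * sqint (V (n + 1)) f) + (\<Sum>n<1. e n * sqint (V n) f)"
        by (rule suminf_offset) simp
      then show "(\<Sum>n. e (Suc n) * sqint (V (Suc n)) f) \<le> sqint W f"
        unfolding Wint[OF \<open>f \<in> borel_measurable M\<close>] by simp
    qed simp
    finally show "sqint W (T f) \<le> ennreal (2 * \<beta>) * sqint W f" .
  qed
qed

end

section \<open>Extrapolation\<close>

context lattice_operator
begin

text \<open>Under the root stands the constant for squared norms found in
  \<open>truncated_weight_admissible\<close>, namely
  \<open>2 * (2 * \<beta> + A^2) + 2 * (2 * A^2)\<close>; the outer factors 2 come from splitting a
  function into two parts.\<close>

definition c\<^sub>0 :: real where "c\<^sub>0 = sqrt (4 * \<beta> + 6 * A\<^sup>2)"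

text \<open>The two-sided bounds make the weighted space equal to \<open>L2\<close> as a set and all
  integrals of the weight over balls finite. The bounds vary with the weight, but the constant
  \<open>c\<^sub>0\<close> is common to all, and only it enters the A_2 constant.\<close>

definition admissible :: "('a \<Rightarrow> real) \<Rightarrow> bool" where
  "admissible w \<longleftrightarrow> w \<in> borel_measurable M \<and> (\<exists>\<epsilon> K. 0 < \<epsilon> \<and> (\<forall>z. \<epsilon> \<le> w z \<and> w z \<le> K)) \<and>
    acts_boundedly M T (wL2 M w) (wL2_norm M w) c\<^sub>0"

lemma nn_integral_shift:
  assumes [measurable]: "g \<in> borel_measurable M" "v \<in> borel_measurable M"
  shows "(\<integral>\<^sup>+z. g z * (v z + e) \<partial>M) = (\<integral>\<^sup>+z. g z * v z \<partial>M) + e * (\<integral>\<^sup>+z. g z \<partial>M)"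
  by (simp add: distrib_left nn_integral_add nn_integral_multc mult.commute[of e])

text \<open>
  The weight \<open>W\<close> is set to \<open>\<infinity>\<close> off the support \<open>E\<close> of \<open>X\<close> before it is truncated. Where the
  result equals \<open>K + \<epsilon>\<close>, the boundedness of \<open>T\<close> in \<open>L\<^sub>2\<close> alone is used.
\<close>

lemma truncated_weight_admissible:
  fixes W :: "'a \<Rightarrow> ennreal" and B :: "nat \<Rightarrow> 'a set" and K \<epsilon> :: real
  assumes W [measurable]: "W \<in> borel_measurable M"
    and W_T: "\<And>f. f \<in> X \<inter> LL \<Longrightarrow> sqint W (T f) \<le> ennreal (2 * \<beta>) * sqint W f"
    and B: "incseq B" "\<And>n. B n \<in> sets M" "\<And>n. (\<lambda>z. of_real (indicator (B n) z)) \<in> X"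
      "\<And>f. f \<in> X \<Longrightarrow> AE z in M. z \<notin> (\<Union>n. B n) \<longrightarrow> f z = 0"
    and K: "0 < K" and \<epsilon>: "0 < \<epsilon>"
  defines "W' \<equiv> \<lambda>z. min (if z \<in> (\<Union>n. B n) then W z else \<infinity>) (ennreal K)"
  defines "w \<equiv> \<lambda>z. enn2real (W' z) + \<epsilon>"
  shows "admissible w" and "\<And>z. ennreal (w z) = W' z + ennreal \<epsilon>"
proof -
  define E where "E = (\<Union>n. B n)"
  have E [measurable]: "E \<in> sets M" unfolding E_def using B(2) by auto
  have W'_eq: "W' = (\<lambda>z. min (if z \<in> E then W z else \<infinity>) (ennreal K))" unfolding W'_def E_def ..
  have W'_meas [measurable]: "W' \<in> borel_measurable M" unfolding W'_eq by measurable
  have W'_K: "W' z \<le> ennreal K" for z unfolding W'_def by simp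
  then have W'_fin: "W' z < top" for z by (rule le_less_trans) simp
  show w_eq: "ennreal (w z) = W' z + ennreal \<epsilon>" for z
    unfolding w_def using W'_fin[of z] \<epsilon> by (subst ennreal_plus) auto
  have w_meas [measurable]: "w \<in> borel_measurable M" unfolding w_def by measurable
  have w_ge: "\<epsilon> \<le> w z" for z unfolding w_def by simp
  have w_le: "w z \<le> K + \<epsilon>" for z
  proof -
    have "enn2real (W' z) \<le> K" using W'_K[of z] K by (intro enn2real_leI) auto
    then show ?thesis unfolding w_def by simp
  qed
  define u where "u z = ennreal (w z)" for z
  have u_meas [measurable]: "u \<in> borel_measurable M" unfolding u_def by measurable
  have u_split: "sqint u g = sqint W' g + ennreal \<epsilon> * sqint (\<lambda>_. 1) g" if [measurable]: "g \<in> borel_measurable M" for g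
    unfolding u_def w_eq by (simp add: nn_integral_shift)
  have u_le: "sqint u g \<le> ennreal (K + \<epsilon>) * sqint (\<lambda>_. 1) g" if [measurable]: "g \<in> borel_measurable M" for g
  proof -
    have "sqint u g \<le> (\<integral>\<^sup>+z. ennreal (K + \<epsilon>) * (ennreal ((norm (g z))\<^sup>2) * 1) \<partial>M)"
      unfolding u_def using w_le
      by (intro nn_integral_mono) (auto simp: mult.commute[of _ "ennreal ((norm _)\<^sup>2)"] intro!: mult_left_mono ennreal_leI)
    then show ?thesis by (simp add: nn_integral_cmult)
  qed
  \<comment> \<open>\<open>f\<close> is split as \<open>g + b\<close>. The part \<open>g\<close>
    lies in \<open>X\<close> and lives where the truncation is inactive, so that \<open>W_T\<close>
    applies. For \<open>b\<close> only the \<open>L_2\<close> bound is used, which is affordable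
    where \<open>u\<close> attains its maximum \<open>K + \<epsilon>\<close>.\<close>
  have bound: "sqint u (T f) \<le> ennreal (4 * \<beta> + 6 * A\<^sup>2) * sqint u f" if f: "f \<in> LL" for f
  proof (cases "sqint u f = 0")
    case True
    note f_meas [measurable] = L2_measurable[OF f]
    have "ennreal \<epsilon> * sqint (\<lambda>_. 1) f = 0" using True u_split[OF f_meas] by simp
    then have "sqint (\<lambda>_. 1) (T f) = 0" using T_L2_bound[OF f] \<epsilon> by simp
    then have "sqint u (T f) = 0" using u_le[OF L2_measurable[OF T_in_L2[OF f]]] by simp
    then show ?thesis by simp
  next
    case False
    note f_meas [measurable] = L2_measurable[OF f]
    define R where "R k = {z \<in> space M. z \<in> E \<and> W z \<le> ennreal K \<and> norm (f z) \<le> real k \<and> z \<in> B k}" for k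
    have Bm [measurable]: "B k \<in> sets M" for k by (rule B(2))
    have R_meas [measurable]: "R k \<in> sets M" for k unfolding R_def by measurable
    \<comment> \<open>The exceptional set: the truncation is inactive, but \<open>f\<close> exceeds
      \<open>k\<close> or \<open>B k\<close> has not yet reached the point. Its share of the
      integral of \<open>|f|^2\<close> tends to zero.\<close>
    define D where "D k = {z \<in> space M. z \<in> E \<and> W z \<le> ennreal K} - R k" for k
    have D_meas [measurable]: "D k \<in> sets M" for k unfolding D_def by measurable
    have f_fin: "(\<integral>\<^sup>+z. ennreal ((norm (f z))\<^sup>2) \<partial>M) < \<infinity>" using f unfolding L2_iff by simp
    have "(\<lambda>k. \<integral>\<^sup>+z. ennreal ((norm (f z))\<^sup>2) * indicator (D k) z \<partial>M) \<longlonglongrightarrow> (\<integral>\<^sup>+z. 0 \<partial>M)"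
    proof (rule nn_integral_dominated_convergence[OF _ _ _ _ f_fin])
      show "AE z in M. ennreal ((norm (f z))\<^sup>2) * indicator (D k) z \<le> ennreal ((norm (f z))\<^sup>2)" for k
        by (auto simp: indicator_def)
      show "AE z in M. (\<lambda>k. ennreal ((norm (f z))\<^sup>2) * indicator (D k) z) \<longlonglongrightarrow> 0"
      proof (rule AE_I2)
        fix z assume z: "z \<in> space M"
        have "\<forall>\<^sub>F k in sequentially. z \<notin> D k"
        proof (cases "z \<in> E")
          case True
          then obtain i where i: "z \<in> B i" unfolding E_def by auto
          obtain j :: nat where j: "norm (f z) \<le> real j" using real_arch_simple by blast
          have "z \<notin> D k" if "max i j \<le> k" for k
          proof -
            have "z \<in> B k" using i B(1) that by (auto simp: incseq_def)
            moreover have "norm (f z) \<le> real k" using j that by simp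
            ultimately show ?thesis unfolding D_def R_def using True by auto
          qed
          then show ?thesis unfolding eventually_sequentially by blast
        qed (auto simp: D_def)
        then have "\<forall>\<^sub>F k in sequentially. ennreal ((norm (f z))\<^sup>2) * indicator (D k) z = 0"
          by eventually_elim simp
        then show "(\<lambda>k. ennreal ((norm (f z))\<^sup>2) * indicator (D k) z) \<longlonglongrightarrow> 0"
          by (rule tendsto_eventually)
      qed
    qed measurable
    \<comment> \<open>The tolerance for \<open>D k\<close>, positive because the case
      \<open>sqint u f = 0\<close> was treated separately. After multiplication by
      \<open>K + \<epsilon>\<close>, which is what \<open>b\<close> may cost on \<open>D k\<close>,
      it amounts to one more \<open>sqint u f\<close>.\<close>
    moreover have "0 < sqint u f / ennreal (K + \<epsilon>)"
      using False by (simp add: zero_less_iff_neq_zero ennreal_divide_eq_0_iff)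
    ultimately have "\<forall>\<^sub>F k in sequentially. (\<integral>\<^sup>+z. ennreal ((norm (f z))\<^sup>2) * indicator (D k) z \<partial>M) < sqint u f / ennreal (K + \<epsilon>)"
      by (intro order_tendstoD) auto
    then obtain k where k: "(\<integral>\<^sup>+z. ennreal ((norm (f z))\<^sup>2) * indicator (D k) z \<partial>M) < sqint u f / ennreal (K + \<epsilon>)"
      unfolding eventually_sequentially by blast
    define g where "g z = of_real (indicator (R k) z) * f z" for z
    define b where "b z = of_real (indicator (- R k) z) * f z" for z
    have fgb: "f = (\<lambda>z. g z + b z)" unfolding g_def b_def by (auto simp: indicator_def)
    have g_meas [measurable]: "g \<in> borel_measurable M" unfolding g_def by measurable
    have b_meas: "b \<in> borel_measurable M"
    proof -
      have "b = (\<lambda>z. f z - g z)" unfolding fgb by auto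
      then show ?thesis by simp
    qed
    note [measurable] = b_meas
    have g_le: "norm (g z) \<le> norm (f z)" for z unfolding g_def by (auto simp: indicator_def)
    have b_le: "norm (b z) \<le> norm (f z)" for z unfolding b_def by (auto simp: indicator_def)
    have g_L2: "g \<in> LL" and b_L2: "b \<in> LL" by (rule L2_ideal[OF f]; use g_le b_le in simp)+
    have g_X: "g \<in> X"
    proof (rule X_ideal[OF X_scale[OF B(3)[of k], of "of_real (real k)"]])
      have "norm (g z) \<le> real k * indicator (B k) z" for z
        unfolding g_def by (auto simp: indicator_def R_def norm_mult)
      then show "AE z in M. norm (g z) \<le> norm (of_real (real k) * of_real (indicator (B k) z) :: 'k)"
        unfolding norm_mult norm_of_real by (auto simp: indicator_def)
    qed measurable
    have Tg: "sqint W' (T g) \<le> ennreal (2 * \<beta>) * sqint W' g"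
    proof -
      \<comment> \<open>Off \<open>E\<close> the weight \<open>W'\<close> equals \<open>K\<close>
        whatever \<open>W\<close> is; this does no harm, since \<open>T g\<close> belongs to
        \<open>X\<close> and so vanishes there.\<close>
      have "AE z in M. z \<notin> E \<longrightarrow> T g z = 0" unfolding E_def by (rule B(4)[OF T_in_X[OF g_X g_L2]])
      then have "sqint W' (T g) \<le> sqint W (T g)"
      proof (intro nn_integral_mono_AE, eventually_elim)
        case (elim z)
        then show ?case by (cases "z \<in> E") (auto simp: W'_eq intro: mult_left_mono)
      qed
      also have "\<dots> \<le> ennreal (2 * \<beta>) * sqint W g" using g_X g_L2 by (intro W_T) auto
      also have "sqint W g = sqint W' g"
        by (intro nn_integral_cong) (auto simp: g_def indicator_def R_def W'_eq min_def)
      finally show ?thesis .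
    qed
    have 1: "sqint u (T g) \<le> ennreal (2 * \<beta> + A\<^sup>2) * sqint u f"
    proof -
      have "sqint u (T g) = sqint W' (T g) + ennreal \<epsilon> * sqint (\<lambda>_. 1) (T g)"
        by (rule u_split[OF L2_measurable[OF T_in_L2[OF g_L2]]])
      also have "\<dots> \<le> ennreal (2 * \<beta>) * sqint W' g + ennreal \<epsilon> * (ennreal (A\<^sup>2) * sqint (\<lambda>_. 1) g)"
        by (intro add_mono Tg mult_left_mono T_L2_bound g_L2) auto
      also have "\<dots> \<le> ennreal (2 * \<beta> + A\<^sup>2) * sqint W' g + ennreal (2 * \<beta> + A\<^sup>2) * (ennreal \<epsilon> * sqint (\<lambda>_. 1) g)"
      proof (rule add_mono)
        show "ennreal (2 * \<beta>) * sqint W' g \<le> ennreal (2 * \<beta> + A\<^sup>2) * sqint W' g"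
          using \<beta>_pos by (intro mult_right_mono ennreal_leI) auto
        have "ennreal \<epsilon> * (ennreal (A\<^sup>2) * sqint (\<lambda>_. 1) g) = ennreal (A\<^sup>2) * (ennreal \<epsilon> * sqint (\<lambda>_. 1) g)"
          by (simp add: ac_simps)
        also have "\<dots> \<le> ennreal (2 * \<beta> + A\<^sup>2) * (ennreal \<epsilon> * sqint (\<lambda>_. 1) g)"
          using \<beta>_pos by (intro mult_right_mono ennreal_leI) auto
        finally show "ennreal \<epsilon> * (ennreal (A\<^sup>2) * sqint (\<lambda>_. 1) g) \<le> ennreal (2 * \<beta> + A\<^sup>2) * (ennreal \<epsilon> * sqint (\<lambda>_. 1) g)" .
      qed
      also have "\<dots> = ennreal (2 * \<beta> + A\<^sup>2) * sqint u g"
        unfolding u_split[OF g_meas] by (simp add: distrib_left)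
      also have "\<dots> \<le> ennreal (2 * \<beta> + A\<^sup>2) * sqint u f"
        using g_le by (intro mult_left_mono sqint_mono) auto
      finally show ?thesis .
    qed
    have 2: "sqint u (T b) \<le> ennreal (2 * A\<^sup>2) * sqint u f"
    proof -
      have pt: "ennreal (K + \<epsilon>) * ennreal ((norm (b z))\<^sup>2) \<le>
          ennreal ((norm (f z))\<^sup>2) * u z + ennreal (K + \<epsilon>) * (ennreal ((norm (f z))\<^sup>2) * indicator (D k) z)"
        if z: "z \<in> space M" for z
      proof (cases "z \<in> R k \<or> z \<in> D k")
        case True
        then show ?thesis by (auto simp: b_def indicator_def add_increasing)
      next
        case F: False
        then have "W' z = ennreal K" using z unfolding W'_eq D_def by (auto simp: min_def top_unique)
        then have "u z = ennreal (K + \<epsilon>)" unfolding u_def w_eq using K \<epsilon> by simp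
        then show ?thesis using F by (simp add: b_def mult.commute)
      qed
      have "ennreal (K + \<epsilon>) * sqint (\<lambda>_. 1) b = (\<integral>\<^sup>+z. ennreal (K + \<epsilon>) * ennreal ((norm (b z))\<^sup>2) \<partial>M)"
        by (simp add: nn_integral_cmult)
      also have "\<dots> \<le> (\<integral>\<^sup>+z. ennreal ((norm (f z))\<^sup>2) * u z +
          ennreal (K + \<epsilon>) * (ennreal ((norm (f z))\<^sup>2) * indicator (D k) z) \<partial>M)"
        by (rule nn_integral_mono) (rule pt)
      also have "\<dots> = sqint u f + ennreal (K + \<epsilon>) * (\<integral>\<^sup>+z. ennreal ((norm (f z))\<^sup>2) * indicator (D k) z \<partial>M)"
        by (subst nn_integral_add) (auto simp: nn_integral_cmult)
      also have "\<dots> \<le> sqint u f + ennreal (K + \<epsilon>) * (sqint u f / ennreal (K + \<epsilon>))"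
        using k by (intro add_left_mono mult_left_mono) auto
      also have "ennreal (K + \<epsilon>) * (sqint u f / ennreal (K + \<epsilon>)) = sqint u f"
        using K \<epsilon> by (subst mult.commute) (simp add: ennreal_divide_times ennreal_mult_divide_eq)
      finally have b2: "ennreal (K + \<epsilon>) * sqint (\<lambda>_. 1) b \<le> 2 * sqint u f" by (simp add: mult_2)
      have "sqint u (T b) \<le> ennreal (K + \<epsilon>) * sqint (\<lambda>_. 1) (T b)"
        by (rule u_le[OF L2_measurable[OF T_in_L2[OF b_L2]]])
      also have "\<dots> \<le> ennreal (K + \<epsilon>) * (ennreal (A\<^sup>2) * sqint (\<lambda>_. 1) b)"
        by (intro mult_left_mono T_L2_bound b_L2) auto
      also have "\<dots> = ennreal (A\<^sup>2) * (ennreal (K + \<epsilon>) * sqint (\<lambda>_. 1) b)" by (simp add: ac_simps)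
      also have "\<dots> \<le> ennreal (A\<^sup>2) * (2 * sqint u f)" by (intro mult_left_mono b2) auto
      also have "\<dots> = ennreal (2 * A\<^sup>2) * sqint u f" by (simp add: ennreal_mult ac_simps)
      finally show ?thesis .
    qed
    have "AE z in M. T f z = T g z + T b z" using T_add[OF g_L2 b_L2] fgb by simp
    then have "sqint u (T f) = sqint u (\<lambda>z. T g z + T b z)" by (rule sqint_cong_AE)
    also have "\<dots> \<le> 2 * sqint u (T g) + 2 * sqint u (T b)"
      by (intro sqint_add_le u_meas L2_measurable T_in_L2 g_L2 b_L2)
    also have "\<dots> \<le> 2 * (ennreal (2 * \<beta> + A\<^sup>2) * sqint u f) + 2 * (ennreal (2 * A\<^sup>2) * sqint u f)"
      by (intro add_mono mult_left_mono 1 2) auto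
    also have "\<dots> = (2 * ennreal (2 * \<beta> + A\<^sup>2) + 2 * ennreal (2 * A\<^sup>2)) * sqint u f"
      by (simp add: distrib_right mult.assoc)
    also have "2 * ennreal (2 * \<beta> + A\<^sup>2) + 2 * ennreal (2 * A\<^sup>2) = ennreal (4 * \<beta> + 6 * A\<^sup>2)"
    proof -
      from ennreal_double_sum[of "2 * \<beta> + A\<^sup>2" "2 * A\<^sup>2"] show ?thesis using \<beta>_pos by (simp add: algebra_simps)
    qed
    finally show ?thesis .
  qed
  have w_int: "(\<integral>\<^sup>+z. ennreal ((norm (f z))\<^sup>2 * w z) \<partial>M) = sqint u f" for f :: "'a \<Rightarrow> 'k"
    unfolding u_def using w_ge \<epsilon> by (intro nn_integral_cong ennreal_mult) (auto intro: order_trans[OF less_imp_le])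
  have "acts_boundedly M T (wL2 M w) (wL2_norm M w) c\<^sub>0"
    unfolding acts_boundedly_def
  proof (intro conjI ballI)
    show "0 \<le> c\<^sub>0" unfolding c\<^sub>0_def using \<beta>_pos by simp
    fix f assume "f \<in> wL2 M w \<inter> LL"
    then have f: "sqint u f < \<infinity>" "f \<in> LL" unfolding wL2_def w_int by auto
    have fin: "sqint u (T f) < \<infinity>"
      by (rule le_less_trans[OF bound[OF f(2)]]) (use f(1) in \<open>simp add: ennreal_mult_less_top\<close>)
    then show "T f \<in> wL2 M w" unfolding wL2_def w_int using L2_measurable[OF T_in_L2[OF f(2)]] by simp
    have "enn2real (sqint u (T f)) \<le> enn2real (ennreal (4 * \<beta> + 6 * A\<^sup>2) * sqint u f)"
      by (rule enn2real_mono[OF bound[OF f(2)]]) (use f(1) in \<open>simp add: ennreal_mult_less_top\<close>)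
    also have "\<dots> = (4 * \<beta> + 6 * A\<^sup>2) * enn2real (sqint u f)"
      unfolding enn2real_mult using \<beta>_pos by (subst enn2real_ennreal) auto
    finally show "wL2_norm M w (T f) \<le> c\<^sub>0 * wL2_norm M w f"
      unfolding wL2_norm_def w_int c\<^sub>0_def by (simp add: real_sqrt_mult[symmetric])
  qed
  then show "admissible w" unfolding admissible_def using w_meas w_ge w_le \<epsilon> by blast
qed

end

context convex_lattice
begin

lemma fatou_bound:
  fixes f :: "nat \<Rightarrow> 'a \<Rightarrow> 'k"
  assumes f: "\<And>j. f j \<in> X" "\<And>j. N (f j) \<le> B" and g: "g \<in> borel_measurable M"
    and lim: "AE z in M. (\<lambda>j. f j z) \<longlonglongrightarrow> g z"
  shows "g \<in> X" "N g \<le> B"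
proof -
  have B: "0 \<le> B" using f(2)[of 0] N_nonneg[OF f(1)[of 0]] by simp
  \<comment> \<open>Dividing by any \<open>b > B\<close> instead of \<open>B\<close> covers the case
    \<open>B = 0\<close>; in the end \<open>b\<close> decreases to \<open>B\<close>.\<close>
  have scaled: "(\<lambda>z. of_real (1 / b) * g z) \<in> X \<and> N (\<lambda>z. of_real (1 / b) * g z) \<le> 1" if b: "B < b" for b
  proof -
    have b0: "0 < b" using B b by simp
    have "(\<lambda>z. of_real (1 / b) * f j z) \<in> X \<and> N (\<lambda>z. of_real (1 / b) * f j z) \<le> 1" for j
    proof
      show "(\<lambda>z. of_real (1 / b) * f j z) \<in> X" by (rule X_scale[OF f(1)])
      have "N (\<lambda>z. of_real (1 / b) * f j z) = 1 / b * N (f j)"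
        unfolding N_scale[OF f(1)] norm_of_real using b0 by simp
      also have "\<dots> \<le> 1" using f(2)[of j] b b0 by (simp add: field_simps)
      finally show "N (\<lambda>z. of_real (1 / b) * f j z) \<le> 1" .
    qed
    moreover have "AE z in M. (\<lambda>j. of_real (1 / b) * f j z) \<longlonglongrightarrow> of_real (1 / b) * g z"
      using lim by eventually_elim (intro tendsto_intros)
    moreover have "(\<lambda>z. of_real (1 / b) * g z) \<in> borel_measurable M" using g by measurable
    ultimately show ?thesis
      using fatou[unfolded fatou_property_def, rule_format, of "\<lambda>j z. of_real (1 / b) * f j z" "\<lambda>z. of_real (1 / b) * g z"]
      by blast
  qed
  show gX: "g \<in> X"
  proof -
    have "of_real (B + 1) * (of_real (1 / (B + 1)) * x) = x" for x :: 'k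
      unfolding mult.assoc[symmetric] of_real_mult[symmetric] using B by simp
    then show ?thesis
      using X_scale[OF conjunct1[OF scaled[of "B + 1"]], of "of_real (B + 1)"] by simp
  qed
  have "N g \<le> b" if b: "B < b" for b
  proof -
    have b0: "0 < b" using B b by simp
    have "1 / b * N g \<le> 1"
      using conjunct2[OF scaled[OF b]] b0 unfolding N_scale[OF gX] norm_of_real by simp
    then show ?thesis using b0 by (simp add: field_simps)
  qed
  then show "N g \<le> B" by (rule dense_ge)
qed

end

context lattice_operator
begin

text \<open>For a minorant \<open>r\<close> of \<open>h\<close> in \<open>X\<close>,
  \<open>norming_weight\<close> computes the norm of \<open>r\<close> up to \<open>c^2\<close> by a
  weight \<open>v\<close>, and \<open>invariant_weight\<close> majorises \<open>v\<close> by
  \<open>W\<close>. Up to truncations, \<open>\<integral>h^2 v \<le> \<integral>h^2 W \<le> C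
  \<integral>|f|^2 W \<le> 2 C (N f)^2\<close>, whence the constant \<open>c * sqrt (2 * C)\<close>.
  Since \<open>h\<close> is merely measurable, its finiteness, its vanishing off the support of
  \<open>X\<close> and its membership in \<open>X\<close> are also extracted from the weighted
  bounds.\<close>

lemma extrapolation:
  fixes h :: "'a \<Rightarrow> ennreal" and C :: real
  assumes f: "f \<in> X" "f \<in> LL" and h [measurable]: "h \<in> borel_measurable M" and C: "0 \<le> C"
    and weighted: "\<And>w. admissible w \<Longrightarrow>
      (\<integral>\<^sup>+z. (h z)\<^sup>2 * ennreal (w z) \<partial>M) \<le> ennreal C * sqint (\<lambda>z. ennreal (w z)) f"
  shows "\<exists>g\<in>X. (AE z in M. h z = ennreal (norm (g z))) \<and> N g \<le> c * sqrt (2 * C) * N f"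
proof -
  obtain B where B: "incseq B" "\<And>n. B n \<in> sets M" "\<And>n. emeasure M (B n) < \<infinity>"
    "\<And>n. (\<lambda>z. of_real (indicator (B n) z)) \<in> X"
    "\<And>f. f \<in> X \<Longrightarrow> AE z in M. z \<notin> (\<Union>n. B n) \<longrightarrow> f z = 0"
    by (rule exhaustion) blast
  define E where "E = (\<Union>n. B n)"
  have E [measurable]: "E \<in> sets M" unfolding E_def using B(2) by auto
  have Bm [measurable]: "B k \<in> sets M" for k by (rule B(2))
  note fm [measurable] = X_measurable[OF f(1)]
  have f_fin: "sqint (\<lambda>_. 1) f < \<infinity>" using f(2) unfolding L2_iff by simp
  \<comment> \<open>The weight is infinite off \<open>E\<close>, so a finite integral forces
    \<open>h = 0\<close> there. That some admissible weight exists is recorded for the proof that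
    \<open>h\<close> is finite.\<close>
  have key: "\<exists>W\<in>borel_measurable M. (\<forall>z. v z \<le> W z) \<and>
      (\<integral>\<^sup>+z. (h z)\<^sup>2 * (if z \<in> E then W z else \<infinity>) \<partial>M) \<le> ennreal (2 * C * (N f)\<^sup>2) \<and>
      (\<exists>w. admissible w)" if v: "subunit v" for v
  proof -
    obtain W where W [measurable]: "W \<in> borel_measurable M" and W_v: "\<And>z. v z \<le> W z"
      and W_X: "\<And>f. f \<in> X \<Longrightarrow> sqint W f \<le> ennreal (2 * (N f)\<^sup>2)"
      and W_T: "\<And>f. f \<in> X \<inter> LL \<Longrightarrow> sqint W (T f) \<le> ennreal (2 * \<beta>) * sqint W f"
      using invariant_weight[OF v] by blast
    define V where "V K z = min (if z \<in> E then W z else \<infinity>) (ennreal K)" for K z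
    have V_meas [measurable]: "V K \<in> borel_measurable M" for K unfolding V_def by measurable
    have adm: "admissible (\<lambda>z. enn2real (V K z) + \<epsilon>)"
      "ennreal (enn2real (V K z) + \<epsilon>) = V K z + ennreal \<epsilon>" if "0 < K" "0 < \<epsilon>" for K \<epsilon> z
      unfolding V_def E_def
      by (rule truncated_weight_admissible[OF W _ B(1,2,4) _ that]; use W_T B(5) in blast)+
    \<comment> \<open>The perturbation by \<open>\<epsilon>\<close> disappears because
      \<open>f\<close> lies in \<open>L_2\<close>; the level \<open>K\<close> is removed afterwards
      by monotone convergence.\<close>
    have V_bound: "(\<integral>\<^sup>+z. (h z)\<^sup>2 * V K z \<partial>M) \<le> ennreal (2 * C * (N f)\<^sup>2)" if K: "0 < K" for K
    proof (rule ennreal_le_by_eps_mult)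
      fix \<epsilon> :: real assume \<epsilon>: "0 < \<epsilon>"
      have "(\<integral>\<^sup>+z. (h z)\<^sup>2 * V K z \<partial>M) \<le> (\<integral>\<^sup>+z. (h z)\<^sup>2 * (V K z + ennreal \<epsilon>) \<partial>M)"
        by (intro nn_integral_mono mult_left_mono) auto
      also have "\<dots> \<le> ennreal C * sqint (\<lambda>z. V K z + ennreal \<epsilon>) f"
        using weighted[OF adm(1)[OF K \<epsilon>]] adm(2)[OF K \<epsilon>] by simp
      also have "sqint (\<lambda>z. V K z + ennreal \<epsilon>) f = sqint (V K) f + ennreal \<epsilon> * sqint (\<lambda>_. 1) f"
        by (simp add: nn_integral_shift)
      also have "sqint (V K) f \<le> sqint W f"
        using B(5)[OF f(1)]
      proof (intro nn_integral_mono_AE, eventually_elim)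
        case (elim z)
        then show ?case by (cases "z \<in> E") (auto simp: V_def E_def intro: mult_left_mono)
      qed
      also have "sqint W f \<le> ennreal (2 * (N f)\<^sup>2)" by (rule W_X[OF f(1)])
      finally have "(\<integral>\<^sup>+z. (h z)\<^sup>2 * V K z \<partial>M) \<le> ennreal C * (ennreal (2 * (N f)\<^sup>2) + ennreal \<epsilon> * sqint (\<lambda>_. 1) f)"
        by (simp add: add_right_mono mult_left_mono)
      also have "\<dots> = ennreal (2 * C * (N f)\<^sup>2) + ennreal \<epsilon> * (ennreal C * sqint (\<lambda>_. 1) f)"
        using C by (simp add: distrib_left ennreal_mult ac_simps)
      finally show "(\<integral>\<^sup>+z. (h z)\<^sup>2 * V K z \<partial>M) \<le>
          ennreal (2 * C * (N f)\<^sup>2) + ennreal \<epsilon> * (ennreal C * sqint (\<lambda>_. 1) f)" .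
    next
      show "ennreal C * sqint (\<lambda>_. 1) f < \<infinity>" using f_fin by (simp add: ennreal_mult_less_top)
    qed
    have "(\<integral>\<^sup>+z. (h z)\<^sup>2 * (if z \<in> E then W z else \<infinity>) \<partial>M) =
        (\<integral>\<^sup>+z. (SUP n. (h z)\<^sup>2 * V (real (Suc n)) z) \<partial>M)"
      unfolding V_def SUP_mult_left_ennreal[symmetric] ennreal_SUP_min_nat ..
    also have "\<dots> = (SUP n. \<integral>\<^sup>+z. (h z)\<^sup>2 * V (real (Suc n)) z \<partial>M)"
    proof (rule nn_integral_monotone_convergence_SUP)
      show "incseq (\<lambda>n z. (h z)\<^sup>2 * V (real (Suc n)) z)"
        unfolding incseq_def le_fun_def V_def
        by (intro allI impI mult_left_mono min.mono order_refl ennreal_leI) auto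
    qed measurable
    also have "\<dots> \<le> ennreal (2 * C * (N f)\<^sup>2)" by (intro SUP_least V_bound) simp
    finally show ?thesis using W W_v adm(1)[OF zero_less_one zero_less_one] by blast
  qed
  \<comment> \<open>Even the zero weight gives information: its majorant yields \<open>h = 0\<close>
    off \<open>E\<close>, and the admissible weight obtained with it, being bounded below, yields
    finiteness of \<open>h\<close> a.e.\<close>
  have "subunit (\<lambda>_. 0)" unfolding subunit_def by simp
  from key[OF this] obtain W0 w where W0 [measurable]: "W0 \<in> borel_measurable M"
    and W0_int: "(\<integral>\<^sup>+z. (h z)\<^sup>2 * (if z \<in> E then W0 z else \<infinity>) \<partial>M) \<le> ennreal (2 * C * (N f)\<^sup>2)"
    and w: "admissible w" by blast
  have "(\<integral>\<^sup>+z. (h z)\<^sup>2 * (if z \<in> E then W0 z else \<infinity>) \<partial>M) \<noteq> \<infinity>"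
    using W0_int by (auto simp: top_unique)
  then have "AE z in M. (h z)\<^sup>2 * (if z \<in> E then W0 z else \<infinity>) \<noteq> \<infinity>"
    by (intro nn_integral_noteq_infinite) auto
  then have h_off: "AE z in M. z \<notin> E \<longrightarrow> h z = 0"
    by eventually_elim (auto simp: ennreal_mult_eq_top_iff split: if_splits)
  have h_fin: "AE z in M. h z < \<infinity>"
  proof -
    obtain \<epsilon> K where w': "0 < \<epsilon>" "\<And>z. \<epsilon> \<le> w z" "\<And>z. w z \<le> K" and [measurable]: "w \<in> borel_measurable M"
      using w unfolding admissible_def by blast
    have "sqint (\<lambda>z. ennreal (w z)) f \<le> (\<integral>\<^sup>+z. ennreal K * (ennreal ((norm (f z))\<^sup>2) * 1) \<partial>M)"
      using w'(3) by (intro nn_integral_mono) (auto simp: mult.commute[of _ "ennreal ((norm _)\<^sup>2)"] intro!: mult_left_mono ennreal_leI)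
    also have "\<dots> < \<infinity>" using f_fin by (simp add: nn_integral_cmult ennreal_mult_less_top)
    finally have "(\<integral>\<^sup>+z. (h z)\<^sup>2 * ennreal (w z) \<partial>M) < \<infinity>"
      using weighted[OF w] by (auto simp: ennreal_mult_less_top elim!: le_less_trans)
    then have "AE z in M. (h z)\<^sup>2 * ennreal (w z) \<noteq> \<infinity>"
      by (intro nn_integral_noteq_infinite) auto
    then show ?thesis
    proof eventually_elim
      case (elim z)
      have "ennreal (w z) \<noteq> 0" using w'(1) w'(2)[of z] by simp
      with elim have "(h z)\<^sup>2 \<noteq> \<infinity>" by (auto simp: ennreal_mult_eq_top_iff)
      then show ?case by (cases "h z") (auto simp: power2_eq_square ennreal_mult_eq_top_iff)
    qed
  qed
  define h' where "h' z = enn2real (h z)" for z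
  have h'_meas [measurable]: "h' \<in> borel_measurable M" unfolding h'_def by measurable
  have h'_nn: "0 \<le> h' z" for z unfolding h'_def by simp
  \<comment> \<open>Bounded minorants of \<open>h\<close> supported in \<open>B k\<close> certainly
    lie in \<open>X\<close>. They converge to \<open>h\<close>, and the Fatou property transfers
    their uniform bound.\<close>
  define r where "r k z = min (h' z) (real k) * indicator (B k) z" for k z
  have r_meas [measurable]: "r k \<in> borel_measurable M" for k unfolding r_def by measurable
  have r_nn: "0 \<le> r k z" for k z unfolding r_def using h'_nn[of z] by (auto simp: indicator_def)
  have r_X: "(\<lambda>z. of_real (r k z)) \<in> X" for k
  proof (rule X_ideal[OF X_scale[OF B(4)[of k], of "of_real (real k)"]])
    show "AE z in M. norm (of_real (r k z) :: 'k) \<le> norm (of_real (real k) * of_real (indicator (B k) z) :: 'k)"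
      unfolding norm_mult norm_of_real using h'_nn by (auto simp: r_def indicator_def)
  qed measurable
  have r_bound: "N (\<lambda>z. of_real (r k z)) \<le> c * sqrt (2 * C) * N f" for k
  proof -
    obtain v where v: "v \<in> borel_measurable M" "\<And>f. f \<in> X \<Longrightarrow> sqint v f \<le> ennreal ((N f)\<^sup>2)"
      "ennreal ((N (\<lambda>z. of_real (r k z)))\<^sup>2) \<le> ennreal (c\<^sup>2) * sqint v (\<lambda>z. of_real (r k z))"
      using norming_weight[OF r_X[of k]] by blast
    have "subunit v" unfolding subunit_def using v by auto
    from key[OF this] obtain W where W: "\<And>z. v z \<le> W z"
      "(\<integral>\<^sup>+z. (h z)\<^sup>2 * (if z \<in> E then W z else \<infinity>) \<partial>M) \<le> ennreal (2 * C * (N f)\<^sup>2)" by blast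
    have "sqint v (\<lambda>z. of_real (r k z)) \<le> (\<integral>\<^sup>+z. (h z)\<^sup>2 * (if z \<in> E then W z else \<infinity>) \<partial>M)"
    proof (intro nn_integral_mono mult_mono)
      fix z
      have "ennreal (r k z) \<le> h z"
      proof -
        have "r k z \<le> h' z" using h'_nn[of z] by (auto simp: r_def indicator_def)
        then have "ennreal (r k z) \<le> ennreal (h' z)" by (rule ennreal_leI)
        also have "\<dots> \<le> h z" unfolding h'_def by (cases "h z") auto
        finally show ?thesis .
      qed
      then have "(ennreal (r k z))\<^sup>2 \<le> (h z)\<^sup>2" by (rule power_mono) simp
      then show "ennreal ((norm (of_real (r k z) :: 'k))\<^sup>2) \<le> (h z)\<^sup>2"
        using r_nn by (simp add: ennreal_power)
      show "v z \<le> (if z \<in> E then W z else \<infinity>)" using W(1) by simp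
    qed auto
    also have "\<dots> \<le> ennreal (2 * C * (N f)\<^sup>2)" by (rule W(2))
    finally have "ennreal ((N (\<lambda>z. of_real (r k z)))\<^sup>2) \<le> ennreal (c\<^sup>2) * ennreal (2 * C * (N f)\<^sup>2)"
      using v(3) by (meson mult_left_mono order_trans zero_le)
    also have "\<dots> = ennreal ((c * sqrt (2 * C) * N f)\<^sup>2)"
      using C by (simp add: power_mult_distrib flip: ennreal_mult)
    finally have "(N (\<lambda>z. of_real (r k z)))\<^sup>2 \<le> (c * sqrt (2 * C) * N f)\<^sup>2" by (simp add: ennreal_le_iff)
    then show ?thesis
      by (rule power2_le_imp_le) (use C c_ge_1 N_nonneg[OF f(1)] in auto)
  qed
  have lim: "AE z in M. (\<lambda>k. of_real (r k z) :: 'k) \<longlonglongrightarrow> of_real (h' z)"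
    using h_off
  proof eventually_elim
    case (elim z)
    have "\<forall>\<^sub>F k in sequentially. r k z = h' z"
    proof (cases "z \<in> E")
      case True
      then obtain i where i: "z \<in> B i" unfolding E_def by auto
      obtain j :: nat where j: "h' z \<le> real j" using real_arch_simple by blast
      have "r k z = h' z" if "max i j \<le> k" for k
      proof -
        have "z \<in> B k" using i B(1) that by (auto simp: incseq_def)
        moreover have "h' z \<le> real k" using j that by simp
        ultimately show ?thesis unfolding r_def by simp
      qed
      then show ?thesis unfolding eventually_sequentially by blast
    qed (use elim in \<open>simp add: r_def h'_def\<close>)
    then have "(\<lambda>k. r k z) \<longlonglongrightarrow> h' z" by (rule tendsto_eventually)
    then show ?case by (rule tendsto_of_real)
  qed
  have h'm: "(\<lambda>z. of_real (h' z) :: 'k) \<in> borel_measurable M" by measurable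
  show ?thesis
  proof (intro bexI conjI)
    show "(\<lambda>z. of_real (h' z)) \<in> X" "N (\<lambda>z. of_real (h' z)) \<le> c * sqrt (2 * C) * N f"
      by (rule fatou_bound[OF r_X r_bound h'm lim])+
    show "AE z in M. h z = ennreal (norm (of_real (h' z) :: 'k))"
      using h_fin by eventually_elim (simp add: h'_nn, simp add: h'_def)
  qed
qed

end

section \<open>Spaces of homogeneous type\<close>

text \<open>For a finite measure with the same null sets as \<open>M\<close>, the disjoint sets have
  summable masses, and a summable family has only countably many nonzero terms.\<close>

lemma (in sigma_finite_measure) countable_disjoint_positive:
  assumes F: "\<And>q. q \<in> Q \<Longrightarrow> F q \<in> sets M" "\<And>q. q \<in> Q \<Longrightarrow> 0 < emeasure M (F q)"
    and disj: "disjoint_family_on F Q"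
  shows "countable Q"
proof -
  obtain p where p [measurable]: "p \<in> borel_measurable M" and p_fin: "integral\<^sup>N M p \<noteq> \<infinity>"
    and p_pos: "\<And>z. z \<in> space M \<Longrightarrow> 0 < p z"
    using Ex_finite_integrable_function by blast
  define P where "P = density M p"
  have sP [simp]: "sets P = sets M" "space P = space M" unfolding P_def by simp_all
  have "emeasure P (space P) \<noteq> \<infinity>"
    using p_fin unfolding P_def by (simp add: emeasure_density cong: nn_integral_cong)
  then interpret P: finite_measure P by (rule finite_measureI)
  have pos: "0 < measure P (F q)" if q: "q \<in> Q" for q
  proof (rule ccontr)
    assume "\<not> 0 < measure P (F q)"
    then have "emeasure P (F q) = 0" by (simp add: P.emeasure_eq_measure not_less antisym)
    then have "AE z in M. z \<in> F q \<longrightarrow> p z = 0"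
      unfolding P_def using F(1)[OF q] by (subst (asm) emeasure_density) (auto simp: nn_integral_0_iff_AE indicator_def)
    then have "AE z in M. z \<notin> F q" using AE_space by eventually_elim (metis p_pos less_irrefl)
    then have "emeasure M (F q) = 0"
      using F(1)[OF q] by (simp add: AE_iff_measurable[OF _ refl] sets.sets_into_space[OF F(1)[OF q]] Int_absorb1 flip: Int_def)
    then show False using F(2)[OF q] by simp
  qed
  have "(\<Sum>q\<in>I. measure P (F q)) \<le> measure P (space P)" if I: "finite I" "I \<subseteq> Q" for I
  proof -
    have "(\<Sum>q\<in>I. measure P (F q)) = measure P (\<Union>q\<in>I. F q)"
      using I F(1) by (intro P.finite_measure_finite_Union[symmetric] disjoint_family_on_mono[OF _ disj]) auto
    also have "\<dots> \<le> measure P (space P)" by (rule P.bounded_measure)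
    finally show ?thesis .
  qed
  then have "(\<lambda>q. measure P (F q)) summable_on Q"
    by (intro nonneg_bdd_above_summable_on bdd_aboveI[of _ "measure P (space P)"]) auto
  from summable_countable_real[OF this] have "countable {q \<in> Q. measure P (F q) \<noteq> 0}" .
  moreover have "{q \<in> Q. measure P (F q) \<noteq> 0} = Q" using pos by force
  ultimately show ?thesis by simp
qed

locale homogeneous =
  fixes \<nu> :: "'s measure" and d :: "'s \<Rightarrow> 's \<Rightarrow> real" and \<kappa> D :: real
  assumes homogeneous: "homogeneous_type \<nu> d \<kappa> D"
begin

abbreviation qb :: "'s \<times> real \<Rightarrow> 's set" where
  "qb p \<equiv> qball \<nu> d (fst p) (snd p)"

definition balls :: "('s \<times> real) set" where
  "balls = space \<nu> \<times> {0<..}"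

text \<open>\<open>\<kappa>\<close> and \<open>D\<close> are arbitrary reals in the definition of
  homogeneous type; enlarging them to at least 1 preserves the inequalities and makes powers of them
  monotone.\<close>

definition K :: real where "K = max \<kappa> 1"

definition D' :: real where "D' = max D 1"

lemma K_ge_1: "1 \<le> K" and D'_ge_1: "1 \<le> D'"
  unfolding K_def D'_def by simp_all

section \<open>Balls of the quasi-metric: doubling, engulfing, nets and a countable base\<close>

lemma d_nonneg: "x \<in> space \<nu> \<Longrightarrow> y \<in> space \<nu> \<Longrightarrow> 0 \<le> d x y"
  and d_refl: "x \<in> space \<nu> \<Longrightarrow> d x x = 0"
  and d_sym: "x \<in> space \<nu> \<Longrightarrow> y \<in> space \<nu> \<Longrightarrow> d x y = d y x"
  using homogeneous unfolding homogeneous_type_def by blast+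

lemma d_triangle:
  assumes "x \<in> space \<nu>" "y \<in> space \<nu>" "z \<in> space \<nu>"
  shows "d x z \<le> K * (d x y + d y z)"
proof -
  have "d x z \<le> \<kappa> * (d x y + d y z)"
    using homogeneous assms unfolding homogeneous_type_def by blast
  also have "\<dots> \<le> K * (d x y + d y z)"
    using assms by (intro mult_right_mono) (auto simp: K_def d_nonneg)
  finally show ?thesis .
qed

lemma mem_qball: "z \<in> qball \<nu> d y r \<longleftrightarrow> z \<in> space \<nu> \<and> d y z < r"
  unfolding qball_def by simp

lemma centre_in_qb: "p \<in> balls \<Longrightarrow> fst p \<in> qb p"
  unfolding balls_def by (auto simp: mem_qball d_refl)

lemma qb_sets [measurable]: "p \<in> balls \<Longrightarrow> qb p \<in> sets \<nu>"
  and qb_pos: "p \<in> balls \<Longrightarrow> 0 < emeasure \<nu> (qb p)"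
  and qb_fin: "p \<in> balls \<Longrightarrow> emeasure \<nu> (qb p) < \<infinity>"
  using homogeneous unfolding homogeneous_type_def balls_def by auto

lemma qball_mono: "r \<le> s \<Longrightarrow> qball \<nu> d y r \<subseteq> qball \<nu> d y s"
  by (auto simp: mem_qball)

lemma doubling:
  assumes "y \<in> space \<nu>" "0 < r"
  shows "emeasure \<nu> (qball \<nu> d y (2 ^ n * r)) \<le> ennreal (D' ^ n) * emeasure \<nu> (qball \<nu> d y r)"
proof (induction n)
  case (Suc n)
  have "emeasure \<nu> (qball \<nu> d y (2 * (2 ^ n * r))) \<le> ennreal D * emeasure \<nu> (qball \<nu> d y (2 ^ n * r))"
    using homogeneous assms unfolding homogeneous_type_def by simp
  also have "\<dots> \<le> ennreal D' * (ennreal (D' ^ n) * emeasure \<nu> (qball \<nu> d y r))"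
    by (intro mult_mono Suc.IH ennreal_leI) (auto simp: D'_def)
  finally show ?case using D'_ge_1 by (simp add: ennreal_mult mult.assoc)
qed simp

text \<open>Let \<open>r = snd p\<close>. A point of \<open>qb q\<close> is at distance at most
  \<open>2 K r\<close> from the common point, hence less than
  \<open>K (r + 2 K r) \<le> 3 K^2 r\<close> from the centre of \<open>qb p\<close>. This is the
  origin of the dilation factor used throughout.\<close>

lemma qball_engulf:
  assumes "p \<in> balls" "q \<in> balls" and int: "qb p \<inter> qb q \<noteq> {}" and le: "snd q \<le> snd p"
  shows "qb q \<subseteq> qball \<nu> d (fst p) (3 * K\<^sup>2 * snd p)"
proof
  fix z assume z: "z \<in> qb q"
  obtain u where u: "u \<in> qb p" "u \<in> qb q" using int by auto
  have s: "fst p \<in> space \<nu>" "fst q \<in> space \<nu>" "z \<in> space \<nu>" "u \<in> space \<nu>" "0 < snd p"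
    using assms u z unfolding balls_def by (auto simp: mem_qball)
  have "d u z \<le> K * (d u (fst q) + d (fst q) z)" by (rule d_triangle[OF s(4,2,3)])
  also have "\<dots> \<le> K * (2 * snd p)"
    using u z le K_ge_1 d_sym[OF s(4,2)] by (intro mult_left_mono) (auto simp: mem_qball)
  finally have 1: "d u z \<le> 2 * K * snd p" by simp
  have "d (fst p) z \<le> K * (d (fst p) u + d u z)" by (rule d_triangle[OF s(1,4,3)])
  also have "\<dots> < K * (snd p + 2 * K * snd p)"
    using u 1 K_ge_1 by (intro mult_strict_left_mono add_less_le_mono) (auto simp: mem_qball)
  also have "\<dots> \<le> K * (K * snd p + 2 * K * snd p)"
    using K_ge_1 s(5) by (intro mult_left_mono add_right_mono) auto
  also have "\<dots> = 3 * K\<^sup>2 * snd p" by (simp add: power2_eq_square algebra_simps)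
  finally show "z \<in> qball \<nu> d (fst p) (3 * K\<^sup>2 * snd p)" using s(3) by (simp add: mem_qball)
qed

lemma sigma_finite: "sigma_finite_measure \<nu>"
proof (cases "space \<nu> = {}")
  case True
  then show ?thesis by (intro sigma_finite_measure.intro exI[of _ "{}"]) auto
next
  case False
  then obtain y where y: "y \<in> space \<nu>" by auto
  define R where "R n = qball \<nu> d y (real (Suc n))" for n
  have R: "R n \<in> sets \<nu>" "emeasure \<nu> (R n) < \<infinity>" for n
    using qb_sets[of "(y, real (Suc n))"] qb_fin[of "(y, real (Suc n))"] y unfolding R_def balls_def by auto
  have "x \<in> (\<Union>n. R n)" if x: "x \<in> space \<nu>" for x
  proof -
    obtain n where "d y x \<le> real n" using real_arch_simple by blast
    then have "x \<in> R n" using x unfolding R_def by (simp add: mem_qball)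
    then show ?thesis by auto
  qed
  then have "\<Union>(range R) = space \<nu>" using R(1) sets.sets_into_space by blast
  then show ?thesis
    using R by (intro sigma_finite_measure.intro exI[of _ "range R"]) (auto simp: less_top)
qed

text \<open>A maximal \<open>e\<close>-separated set is a net. By the quasi-triangle inequality the
  balls of radius \<open>e / (2 * K)\<close> about its points are disjoint; they have positive
  measure, so sigma-finiteness makes the set countable.\<close>

lemma countable_net:
  assumes e: "0 < e"
  obtains Q where "countable Q" "Q \<subseteq> space \<nu>" "\<And>x. x \<in> space \<nu> \<Longrightarrow> \<exists>q\<in>Q. d q x < e"
proof -
  define \<S> where "\<S> = {Q. Q \<subseteq> space \<nu> \<and> (\<forall>x\<in>Q. \<forall>y\<in>Q. x \<noteq> y \<longrightarrow> e \<le> d x y)}"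
  have "\<exists>Q\<in>\<S>. \<forall>R\<in>\<S>. Q \<subseteq> R \<longrightarrow> R = Q"
  proof (rule subset_Zorn')
    fix \<C> assume "subset.chain \<S> \<C>"
    then have sub: "\<C> \<subseteq> \<S>" and lin: "\<And>G H. G \<in> \<C> \<Longrightarrow> H \<in> \<C> \<Longrightarrow> G \<subseteq> H \<or> H \<subseteq> G"
      unfolding subset.chain_def by auto
    have "e \<le> d x y" if xy: "x \<in> \<Union>\<C>" "y \<in> \<Union>\<C>" "x \<noteq> y" for x y
    proof -
      obtain G H where GH: "G \<in> \<C>" "H \<in> \<C>" "x \<in> G" "y \<in> H" using xy by auto
      obtain L where "L \<in> \<C>" "x \<in> L" "y \<in> L" using lin[OF GH(1,2)] GH by blast
      then show ?thesis using sub xy(3) unfolding \<S>_def by blast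
    qed
    moreover have "\<Union>\<C> \<subseteq> space \<nu>" using sub unfolding \<S>_def by blast
    ultimately show "\<Union>\<C> \<in> \<S>" unfolding \<S>_def by blast
  qed
  then obtain Q where Q: "Q \<in> \<S>" and max: "\<And>R. R \<in> \<S> \<Longrightarrow> Q \<subseteq> R \<Longrightarrow> R = Q" by blast
  have Q_sub: "Q \<subseteq> space \<nu>" and Q_sep: "\<And>x y. x \<in> Q \<Longrightarrow> y \<in> Q \<Longrightarrow> x \<noteq> y \<Longrightarrow> e \<le> d x y"
    using Q unfolding \<S>_def by auto
  have net: "\<exists>q\<in>Q. d q x < e" if x: "x \<in> space \<nu>" for x
  proof (rule ccontr)
    assume "\<not> ?thesis"
    then have far: "\<And>q. q \<in> Q \<Longrightarrow> e \<le> d q x" by (auto simp: not_less)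
    have "e \<le> d x q" if "q \<in> Q" for q using far[OF that] d_sym x Q_sub that by auto
    then have "insert x Q \<in> \<S>" using far Q_sub Q_sep x unfolding \<S>_def by auto
    then have "x \<in> Q" using max by blast
    then show False using far d_refl[OF x] e by fastforce
  qed
  have "countable Q"
  proof (rule sigma_finite_measure.countable_disjoint_positive[OF sigma_finite])
    define r where "r = e / (2 * K)"
    have r: "0 < r" unfolding r_def using e K_ge_1 by simp
    have b: "(q, r) \<in> balls" if "q \<in> Q" for q using that Q_sub r unfolding balls_def by auto
    show "qball \<nu> d q r \<in> sets \<nu>" "0 < emeasure \<nu> (qball \<nu> d q r)" if "q \<in> Q" for q
      using qb_sets[OF b[OF that]] qb_pos[OF b[OF that]] by auto
    have "z \<notin> qball \<nu> d q' r" if q: "q \<in> Q" "q' \<in> Q" "q \<noteq> q'" and z: "z \<in> qball \<nu> d q r" for q q' z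
    proof
      assume z': "z \<in> qball \<nu> d q' r"
      have s: "q \<in> space \<nu>" "q' \<in> space \<nu>" "z \<in> space \<nu>" using q Q_sub z by (auto simp: mem_qball)
      have "d q q' \<le> K * (d q z + d z q')" by (rule d_triangle[OF s(1,3,2)])
      also have "\<dots> < K * (r + r)"
        using z z' d_sym[OF s(3,2)] K_ge_1 by (intro mult_strict_left_mono add_strict_mono) (auto simp: mem_qball)
      also have "\<dots> = e" unfolding r_def using K_ge_1 by simp
      finally show False using Q_sep[OF q] by simp
    qed
    then show "disjoint_family_on (\<lambda>q. qball \<nu> d q r) Q"
      unfolding disjoint_family_on_def by blast
  qed
  with Q_sub net show thesis by (intro that) auto
qed

text \<open>Balls of radii \<open>1 / (n + 1)\<close> about the points of countable nets. The
  openness of balls, part of the definition of homogeneous type, leaves a radius \<open>e\<close> of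
  room around \<open>x\<close>, and small balls near \<open>x\<close> fit in once
  \<open>2 K / (n + 1) < e\<close>.\<close>

lemma countable_base:
  obtains \<U> :: "'s set set" where "countable \<U>" "\<U> \<subseteq> sets \<nu>"
    "\<And>p x. p \<in> balls \<Longrightarrow> x \<in> qb p \<Longrightarrow> \<exists>U\<in>\<U>. x \<in> U \<and> U \<subseteq> qb p"
proof -
  have "\<forall>n::nat. \<exists>Q. countable Q \<and> Q \<subseteq> space \<nu> \<and> (\<forall>x\<in>space \<nu>. \<exists>q\<in>Q. d q x < 1 / real (Suc n))"
    using countable_net by (metis divide_pos_pos of_nat_0_less_iff zero_less_Suc zero_less_one)
  then obtain Q where Q: "\<And>n. countable (Q n)" "\<And>n. Q n \<subseteq> space \<nu>"
    "\<And>n x. x \<in> space \<nu> \<Longrightarrow> \<exists>q\<in>Q n. d q x < 1 / real (Suc n)" by metis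
  define \<U> where "\<U> = (\<Union>n. (\<lambda>q. qball \<nu> d q (1 / real (Suc n))) ` Q n)"
  have "countable \<U>" unfolding \<U>_def using Q(1) by auto
  moreover have "\<U> \<subseteq> sets \<nu>"
  proof -
    have "(q, 1 / real (Suc n)) \<in> balls" if "q \<in> Q n" for q n using that Q(2) unfolding balls_def by auto
    from qb_sets[OF this] show ?thesis unfolding \<U>_def by auto
  qed
  moreover have "\<exists>U\<in>\<U>. x \<in> U \<and> U \<subseteq> qb p" if p: "p \<in> balls" and x: "x \<in> qb p" for p x
  proof -
    have xs: "x \<in> space \<nu>" using x by (simp add: mem_qball)
    have "fst p \<in> space \<nu>" "0 < snd p" using p unfolding balls_def by auto
    then have "\<exists>e>0. qball \<nu> d x e \<subseteq> qb p"
      using homogeneous x unfolding homogeneous_type_def by blast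
    then obtain e where e: "0 < e" "qball \<nu> d x e \<subseteq> qb p" by blast
    have "0 < e / (2 * K)" using e(1) K_ge_1 by simp
    from reals_Archimedean[OF this] obtain n where n: "inverse (real (Suc n)) < e / (2 * K)" by blast
    obtain q where q: "q \<in> Q n" "d q x < 1 / real (Suc n)" using Q(3)[OF xs] by blast
    have qs: "q \<in> space \<nu>" using q Q(2) by auto
    have "qball \<nu> d q (1 / real (Suc n)) \<subseteq> qball \<nu> d x e"
    proof
      fix z assume z: "z \<in> qball \<nu> d q (1 / real (Suc n))"
      then have zs: "z \<in> space \<nu>" by (simp add: mem_qball)
      have "d x z \<le> K * (d x q + d q z)" by (rule d_triangle[OF xs qs zs])
      also have "\<dots> \<le> K * (1 / real (Suc n) + 1 / real (Suc n))"
        using z q(2) d_sym[OF xs qs] K_ge_1 by (intro mult_left_mono add_mono) (auto simp: mem_qball)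
      also have "\<dots> = 2 * K * inverse (real (Suc n))" by (simp add: inverse_eq_divide)
      also have "\<dots> < 2 * K * (e / (2 * K))" using n K_ge_1 by (intro mult_strict_left_mono) auto
      also have "\<dots> = e" using K_ge_1 by simp
      finally show "z \<in> qball \<nu> d x e" using zs by (simp add: mem_qball)
    qed
    moreover have "x \<in> qball \<nu> d q (1 / real (Suc n))" using q(2) xs by (simp add: mem_qball)
    ultimately show ?thesis using e(2) q(1) unfolding \<U>_def by blast
  qed
  ultimately show thesis by (rule that)
qed

end

section \<open>Measurability of the maximal function\<close>

context homogeneous
begin

text \<open>Family and measure are parameters: finite families admit the covering argument and the
  selection of a ball at each point, countable ones give measurability and monotone limits, and
  Lerner's argument uses weighted measures besides \<open>\<nu>\<close>.\<close>

definition maxop :: "('s \<times> real) set \<Rightarrow> 's measure \<Rightarrow> ('s \<Rightarrow> ennreal) \<Rightarrow> 's \<Rightarrow> ennreal" where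
  "maxop C m h x = (SUP p\<in>C. average m (qb p) h * indicator (qb p) x)"

lemma average_times:
  assumes "0 < emeasure m B" "emeasure m B < \<infinity>"
  shows "average m B h * emeasure m B = (\<integral>\<^sup>+u\<in>B. h u \<partial>m)"
  unfolding average_def using assms by (simp add: ennreal_divide_times ennreal_divide_self)

lemma average_leI:
  assumes "0 < emeasure m B" "(\<integral>\<^sup>+u\<in>B. h u \<partial>m) \<le> a * emeasure m B"
  shows "average m B h \<le> a"
  unfolding average_def using assms by (intro divide_le_posI_ennreal) (auto simp: mult.commute)

lemma average_mono: "(\<And>u. h u \<le> k u) \<Longrightarrow> average m B h \<le> average m B k"
  unfolding average_def by (intro divide_right_mono_ennreal nn_integral_mono mult_right_mono) auto

text \<open>
  The family \<open>C\<close> is obtained by approximating, in measure and from above a prescribed set of the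
  countable base, every ball by a ball from a countable collection. This is what makes the
  maximal function jointly measurable.
\<close>

lemma countable_family:
  obtains C where "countable C" "C \<subseteq> balls"
    "\<And>h p x. h \<in> borel_measurable \<nu> \<Longrightarrow> p \<in> balls \<Longrightarrow> x \<in> qb p \<Longrightarrow> average \<nu> (qb p) h \<le> maxop C \<nu> h x"
proof -
  obtain \<U> where \<U>: "countable \<U>" "\<U> \<subseteq> sets \<nu>"
    "\<And>p x. p \<in> balls \<Longrightarrow> x \<in> qb p \<Longrightarrow> \<exists>U\<in>\<U>. x \<in> U \<and> U \<subseteq> qb p"
    by (rule countable_base) blast
  \<comment> \<open>A code \<open>(U, F, n)\<close> asks for a ball that contains \<open>U\<close>
    and differs from the finite union \<open>\<Union>F\<close> by at most \<open>1 / (n + 1)\<close>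
    on either side. There are countably many codes, and one ball is kept for each code that some
    ball satisfies.\<close>
  define P where "P = (\<lambda>(U, F, n :: nat) p. p \<in> balls \<and> U \<subseteq> qb p \<and>
    emeasure \<nu> (qb p - \<Union>F) \<le> ennreal (1 / real (Suc n)) \<and> emeasure \<nu> (\<Union>F - qb p) \<le> ennreal (1 / real (Suc n)))"
  define I where "I = {i \<in> \<U> \<times> {F. finite F \<and> F \<subseteq> \<U>} \<times> UNIV. \<exists>p. P i p}"
  define C where "C = (\<lambda>i. SOME p. P i p) ` I"
  have "countable I"
  proof (rule countable_subset)
    show "I \<subseteq> \<U> \<times> {F. finite F \<and> F \<subseteq> \<U>} \<times> UNIV" unfolding I_def by auto
    show "countable (\<U> \<times> {F. finite F \<and> F \<subseteq> \<U>} \<times> (UNIV :: nat set))"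
      using \<U>(1) by (intro countable_SIGMA countable_Collect_finite_subset) auto
  qed
  then have "countable C" unfolding C_def by simp
  have P_some: "P i (SOME p. P i p)" if "P i p" for i p by (rule someI[of "P i" p]) (rule that)
  have C_balls: "C \<subseteq> balls"
  proof
    fix p assume "p \<in> C"
    then obtain i q where "p = (SOME p. P i p)" "P i q" unfolding C_def I_def by auto
    then have "P i p" using P_some by simp
    then show "p \<in> balls" unfolding P_def by (auto split: prod.splits)
  qed
  have main: "average \<nu> (qb p) h \<le> maxop C \<nu> h x"
    if h [measurable]: "h \<in> borel_measurable \<nu>" and p: "p \<in> balls" and x: "x \<in> qb p" for h p x
  proof -
    define l where "l = maxop C \<nu> h x"
    define B where "B = qb p"
    have B [measurable]: "B \<in> sets \<nu>" and B_pos: "0 < emeasure \<nu> B" and B_fin: "emeasure \<nu> B < \<infinity>"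
      unfolding B_def using qb_sets[OF p] qb_pos[OF p] qb_fin[OF p] by auto
    have C_le: "(\<integral>\<^sup>+u\<in>qb q. h u \<partial>\<nu>) \<le> l * emeasure \<nu> (qb q)" if q: "q \<in> C" "x \<in> qb q" for q
    proof -
      have qb: "q \<in> balls" using q C_balls by auto
      have "average \<nu> (qb q) h * indicator (qb q) x \<le> l" unfolding l_def maxop_def using q(1) by (intro SUP_upper)
      then have "average \<nu> (qb q) h \<le> l" using q(2) by simp
      then have "average \<nu> (qb q) h * emeasure \<nu> (qb q) \<le> l * emeasure \<nu> (qb q)" by (rule mult_right_mono) simp
      then show ?thesis unfolding average_times[OF qb_pos[OF qb] qb_fin[OF qb]] .
    qed
    have "(\<integral>\<^sup>+u\<in>B. h u \<partial>\<nu>) \<le> l * emeasure \<nu> B"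
    proof (cases "l = \<infinity>")
      case True
      then show ?thesis using B_pos by (simp add: ennreal_top_mult)
    next
      case False
      obtain U where U: "U \<in> \<U>" "x \<in> U" "U \<subseteq> B" using \<U>(3)[OF p x] unfolding B_def by blast
      \<comment> \<open>Replacing \<open>B\<close> by a kept ball \<open>q\<close> loses the part of
        \<open>B\<close> outside \<open>q\<close>, of measure at most \<open>2 \<eta>\<close>;
        truncating \<open>h\<close> at \<open>k\<close> bounds the loss by
        \<open>2 k \<eta>\<close>. The set \<open>U\<close> in the code guarantees that
        \<open>x\<close> lies in \<open>q\<close>, so the average over \<open>q\<close> is at most
        \<open>l\<close>.\<close>
      have trunc: "(\<integral>\<^sup>+u\<in>B. min (h u) (ennreal (real k)) \<partial>\<nu>) \<le> l * emeasure \<nu> B" for k :: nat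
      proof (rule ennreal_le_by_eps_mult)
        show "l + 2 * ennreal (real k) < \<infinity>" using False by (simp add: less_top ennreal_mult_less_top)
        fix e :: real assume e: "0 < e"
        from reals_Archimedean[OF this] obtain n where n: "inverse (real (Suc n)) < e" by blast
        define \<eta> where "\<eta> = ennreal (1 / real (Suc n))"
        have \<eta>: "\<eta> \<le> ennreal e" unfolding \<eta>_def using n by (intro ennreal_leI) (simp add: inverse_eq_divide)
        define V where "V = {U \<in> \<U>. U \<subseteq> B}"
        have V: "countable V" "V \<noteq> {}" "V \<subseteq> \<U>" using \<U>(1) U unfolding V_def by (auto intro: countable_subset[of _ \<U>])
        have "\<Union>V = B" unfolding V_def using \<U>(3)[OF p] unfolding B_def by blast
        then have UN: "(\<Union>i. from_nat_into V i) = B"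
          using range_from_nat_into[OF V(2,1)] by simp
        define F where "F i = from_nat_into V ` {..<i}" for i :: nat
        have F_sub: "F i \<subseteq> V" for i unfolding F_def using from_nat_into[OF V(2)] by auto
        have F_meas: "\<Union>(F i) \<in> sets \<nu>" for i
          using F_sub[of i] V(3) \<U>(2) by (intro sets.finite_Union) (auto simp: F_def)
        have "(\<lambda>i. emeasure \<nu> (B - \<Union>(F i))) \<longlonglongrightarrow> emeasure \<nu> (\<Inter>i. B - \<Union>(F i))"
        proof (rule Lim_emeasure_decseq)
          show "range (\<lambda>i. B - \<Union>(F i)) \<subseteq> sets \<nu>" using F_meas B by auto
          show "decseq (\<lambda>i. B - \<Union>(F i))" unfolding F_def by (intro monotoneI) auto
          show "emeasure \<nu> (B - \<Union>(F i)) \<noteq> \<infinity>" for i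
            using emeasure_mono[of "B - \<Union>(F i)" B \<nu>] B_fin by (auto simp: top_unique)
        qed
        also have "(\<Inter>i. B - \<Union>(F i)) = {}"
        proof -
          have "\<exists>i. z \<in> \<Union>(F i)" if "z \<in> B" for z
          proof -
            from that UN obtain j where "z \<in> from_nat_into V j" by blast
            then have "z \<in> \<Union>(F (Suc j))" unfolding F_def by auto
            then show ?thesis by blast
          qed
          then show ?thesis by blast
        qed
        finally have "\<forall>\<^sub>F i in sequentially. emeasure \<nu> (B - \<Union>(F i)) < \<eta>"
          by (rule order_tendstoD) (simp add: \<eta>_def)
        then obtain i where i: "emeasure \<nu> (B - \<Union>(F i)) < \<eta>" unfolding eventually_sequentially by blast
        define G where "G = \<Union>(F i)"
        have G [measurable]: "G \<in> sets \<nu>" and G_sub: "G \<subseteq> B"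
          unfolding G_def using F_meas F_sub[of i] by (auto simp: V_def)
        have "P (U, F i, n) p"
          unfolding P_def using p U(3) i G_sub unfolding B_def G_def \<eta>_def
          by (auto simp: Diff_eq_empty_iff[THEN iffD2])
        then have wit: "P (U, F i, n) (SOME p. P (U, F i, n) p)" by (rule P_some)
        define q where "q = (SOME p. P (U, F i, n) p)"
        have "(U, F i, n) \<in> I"
          unfolding I_def mem_Collect_eq
        proof
          show "(U, F i, n) \<in> \<U> \<times> {F. finite F \<and> F \<subseteq> \<U>} \<times> UNIV"
            using U(1) F_sub[of i] V(3) by (auto simp: F_def)
          show "\<exists>p. P (U, F i, n) p" using \<open>P (U, F i, n) p\<close> by (rule exI)
        qed
        then have qC: "q \<in> C" unfolding C_def q_def by (rule imageI)
        have q: "q \<in> balls" "U \<subseteq> qb q" "emeasure \<nu> (qb q - G) \<le> \<eta>" "emeasure \<nu> (G - qb q) \<le> \<eta>"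
          using wit[folded q_def] unfolding P_def G_def \<eta>_def by auto
        have qm [measurable]: "qb q \<in> sets \<nu>" using q(1) by (rule qb_sets)
        have "emeasure \<nu> (qb q) \<le> emeasure \<nu> (B \<union> (qb q - G))" using G_sub by (intro emeasure_mono) auto
        also have "\<dots> \<le> emeasure \<nu> B + emeasure \<nu> (qb q - G)" by (rule emeasure_subadditive) auto
        finally have m1: "emeasure \<nu> (qb q) \<le> emeasure \<nu> B + \<eta>" using q(3) by (meson add_left_mono order_trans)
        have "emeasure \<nu> (B - qb q) \<le> emeasure \<nu> ((B - G) \<union> (G - qb q))" by (intro emeasure_mono) auto
        also have "\<dots> \<le> emeasure \<nu> (B - G) + emeasure \<nu> (G - qb q)" by (rule emeasure_subadditive) auto
        finally have m2: "emeasure \<nu> (B - qb q) \<le> \<eta> + \<eta>"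
          using i q(4) unfolding G_def[symmetric] by (meson add_mono less_imp_le order_trans)
        have "(\<integral>\<^sup>+u\<in>B. min (h u) (ennreal (real k)) \<partial>\<nu>) \<le>
            (\<integral>\<^sup>+u. h u * indicator (qb q) u + ennreal (real k) * indicator (B - qb q) u \<partial>\<nu>)"
          by (intro nn_integral_mono) (auto simp: indicator_def)
        also have "\<dots> = (\<integral>\<^sup>+u\<in>qb q. h u \<partial>\<nu>) + ennreal (real k) * emeasure \<nu> (B - qb q)"
          by (subst nn_integral_add) (auto simp: nn_integral_cmult_indicator)
        also have "\<dots> \<le> l * (emeasure \<nu> B + \<eta>) + ennreal (real k) * (\<eta> + \<eta>)"
        proof (intro add_mono)
          have "(\<integral>\<^sup>+u\<in>qb q. h u \<partial>\<nu>) \<le> l * emeasure \<nu> (qb q)"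
            using C_le[OF qC] q(2) U(2) by auto
          also have "\<dots> \<le> l * (emeasure \<nu> B + \<eta>)" by (rule mult_left_mono[OF m1]) simp
          finally show "(\<integral>\<^sup>+u\<in>qb q. h u \<partial>\<nu>) \<le> l * (emeasure \<nu> B + \<eta>)" .
          show "ennreal (real k) * emeasure \<nu> (B - qb q) \<le> ennreal (real k) * (\<eta> + \<eta>)"
            by (rule mult_left_mono[OF m2]) simp
        qed
        also have "\<dots> = l * emeasure \<nu> B + \<eta> * (l + 2 * ennreal (real k))"
          unfolding mult_2 distrib_left by (simp add: mult.commute[of _ \<eta>] add.assoc)
        also have "\<dots> \<le> l * emeasure \<nu> B + ennreal e * (l + 2 * ennreal (real k))"
          by (intro add_left_mono mult_right_mono \<eta>) auto
        finally show "(\<integral>\<^sup>+u\<in>B. min (h u) (ennreal (real k)) \<partial>\<nu>) \<le>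
          l * emeasure \<nu> B + ennreal e * (l + 2 * ennreal (real k))" .
      qed
      have "(\<integral>\<^sup>+u\<in>B. h u \<partial>\<nu>) = (\<integral>\<^sup>+u. (SUP k::nat. min (h u) (ennreal (real (Suc k))) * indicator B u) \<partial>\<nu>)"
        unfolding SUP_mult_right_ennreal[symmetric] ennreal_SUP_min_nat ..
      also have "\<dots> = (SUP k::nat. \<integral>\<^sup>+u\<in>B. min (h u) (ennreal (real (Suc k))) \<partial>\<nu>)"
        by (intro nn_integral_monotone_convergence_SUP)
          (auto simp: incseq_def le_fun_def intro!: mult_right_mono min.mono ennreal_leI)
      also have "\<dots> \<le> l * emeasure \<nu> B" by (intro SUP_least trunc)
      finally show ?thesis .
    qed
    then show ?thesis using B_pos unfolding l_def[symmetric] B_def by (intro average_leI)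
  qed
  show thesis by (rule that[OF \<open>countable C\<close> C_balls main])
qed

definition ball_family :: "('s \<times> real) set" where
  "ball_family = (SOME C. countable C \<and> C \<subseteq> balls \<and> (\<forall>h p x. h \<in> borel_measurable \<nu> \<longrightarrow> p \<in> balls \<longrightarrow> x \<in> qb p \<longrightarrow>
    average \<nu> (qb p) h \<le> maxop C \<nu> h x))"

lemma ball_family: "countable ball_family" "ball_family \<subseteq> balls"
  and average_le_maxop: "h \<in> borel_measurable \<nu> \<Longrightarrow> p \<in> balls \<Longrightarrow> x \<in> qb p \<Longrightarrow> average \<nu> (qb p) h \<le> maxop ball_family \<nu> h x"
proof -
  have "\<exists>C. countable C \<and> C \<subseteq> balls \<and> (\<forall>h p x. h \<in> borel_measurable \<nu> \<longrightarrow> p \<in> balls \<longrightarrow> x \<in> qb p \<longrightarrow>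
    average \<nu> (qb p) h \<le> maxop C \<nu> h x)"
    by (rule countable_family) blast
  from someI_ex[OF this] show "countable ball_family" "ball_family \<subseteq> balls"
    "h \<in> borel_measurable \<nu> \<Longrightarrow> p \<in> balls \<Longrightarrow> x \<in> qb p \<Longrightarrow> average \<nu> (qb p) h \<le> maxop ball_family \<nu> h x"
    unfolding ball_family_def by blast+
qed

lemma maximal_eq_maxop:
  fixes f :: "'s \<times> 'w \<Rightarrow> 'k::real_normed_vector"
  assumes "(\<lambda>u. ennreal (norm (f (u, \<omega>)))) \<in> borel_measurable \<nu>" "x \<in> space \<nu>"
  shows "maximal \<nu> d f (x, \<omega>) = maxop ball_family \<nu> (\<lambda>u. ennreal (norm (f (u, \<omega>)))) x"
proof (rule antisym)
  show "maximal \<nu> d f (x, \<omega>) \<le> maxop ball_family \<nu> (\<lambda>u. ennreal (norm (f (u, \<omega>)))) x"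
    unfolding maximal_def prod.case
  proof (intro SUP_least, clarsimp)
    fix y r assume "y \<in> space \<nu>" "0 < (r::real)" "x \<in> qball \<nu> d y r"
    then show "average \<nu> (qball \<nu> d y r) (\<lambda>u. ennreal (norm (f (u, \<omega>)))) \<le> maxop ball_family \<nu> (\<lambda>u. ennreal (norm (f (u, \<omega>)))) x"
      using average_le_maxop[OF assms(1), of "(y, r)" x] by (simp add: balls_def)
  qed
  show "maxop ball_family \<nu> (\<lambda>u. ennreal (norm (f (u, \<omega>)))) x \<le> maximal \<nu> d f (x, \<omega>)"
    unfolding maxop_def
  proof (intro SUP_least)
    fix p assume p: "p \<in> ball_family"
    show "average \<nu> (qb p) (\<lambda>u. ennreal (norm (f (u, \<omega>)))) * indicator (qb p) x \<le> maximal \<nu> d f (x, \<omega>)"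
    proof (cases "x \<in> qb p")
      case True
      have "p \<in> balls" using p ball_family(2) by auto
      then have "p \<in> {(y, r). y \<in> space \<nu> \<and> 0 < r \<and> x \<in> qball \<nu> d y r}"
        using True unfolding balls_def by auto
      then have "(case p of (y, r) \<Rightarrow> average \<nu> (qball \<nu> d y r) (\<lambda>u. ennreal (norm (f (u, \<omega>))))) \<le> maximal \<nu> d f (x, \<omega>)"
        unfolding maximal_def prod.case by (rule SUP_upper)
      then show ?thesis using True by (simp add: case_prod_beta)
    qed simp
  qed
qed

lemma maxop_measurable:
  fixes h :: "'s \<times> 'w \<Rightarrow> ennreal"
  assumes I: "countable I" "I \<subseteq> balls" and h [measurable]: "h \<in> borel_measurable (\<nu> \<Otimes>\<^sub>M \<mu>)"
  shows "(\<lambda>(x, \<omega>). maxop I \<nu> (\<lambda>u. h (u, \<omega>)) x) \<in> borel_measurable (\<nu> \<Otimes>\<^sub>M \<mu>)"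
proof -
  interpret sigma_finite_measure \<nu> by (rule sigma_finite)
  have "(\<lambda>z. average \<nu> (qb p) (\<lambda>u. h (u, snd z)) * indicator (qb p) (fst z)) \<in> borel_measurable (\<nu> \<Otimes>\<^sub>M \<mu>)"
    if "p \<in> I" for p
  proof -
    have [measurable]: "qb p \<in> sets \<nu>" using that I(2) by (auto intro: qb_sets)
    show ?thesis unfolding average_def by measurable
  qed
  then have "(\<lambda>z. SUP p\<in>I. average \<nu> (qb p) (\<lambda>u. h (u, snd z)) * indicator (qb p) (fst z)) \<in> borel_measurable (\<nu> \<Otimes>\<^sub>M \<mu>)"
    using I(1) by (intro borel_measurable_SUP) auto
  then show ?thesis unfolding maxop_def by (simp add: case_prod_beta)
qed

lemma maximal_measurable:
  fixes f :: "'s \<times> 'w \<Rightarrow> 'k::{real_normed_vector,second_countable_topology}"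
  assumes f [measurable]: "f \<in> borel_measurable (\<nu> \<Otimes>\<^sub>M \<mu>)"
  shows "maximal \<nu> d f \<in> borel_measurable (\<nu> \<Otimes>\<^sub>M \<mu>)"
proof -
  have eq: "maximal \<nu> d f z = (case z of (x, \<omega>) \<Rightarrow> maxop ball_family \<nu> (\<lambda>u. ennreal (norm (f (u, \<omega>)))) x)"
    if z: "z \<in> space (\<nu> \<Otimes>\<^sub>M \<mu>)" for z
  proof -
    obtain x \<omega> where x: "z = (x, \<omega>)" "x \<in> space \<nu>" "\<omega> \<in> space \<mu>" using z by (auto simp: space_pair_measure)
    have "(\<lambda>u. ennreal (norm (f (u, \<omega>)))) \<in> borel_measurable \<nu>" using x(3) by measurable
    from maximal_eq_maxop[OF this x(2)] show ?thesis unfolding x(1) by simp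
  qed
  have "(\<lambda>(x, \<omega>). maxop ball_family \<nu> (\<lambda>u. ennreal (norm (f (u, \<omega>)))) x) \<in> borel_measurable (\<nu> \<Otimes>\<^sub>M \<mu>)"
    by (rule maxop_measurable[OF ball_family]) measurable
  then show ?thesis by (subst measurable_cong[OF eq]) auto
qed

end

section \<open>The maximal theorem for doubling measures\<close>

text \<open>The layer-cake formula for the square, as an inequality. The infinite value is reached
  from the finite ones by monotonicity.\<close>

lemma square_le_nn_integral:
  fixes y :: ennreal
  shows "y\<^sup>2 \<le> (\<integral>\<^sup>+t. ennreal (2 * t) * indicator {t. 0 < t \<and> ennreal t < y} t \<partial>lborel)"
proof -
  define J where "J y = (\<integral>\<^sup>+t. ennreal (2 * t) * indicator {t. 0 < t \<and> ennreal t < y} t \<partial>lborel)" for y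
  have real_case: "ennreal (r\<^sup>2) = J (ennreal r)" if r: "0 \<le> r" for r
  proof -
    have "(\<integral>\<^sup>+t. ennreal (2 * t) * indicator {0..r} t \<partial>lborel) = ennreal (r\<^sup>2 - 0\<^sup>2)"
      using r by (intro nn_integral_FTC_Icc[where F = "\<lambda>t. t\<^sup>2"])
        (auto intro!: derivative_eq_intros)
    moreover have "(\<integral>\<^sup>+t. ennreal (2 * t) * indicator {0..r} t \<partial>lborel) = J (ennreal r)"
      unfolding J_def
    proof (rule nn_integral_cong_AE)
      have "AE t in lborel. t \<noteq> 0" "AE t in lborel. t \<noteq> r" by (rule AE_lborel_singleton)+
      then show "AE t in lborel. ennreal (2 * t) * indicator {0..r} t =
          ennreal (2 * t) * indicator {t. 0 < t \<and> ennreal t < ennreal r} t"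
        by eventually_elim (auto simp: indicator_def ennreal_less_iff)
    qed
    ultimately show ?thesis by simp
  qed
  show ?thesis
    unfolding J_def[symmetric]
  proof (cases y)
    case (real r)
    then show "y\<^sup>2 \<le> J y" using real_case[of r] by (simp add: ennreal_power)
  next
    case top
    have "J \<infinity> = \<infinity>"
    proof (rule ccontr)
      assume "J \<infinity> \<noteq> \<infinity>"
      then obtain x where x: "J \<infinity> = ennreal x" "0 \<le> x" by (cases "J \<infinity>") auto
      obtain n :: nat where n: "x < real n" using reals_Archimedean2 by blast
      have "ennreal ((real n)\<^sup>2) = J (ennreal (real n))" by (rule real_case) simp
      also have "\<dots> \<le> J \<infinity>"
        unfolding J_def by (intro nn_integral_mono) (auto simp: indicator_def)
      finally have "(real n)\<^sup>2 \<le> x" using x by simp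
      moreover have "1 \<le> n" using n x(2) by (cases n) auto
      then have "real n \<le> (real n)\<^sup>2" by (simp add: power2_eq_square)
      ultimately show False using n by simp
    qed
    then show "y\<^sup>2 \<le> J y" using top by simp
  qed
qed

lemma (in sigma_finite_measure) nn_integral_square_le_layers:
  fixes g :: "'a \<Rightarrow> ennreal"
  assumes g [measurable]: "g \<in> borel_measurable M"
  shows "(\<integral>\<^sup>+x. (g x)\<^sup>2 \<partial>M) \<le>
    (\<integral>\<^sup>+t. ennreal (2 * t) * indicator {0<..} t * emeasure M {x \<in> space M. ennreal t < g x} \<partial>lborel)"
proof -
  interpret P: pair_sigma_finite M "lborel :: real measure"
    by (intro pair_sigma_finite.intro sigma_finite_measure_axioms sigma_finite_lborel)
  have "(\<integral>\<^sup>+x. (g x)\<^sup>2 \<partial>M) \<le>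
    (\<integral>\<^sup>+x. (\<integral>\<^sup>+t. ennreal (2 * t) * indicator {t. 0 < t \<and> ennreal t < g x} t \<partial>lborel) \<partial>M)"
    by (intro nn_integral_mono square_le_nn_integral)
  also have "\<dots> = (\<integral>\<^sup>+x. (\<integral>\<^sup>+t. ennreal (2 * t) * indicator {0<..} t * indicator {x \<in> space M. ennreal t < g x} x \<partial>lborel) \<partial>M)"
    by (intro nn_integral_cong) (auto simp: indicator_def)
  also have "\<dots> = (\<integral>\<^sup>+t. (\<integral>\<^sup>+x. ennreal (2 * t) * indicator {0<..} t * indicator {x \<in> space M. ennreal t < g x} x \<partial>M) \<partial>lborel)"
    by (intro P.Fubini'[symmetric]) measurable
  also have "\<dots> = (\<integral>\<^sup>+t. ennreal (2 * t) * indicator {0<..} t * emeasure M {x \<in> space M. ennreal t < g x} \<partial>lborel)"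
    by (intro nn_integral_cong nn_integral_cmult_indicator) measurable
  finally show ?thesis .
qed

lemma ennreal_SUP_times:
  fixes a b :: "nat \<Rightarrow> ennreal"
  assumes "incseq a" "incseq b"
  shows "(SUP n. a n) * (SUP n. b n) = (SUP n. a n * b n)"
proof (rule antisym)
  have "(SUP n. a n) * (SUP n. b n) = (SUP n. SUP m. a m * b n)"
    unfolding SUP_mult_left_ennreal SUP_mult_right_ennreal ..
  also have "\<dots> \<le> (SUP n. a n * b n)"
  proof (intro SUP_least)
    fix n m
    have "a m * b n \<le> a (max m n) * b (max m n)"
      using assms by (intro mult_mono) (auto simp: incseq_def)
    then show "a m * b n \<le> (SUP n. a n * b n)"
      by (intro SUP_upper2[of "max m n"]) auto
  qed
  finally show "(SUP n. a n) * (SUP n. b n) \<le> (SUP n. a n * b n)" .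
  show "(SUP n. a n * b n) \<le> (SUP n. a n) * (SUP n. b n)"
    by (intro SUP_least mult_mono SUP_upper) auto
qed

lemma ennreal_SUP_square:
  fixes a :: "nat \<Rightarrow> ennreal"
  assumes "incseq a"
  shows "(SUP n. a n)\<^sup>2 = (SUP n. (a n)\<^sup>2)"
  unfolding power2_eq_square by (rule ennreal_SUP_times[OF assms assms])

context homogeneous
begin

section \<open>Covering lemma and maximal inequalities for doubling measures\<close>

abbreviation big :: "'s \<times> real \<Rightarrow> 's \<times> real" where
  "big p \<equiv> (fst p, 3 * K\<^sup>2 * snd p)"

lemma big_balls: "p \<in> balls \<Longrightarrow> big p \<in> balls"
  using K_ge_1 unfolding balls_def by auto

lemma qb_sub_big: "qb p \<subseteq> qb (big p)" if "p \<in> balls"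
proof -
  have "1 * 1 \<le> K\<^sup>2" unfolding power2_eq_square using K_ge_1 by (intro mult_mono) auto
  then have "1 * snd p \<le> 3 * K\<^sup>2 * snd p" using that unfolding balls_def by (intro mult_right_mono) auto
  then show ?thesis by (auto simp: mem_qball)
qed

text \<open>Greedy selection: a ball of largest radius is kept, every ball that meets it lies in its
  dilation by \<open>qball_engulf\<close>, and the induction continues with the balls disjoint from
  it.\<close>

lemma Vitali:
  assumes "finite I" "I \<subseteq> balls"
  shows "\<exists>J\<subseteq>I. disjoint_family_on qb J \<and> (\<Union>p\<in>I. qb p) \<subseteq> (\<Union>p\<in>J. qb (big p))"
  using assms
proof (induction I rule: finite_psubset_induct)
  case (psubset I)
  show ?case
  proof (cases "I = {}")
    case False
    have "Max (snd ` I) \<in> snd ` I" using psubset(1) False by (intro Max_in) auto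
    then obtain p where "p \<in> I" "snd p = Max (snd ` I)" by (metis imageE)
    then have p: "p \<in> I" "\<And>q. q \<in> I \<Longrightarrow> snd q \<le> snd p" using psubset(1) by auto
    have pb: "p \<in> balls" using p psubset.prems by auto
    define I' where "I' = {q \<in> I. qb q \<inter> qb p = {}}"
    have "p \<notin> I'" using centre_in_qb[OF pb] unfolding I'_def by auto
    then have "I' \<subset> I" using p unfolding I'_def by auto
    then obtain J where J: "J \<subseteq> I'" "disjoint_family_on qb J" "(\<Union>p\<in>I'. qb p) \<subseteq> (\<Union>p\<in>J. qb (big p))"
      using psubset.IH[of I'] psubset.prems by auto
    have "disjoint_family_on qb (insert p J)"
      using J(1,2) unfolding disjoint_family_on_def I'_def by blast
    moreover have "(\<Union>p\<in>I. qb p) \<subseteq> (\<Union>p\<in>insert p J. qb (big p))"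
    proof
      fix z assume "z \<in> (\<Union>p\<in>I. qb p)"
      then obtain q where q: "q \<in> I" "z \<in> qb q" by auto
      show "z \<in> (\<Union>p\<in>insert p J. qb (big p))"
      proof (cases "q \<in> I'")
        case True
        then show ?thesis using J(3) q by blast
      next
        case F: False
        then have "qb p \<inter> qb q \<noteq> {}" using q unfolding I'_def by auto
        then have "qb q \<subseteq> qb (big p)" using qball_engulf[OF pb _ _ p(2)[OF q(1)]] q psubset.prems by auto
        then show ?thesis using q by auto
      qed
    qed
    ultimately show ?thesis using J(1) p \<open>I' \<subset> I\<close> by (intro exI[of _ "insert p J"]) auto
  qed (auto simp: disjoint_family_on_def)
qed

text \<open>Doubling is imposed for the dilation \<open>big\<close> itself, the form in which the
  covering lemma consumes it, so that \<open>\<Delta>\<close> is at once the constant of the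
  weak-type inequality.\<close>

definition doubling_measure :: "'s measure \<Rightarrow> real \<Rightarrow> bool" where
  "doubling_measure m \<Delta> \<longleftrightarrow> sets m = sets \<nu> \<and> sigma_finite_measure m \<and> 0 \<le> \<Delta> \<and>
    (\<forall>p\<in>balls. 0 < emeasure m (qb p) \<and> emeasure m (qb p) < \<infinity> \<and>
      emeasure m (qb (big p)) \<le> ennreal \<Delta> * emeasure m (qb p))"

context
  fixes m :: "'s measure" and \<Delta> :: real
  assumes m: "doubling_measure m \<Delta>"
begin

lemma m_sets [measurable_cong]: "sets m = sets \<nu>" and m_space: "space m = space \<nu>"
  and m_sigma_finite: "sigma_finite_measure m" and \<Delta>_nonneg: "0 \<le> \<Delta>"
  and m_pos: "p \<in> balls \<Longrightarrow> 0 < emeasure m (qb p)" and m_fin: "p \<in> balls \<Longrightarrow> emeasure m (qb p) < \<infinity>"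
  and m_big: "p \<in> balls \<Longrightarrow> emeasure m (qb (big p)) \<le> ennreal \<Delta> * emeasure m (qb p)"
  using m sets_eq_imp_space_eq[of m \<nu>] unfolding doubling_measure_def by auto

lemma qb_sets_m: "p \<in> balls \<Longrightarrow> qb p \<in> sets m"
  unfolding m_sets by (rule qb_sets)

lemma maxop_measurable_m:
  assumes "countable I" "I \<subseteq> balls"
  shows "maxop I m h \<in> borel_measurable m"
proof -
  have "(\<lambda>x. average m (qb p) h * indicator (qb p) x) \<in> borel_measurable m" if "p \<in> I" for p
  proof -
    have "qb p \<in> sets m" using that assms(2) by (intro qb_sets_m) auto
    then show ?thesis
      by (intro borel_measurable_times_ennreal borel_measurable_const borel_measurable_indicator)
  qed
  then show ?thesis unfolding maxop_def by (intro borel_measurable_SUP assms(1)) auto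
qed

text \<open>The level set is covered by the balls with average above \<open>t\<close>. The disjoint
  balls selected by \<open>Vitali\<close> use up disjoint parts of the integral of \<open>h\<close>,
  each at least \<open>t\<close> times the measure of the ball, and doubling pays for the
  dilations.\<close>

lemma maximal_weak_type:
  assumes I: "finite I" "I \<subseteq> balls" and h: "h \<in> borel_measurable m"
  shows "t * emeasure m {x \<in> space m. t < maxop I m h x} \<le> ennreal \<Delta> * (\<integral>\<^sup>+x. h x \<partial>m)"
proof -
  note [measurable] = h
  define I' where "I' = {p \<in> I. t < average m (qb p) h}"
  have I': "finite I'" "I' \<subseteq> balls" using I unfolding I'_def by auto
  obtain J where J: "J \<subseteq> I'" "disjoint_family_on qb J" "(\<Union>p\<in>I'. qb p) \<subseteq> (\<Union>p\<in>J. qb (big p))"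
    using Vitali[OF I'] by blast
  have J': "finite J" "\<And>p. p \<in> J \<Longrightarrow> p \<in> balls" using J(1) I' finite_subset by auto
  have "{x \<in> space m. t < maxop I m h x} \<subseteq> (\<Union>p\<in>I'. qb p)"
  proof
    fix x assume "x \<in> {x \<in> space m. t < maxop I m h x}"
    then obtain p where "p \<in> I" "t < average m (qb p) h * indicator (qb p) x"
      unfolding maxop_def less_SUP_iff by blast
    moreover from this have "x \<in> qb p" by (cases "x \<in> qb p") auto
    ultimately have "p \<in> I'" "x \<in> qb p" unfolding I'_def by auto
    then show "x \<in> (\<Union>p\<in>I'. qb p)" by auto
  qed
  moreover have UN_sets: "(\<Union>p\<in>J. qb (big p)) \<in> sets m"
    by (intro sets.finite_UN J'(1) qb_sets_m big_balls J'(2))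
  ultimately have "emeasure m {x \<in> space m. t < maxop I m h x} \<le> emeasure m (\<Union>p\<in>J. qb (big p))"
    using J(3) by (intro emeasure_mono) (rule order_trans, assumption)
  also have "\<dots> \<le> (\<Sum>p\<in>J. emeasure m (qb (big p)))"
    by (intro emeasure_subadditive_finite J'(1) image_subsetI qb_sets_m big_balls J'(2))
  also have "\<dots> \<le> (\<Sum>p\<in>J. ennreal \<Delta> * emeasure m (qb p))"
    by (intro sum_mono m_big J')
  finally have "t * emeasure m {x \<in> space m. t < maxop I m h x} \<le> t * (\<Sum>p\<in>J. ennreal \<Delta> * emeasure m (qb p))"
    by (rule mult_left_mono) simp
  also have "\<dots> = ennreal \<Delta> * (\<Sum>p\<in>J. t * emeasure m (qb p))"
    by (simp add: sum_distrib_left ac_simps)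
  also have "\<dots> \<le> ennreal \<Delta> * (\<Sum>p\<in>J. \<integral>\<^sup>+x. h x * indicator (qb p) x \<partial>m)"
  proof (intro mult_left_mono sum_mono)
    fix p assume p: "p \<in> J"
    then have "t \<le> average m (qb p) h" using J(1) unfolding I'_def by auto
    then have "t * emeasure m (qb p) \<le> average m (qb p) h * emeasure m (qb p)" by (rule mult_right_mono) simp
    then show "t * emeasure m (qb p) \<le> (\<integral>\<^sup>+x. h x * indicator (qb p) x \<partial>m)"
      unfolding average_times[OF m_pos[OF J'(2)[OF p]] m_fin[OF J'(2)[OF p]]] .
  qed simp
  also have "(\<Sum>p\<in>J. \<integral>\<^sup>+x. h x * indicator (qb p) x \<partial>m) = (\<integral>\<^sup>+x. (\<Sum>p\<in>J. h x * indicator (qb p) x) \<partial>m)"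
    using qb_sets_m J' by (intro nn_integral_sum[symmetric]) auto
  also have "\<dots> \<le> (\<integral>\<^sup>+x. h x \<partial>m)"
  proof (rule nn_integral_mono)
    fix x
    have "(\<Sum>p\<in>J. h x * indicator (qb p) x) = h x * indicator (\<Union>p\<in>J. qb p) x"
      unfolding indicator_UN_disjoint[OF J'(1) J(2)] sum_distrib_left ..
    also have "\<dots> \<le> h x" by (auto simp: indicator_def)
    finally show "(\<Sum>p\<in>J. h x * indicator (qb p) x) \<le> h x" .
  qed
  finally show ?thesis by (simp add: mult_left_mono)
qed

text \<open>Marcinkiewicz interpolation with the trivial bound in \<open>L_\<infinity>\<close>: the
  values of \<open>h\<close> up to \<open>t / 2\<close> raise averages by at most
  \<open>t / 2\<close>, so the level set at \<open>t\<close> lies in that of the upper part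
  \<open>h'\<close> at \<open>t / 2\<close>. The constant is \<open>4 * \<Delta>\<close>, from
  \<open>2 * t = 4 * (t / 2)\<close>, times the factor 2 from the length \<open>2 * h x\<close> of
  the interval of those \<open>t > 0\<close> with \<open>t / 2 < h x\<close>.\<close>

lemma maximal_strong_type_finite:
  assumes I: "finite I" "I \<subseteq> balls" and h: "h \<in> borel_measurable m"
  shows "(\<integral>\<^sup>+x. (maxop I m h x)\<^sup>2 \<partial>m) \<le> ennreal (8 * \<Delta>) * (\<integral>\<^sup>+x. (h x)\<^sup>2 \<partial>m)"
proof -
  note [measurable] = h
  interpret m: sigma_finite_measure m by (rule m_sigma_finite)
  interpret P: pair_sigma_finite m "lborel :: real measure"
    by (intro pair_sigma_finite.intro m_sigma_finite sigma_finite_lborel)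
  have level: "ennreal (2 * t) * emeasure m {x \<in> space m. ennreal t < maxop I m h x} \<le>
      ennreal (4 * \<Delta>) * (\<integral>\<^sup>+x. h x * indicator {x \<in> space m. ennreal (t / 2) < h x} x \<partial>m)" if t: "0 < t" for t
  proof -
    define h' where "h' x = h x * indicator {x \<in> space m. ennreal (t / 2) < h x} x" for x
    have h'_meas: "h' \<in> borel_measurable m" unfolding h'_def by measurable
    have le: "maxop I m h x \<le> maxop I m h' x + ennreal (t / 2)" if x: "x \<in> space m" for x
      unfolding maxop_def[of I m h]
    proof (rule SUP_least)
      fix p assume p: "p \<in> I"
      then have pb: "p \<in> balls" using I by auto
      show "average m (qb p) h * indicator (qb p) x \<le> maxop I m h' x + ennreal (t / 2)"
      proof (cases "x \<in> qb p")
        case True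
        have "(\<integral>\<^sup>+u\<in>qb p. h u \<partial>m) \<le> (\<integral>\<^sup>+u. h' u * indicator (qb p) u + ennreal (t / 2) * indicator (qb p) u \<partial>m)"
          by (intro nn_integral_mono) (auto simp: h'_def indicator_def not_less)
        also have "\<dots> = average m (qb p) h' * emeasure m (qb p) + ennreal (t / 2) * emeasure m (qb p)"
          unfolding average_times[OF m_pos[OF pb] m_fin[OF pb]]
          using h'_meas qb_sets_m[OF pb] by (subst nn_integral_add) (auto simp: nn_integral_cmult_indicator)
        finally have "average m (qb p) h \<le> average m (qb p) h' + ennreal (t / 2)"
          by (intro average_leI m_pos pb) (simp add: distrib_right)
        also have "average m (qb p) h' \<le> maxop I m h' x"
          unfolding maxop_def by (rule SUP_upper2[OF p]) (use True in simp)
        finally show ?thesis using True by (simp add: add_right_mono)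
      qed simp
    qed
    have sub: "{x \<in> space m. ennreal t < maxop I m h x} \<subseteq> {x \<in> space m. ennreal (t / 2) < maxop I m h' x}"
    proof safe
      fix x assume x: "x \<in> space m" "ennreal t < maxop I m h x"
      show "ennreal (t / 2) < maxop I m h' x"
      proof (rule ccontr)
        assume "\<not> ennreal (t / 2) < maxop I m h' x"
        then have "maxop I m h' x + ennreal (t / 2) \<le> ennreal (t / 2) + ennreal (t / 2)"
          by (intro add_right_mono) simp
        also have "\<dots> = ennreal t" using t by (subst ennreal_plus[symmetric]) auto
        finally show False using le[OF x(1)] x(2) by simp
      qed
    qed
    have [measurable]: "maxop I m h' \<in> borel_measurable m"
      using I by (intro maxop_measurable_m countable_finite)
    have "ennreal (2 * t) * emeasure m {x \<in> space m. ennreal t < maxop I m h x} \<le>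
        ennreal 4 * ennreal (t / 2) * emeasure m {x \<in> space m. ennreal (t / 2) < maxop I m h' x}"
    proof (rule mult_mono)
      show "ennreal (2 * t) \<le> ennreal 4 * ennreal (t / 2)" using t by (subst ennreal_mult[symmetric]) auto
      show "emeasure m {x \<in> space m. ennreal t < maxop I m h x} \<le> emeasure m {x \<in> space m. ennreal (t / 2) < maxop I m h' x}"
        by (rule emeasure_mono[OF sub]) measurable
    qed auto
    also have "\<dots> \<le> ennreal 4 * (ennreal \<Delta> * (\<integral>\<^sup>+x. h' x \<partial>m))"
      unfolding mult.assoc by (intro mult_left_mono maximal_weak_type I h'_meas) auto
    also have "\<dots> = ennreal (4 * \<Delta>) * (\<integral>\<^sup>+x. h' x \<partial>m)"
      using \<Delta>_nonneg by (simp add: ennreal_mult mult.assoc)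
    finally show ?thesis unfolding h'_def .
  qed
  have inner: "(\<integral>\<^sup>+t. indicator {0<..} t * indicator {t. ennreal (t / 2) < y} t \<partial>lborel) \<le> 2 * y" for y :: ennreal
  proof (cases y)
    case (real r)
    have "(\<integral>\<^sup>+t. indicator {0<..} t * indicator {t. ennreal (t / 2) < y} t \<partial>lborel) \<le> (\<integral>\<^sup>+t. indicator {0..2 * r} t \<partial>lborel)"
      using real by (intro nn_integral_mono) (auto simp: indicator_def ennreal_less_iff)
    also have "\<dots> = 2 * y" using real by (simp add: ennreal_mult)
    finally show ?thesis .
  qed (simp add: ennreal_mult_top)
  have "(\<integral>\<^sup>+x. (maxop I m h x)\<^sup>2 \<partial>m) \<le>
      (\<integral>\<^sup>+t. ennreal (2 * t) * indicator {0<..} t * emeasure m {x \<in> space m. ennreal t < maxop I m h x} \<partial>lborel)"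
    using I by (intro m.nn_integral_square_le_layers maxop_measurable_m countable_finite)
  also have "\<dots> \<le> (\<integral>\<^sup>+t. (\<integral>\<^sup>+x. ennreal (4 * \<Delta>) * (h x * (indicator {0<..} t * indicator {t. ennreal (t / 2) < h x} t)) \<partial>m) \<partial>lborel)"
  proof (rule nn_integral_mono)
    fix t :: real
    show "ennreal (2 * t) * indicator {0<..} t * emeasure m {x \<in> space m. ennreal t < maxop I m h x} \<le>
      (\<integral>\<^sup>+x. ennreal (4 * \<Delta>) * (h x * (indicator {0<..} t * indicator {t. ennreal (t / 2) < h x} t)) \<partial>m)"
    proof (cases "0 < t")
      case True
      have "(\<integral>\<^sup>+x. ennreal (4 * \<Delta>) * (h x * (indicator {0<..} t * indicator {t. ennreal (t / 2) < h x} t)) \<partial>m) =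
        (\<integral>\<^sup>+x. ennreal (4 * \<Delta>) * (h x * indicator {x \<in> space m. ennreal (t / 2) < h x} x) \<partial>m)"
        using True by (intro nn_integral_cong) (auto simp: indicator_def)
      also have "\<dots> = ennreal (4 * \<Delta>) * (\<integral>\<^sup>+x. h x * indicator {x \<in> space m. ennreal (t / 2) < h x} x \<partial>m)"
        by (rule nn_integral_cmult) measurable
      finally show ?thesis using level[OF True] True by simp
    qed simp
  qed
  also have "\<dots> = (\<integral>\<^sup>+x. (\<integral>\<^sup>+t. ennreal (4 * \<Delta>) * (h x * (indicator {0<..} t * indicator {t. ennreal (t / 2) < h x} t)) \<partial>lborel) \<partial>m)"
    by (intro P.Fubini') measurable
  also have "\<dots> = (\<integral>\<^sup>+x. ennreal (4 * \<Delta>) * (h x * (\<integral>\<^sup>+t. indicator {0<..} t * indicator {t. ennreal (t / 2) < h x} t \<partial>lborel)) \<partial>m)"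
    by (simp add: nn_integral_cmult)
  also have "\<dots> \<le> (\<integral>\<^sup>+x. ennreal (4 * \<Delta>) * (h x * (2 * h x)) \<partial>m)"
    by (intro nn_integral_mono mult_left_mono inner) auto
  also have "\<dots> = (\<integral>\<^sup>+x. ennreal (8 * \<Delta>) * (h x)\<^sup>2 \<partial>m)"
  proof (intro nn_integral_cong)
    fix x
    have "ennreal (8 * \<Delta>) = ennreal (4 * \<Delta>) * 2"
      using \<Delta>_nonneg ennreal_mult[of "4 * \<Delta>" 2] by simp
    then show "ennreal (4 * \<Delta>) * (h x * (2 * h x)) = ennreal (8 * \<Delta>) * (h x)\<^sup>2"
      by (simp add: power2_eq_square ac_simps)
  qed
  also have "\<dots> = ennreal (8 * \<Delta>) * (\<integral>\<^sup>+x. (h x)\<^sup>2 \<partial>m)" by (rule nn_integral_cmult) measurable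
  finally show ?thesis .
qed

lemma maximal_strong_type:
  assumes I: "countable I" "I \<subseteq> balls" and h: "h \<in> borel_measurable m"
  shows "(\<integral>\<^sup>+x. (maxop I m h x)\<^sup>2 \<partial>m) \<le> ennreal (8 * \<Delta>) * (\<integral>\<^sup>+x. (h x)\<^sup>2 \<partial>m)"
proof (cases "I = {}")
  case False
  define F where "F n = from_nat_into I ` {..<n}" for n :: nat
  have F: "finite (F n)" "F n \<subseteq> balls" for n
    unfolding F_def using from_nat_into[OF False] I(2) by auto
  have UN: "I = (\<Union>n. F n)"
  proof -
    have "from_nat_into I i \<in> (\<Union>n. F n)" for i unfolding F_def by (rule UN_I[of "Suc i"]) auto
    then have "I \<subseteq> (\<Union>n. F n)" using range_from_nat_into[OF False I(1)] by force
    moreover have "(\<Union>n. F n) \<subseteq> I" unfolding F_def using from_nat_into[OF False] by auto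
    ultimately show ?thesis by auto
  qed
  have inc: "incseq (\<lambda>n. maxop (F n) m h x)" for x
    unfolding incseq_def maxop_def F_def by (intro allI impI SUP_subset_mono) auto
  have "maxop I m h x = (SUP n. maxop (F n) m h x)" for x
    unfolding maxop_def by (subst UN) (rule SUP_UNION)
  then have "(\<integral>\<^sup>+x. (maxop I m h x)\<^sup>2 \<partial>m) = (\<integral>\<^sup>+x. (SUP n. (maxop (F n) m h x)\<^sup>2) \<partial>m)"
    by (simp add: ennreal_SUP_square[OF inc])
  also have "\<dots> = (SUP n. \<integral>\<^sup>+x. (maxop (F n) m h x)\<^sup>2 \<partial>m)"
  proof (rule nn_integral_monotone_convergence_SUP)
    show "incseq (\<lambda>n x. (maxop (F n) m h x)\<^sup>2)"
      using inc unfolding incseq_def le_fun_def by (intro allI impI power_mono) auto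
    show "(\<lambda>x. (maxop (F n) m h x)\<^sup>2) \<in> borel_measurable m" for n
      using maxop_measurable_m[OF countable_finite[OF F(1)] F(2)] by measurable
  qed
  also have "\<dots> \<le> ennreal (8 * \<Delta>) * (\<integral>\<^sup>+x. (h x)\<^sup>2 \<partial>m)"
    by (intro SUP_least maximal_strong_type_finite F h)
  finally show ?thesis .
qed (simp add: maxop_def bot_ennreal)

end

end

section \<open>Muckenhoupt weights\<close>

lemma ennreal_le_of_mult_le:
  fixes x y z :: ennreal
  assumes "x * z \<le> y * z" "0 < z" "z < \<infinity>"
  shows "x \<le> y"
  using assms by (cases x; cases y; cases z) (auto simp: ennreal_mult[symmetric] ennreal_top_mult top_unique)

context homogeneous
begin

text \<open>Doubling is iterated the least number of times that reaches the dilation factor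
  \<open>3 * K^2\<close>; this makes the constant a function of \<open>\<kappa>\<close> and
  \<open>D\<close> alone.\<close>

definition \<Delta>\<^sub>0 :: real where "\<Delta>\<^sub>0 = D' ^ (LEAST n. 3 * K\<^sup>2 \<le> 2 ^ n)"

lemma \<Delta>\<^sub>0_ge_1: "1 \<le> \<Delta>\<^sub>0"
  unfolding \<Delta>\<^sub>0_def using D'_ge_1 by simp

lemma doubling_big:
  assumes "p \<in> balls"
  shows "emeasure \<nu> (qb (big p)) \<le> ennreal \<Delta>\<^sub>0 * emeasure \<nu> (qb p)"
proof -
  define n :: nat where "n = (LEAST n. 3 * K\<^sup>2 \<le> 2 ^ n)"
  have "\<exists>n. 3 * K\<^sup>2 < 2 ^ n" by (rule real_arch_pow) simp
  then obtain n' :: nat where "3 * K\<^sup>2 < 2 ^ n'" by blast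
  then have "3 * K\<^sup>2 \<le> 2 ^ n" unfolding n_def
    by (intro LeastI[where P = "\<lambda>n. 3 * K\<^sup>2 \<le> 2 ^ n" and k = n'] less_imp_le)
  then have "3 * K\<^sup>2 * snd p \<le> 2 ^ n * snd p" using assms unfolding balls_def by (intro mult_right_mono) auto
  from qball_mono[OF this] have "emeasure \<nu> (qb (big p)) \<le> emeasure \<nu> (qball \<nu> d (fst p) (2 ^ n * snd p))"
    using qb_sets[of "(fst p, 2 ^ n * snd p)"] assms
    by (intro emeasure_mono) (auto simp: balls_def)
  also have "\<dots> \<le> ennreal \<Delta>\<^sub>0 * emeasure \<nu> (qb p)"
    unfolding \<Delta>\<^sub>0_def n_def[symmetric] using assms by (intro doubling) (auto simp: balls_def)
  finally show ?thesis .
qed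

text \<open>Muckenhoupt's condition on one fibre. The two-sided bounds, inherited from admissible
  weights, make integrals of \<open>w\<close> and \<open>1 / w\<close> over balls positive and
  finite, so that they may be cancelled; they do not enter any constant.\<close>

definition A2_weight :: "('s \<Rightarrow> real) \<Rightarrow> real \<Rightarrow> bool" where
  "A2_weight w Q \<longleftrightarrow> w \<in> borel_measurable \<nu> \<and> (\<exists>e b. 0 < e \<and> (\<forall>u. e \<le> w u \<and> w u \<le> b)) \<and> 0 \<le> Q \<and>
    (\<forall>p\<in>balls. average \<nu> (qb p) (\<lambda>u. ennreal (w u)) * average \<nu> (qb p) (\<lambda>u. ennreal (1 / w u)) \<le> ennreal Q)"

lemma A2_weight_inverse:
  assumes "A2_weight w Q"
  shows "A2_weight (\<lambda>u. 1 / w u) Q"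
proof -
  obtain e b where e: "0 < e" "\<And>u. e \<le> w u" "\<And>u. w u \<le> b" using assms unfolding A2_weight_def by auto
  have "0 < w u" for u using e(1,2) by (rule less_le_trans)
  moreover have "0 < b" using e(1) e(2,3)[of undefined] by linarith
  ultimately have "0 < 1 / b \<and> (\<forall>u. 1 / b \<le> 1 / w u \<and> 1 / w u \<le> 1 / e)"
    using e by (auto simp: frac_le)
  then have "\<exists>e b. 0 < e \<and> (\<forall>u. e \<le> 1 / w u \<and> 1 / w u \<le> b)" by blast
  moreover have "(\<lambda>u. 1 / w u) \<in> borel_measurable \<nu>"
    by (rule borel_measurable_divide) (use assms in \<open>simp_all add: A2_weight_def\<close>)
  ultimately show ?thesis using assms unfolding A2_weight_def by (simp add: mult.commute)
qed

context
  fixes w :: "'s \<Rightarrow> real" and Q :: real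
  assumes w: "A2_weight w Q"
begin

lemma w_meas [measurable]: "w \<in> borel_measurable \<nu>" and Q_nonneg: "0 \<le> Q"
  and w_A2: "p \<in> balls \<Longrightarrow>
    average \<nu> (qb p) (\<lambda>u. ennreal (w u)) * average \<nu> (qb p) (\<lambda>u. ennreal (1 / w u)) \<le> ennreal Q"
  using w unfolding A2_weight_def by auto

lemma w_pos: "0 < w u"
  using w unfolding A2_weight_def by (meson less_le_trans)

lemma w_inv: "ennreal (w u) * ennreal (1 / w u) = 1" "ennreal (1 / w u) * ennreal (w u) = 1"
  using w_pos[of u] by (simp_all flip: ennreal_mult)

lemma w_int_bounds:
  assumes "p \<in> balls"
  shows "0 < (\<integral>\<^sup>+u\<in>qb p. ennreal (w u) \<partial>\<nu>)" "(\<integral>\<^sup>+u\<in>qb p. ennreal (w u) \<partial>\<nu>) < \<infinity>"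
proof -
  obtain e b where e: "0 < e" "\<And>u. e \<le> w u" "\<And>u. w u \<le> b" using w unfolding A2_weight_def by auto
  note [measurable] = qb_sets[OF assms]
  have "0 < ennreal e * emeasure \<nu> (qb p)"
    using e(1) qb_pos[OF assms] by (simp add: ennreal_zero_less_mult_iff)
  also have "\<dots> = (\<integral>\<^sup>+u\<in>qb p. ennreal e \<partial>\<nu>)" by (simp add: nn_integral_cmult_indicator)
  also have "\<dots> \<le> (\<integral>\<^sup>+u\<in>qb p. ennreal (w u) \<partial>\<nu>)"
    using e(2) by (intro nn_integral_mono mult_right_mono ennreal_leI) auto
  finally show "0 < (\<integral>\<^sup>+u\<in>qb p. ennreal (w u) \<partial>\<nu>)" .
  have "(\<integral>\<^sup>+u\<in>qb p. ennreal (w u) \<partial>\<nu>) \<le> (\<integral>\<^sup>+u\<in>qb p. ennreal b \<partial>\<nu>)"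
    using e(3) by (intro nn_integral_mono mult_right_mono ennreal_leI) auto
  also have "\<dots> = ennreal b * emeasure \<nu> (qb p)" by (simp add: nn_integral_cmult_indicator)
  also have "\<dots> < \<infinity>" using qb_fin[OF assms] by (simp add: ennreal_mult_less_top)
  finally show "(\<integral>\<^sup>+u\<in>qb p. ennreal (w u) \<partial>\<nu>) < \<infinity>" .
qed

lemma w_A2_int:
  assumes "p \<in> balls"
  shows "(\<integral>\<^sup>+u\<in>qb p. ennreal (w u) \<partial>\<nu>) * (\<integral>\<^sup>+u\<in>qb p. ennreal (1 / w u) \<partial>\<nu>) \<le> ennreal Q * (emeasure \<nu> (qb p))\<^sup>2"
proof -
  have "(\<integral>\<^sup>+u\<in>qb p. ennreal (w u) \<partial>\<nu>) * (\<integral>\<^sup>+u\<in>qb p. ennreal (1 / w u) \<partial>\<nu>) =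
    average \<nu> (qb p) (\<lambda>u. ennreal (w u)) * average \<nu> (qb p) (\<lambda>u. ennreal (1 / w u)) * (emeasure \<nu> (qb p))\<^sup>2"
    unfolding average_times[OF qb_pos[OF assms] qb_fin[OF assms], symmetric] power2_eq_square by (simp add: ac_simps)
  also have "\<dots> \<le> ennreal Q * (emeasure \<nu> (qb p))\<^sup>2" by (intro mult_right_mono w_A2 assms) simp
  finally show ?thesis .
qed

lemma w_Cauchy_Schwarz:
  assumes "p \<in> balls"
  shows "(emeasure \<nu> (qb p))\<^sup>2 \<le> (\<integral>\<^sup>+u\<in>qb p. ennreal (w u) \<partial>\<nu>) * (\<integral>\<^sup>+u\<in>qb p. ennreal (1 / w u) \<partial>\<nu>)"
proof -
  note [measurable] = qb_sets[OF assms]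
  define f where "f u = ennreal (sqrt (w u)) * indicator (qb p) u" for u
  define g where "g u = ennreal (sqrt (1 / w u)) * indicator (qb p) u" for u
  have [measurable]: "f \<in> borel_measurable \<nu>" "g \<in> borel_measurable \<nu>" unfolding f_def g_def by measurable
  have fg: "f u * g u = indicator (qb p) u" for u
  proof -
    have "sqrt (w u) * sqrt (1 / w u) = 1" using w_pos[of u] by (simp flip: real_sqrt_mult)
    then have "ennreal (sqrt (w u)) * ennreal (sqrt (1 / w u)) = 1"
      using w_pos[of u] by (simp flip: ennreal_mult)
    then show ?thesis unfolding f_def g_def by (simp add: indicator_def)
  qed
  have "(emeasure \<nu> (qb p))\<^sup>2 = (\<integral>\<^sup>+u. f u * g u \<partial>\<nu>)\<^sup>2" unfolding fg by simp
  also have "\<dots> \<le> (\<integral>\<^sup>+u. (f u)\<^sup>2 \<partial>\<nu>) * (\<integral>\<^sup>+u. (g u)\<^sup>2 \<partial>\<nu>)" by (rule Cauchy_Schwarz_nn_integral) auto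
  also have "(\<lambda>u. (f u)\<^sup>2) = (\<lambda>u. ennreal (w u) * indicator (qb p) u)"
    unfolding f_def using w_pos by (auto simp: fun_eq_iff indicator_def ennreal_power less_imp_le)
  also have "(\<lambda>u. (g u)\<^sup>2) = (\<lambda>u. ennreal (1 / w u) * indicator (qb p) u)"
    unfolding g_def using w_pos by (auto simp: fun_eq_iff indicator_def ennreal_power less_imp_le)
  finally show ?thesis .
qed

end

text \<open>For a ball \<open>B\<close>, its dilation \<open>B'\<close> and
  \<open>\<sigma> = 1 / w\<close>, one has \<open>w(B') \<sigma>(B) \<le> w(B') \<sigma>(B') \<le> Q
  \<nu>(B')^2 \<le> Q \<Delta>\<^sub>0^2 \<nu>(B)^2\<close>, and
  \<open>\<nu>(B)^2 \<le> w(B) \<sigma>(B)\<close> by Cauchy-Schwarz. Cancelling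
  \<open>\<sigma>(B)\<close> leaves the doubling of \<open>w\<close>.\<close>

lemma A2_weight_doubling:
  assumes w: "A2_weight w Q"
  shows "doubling_measure (density \<nu> (\<lambda>u. ennreal (w u))) (Q * \<Delta>\<^sub>0\<^sup>2)"
proof -
  note wm [measurable] = w_meas[OF w]
  note w' = A2_weight_inverse[OF w]
  interpret sigma_finite_measure \<nu> by (rule sigma_finite)
  define mw where "mw p = (\<integral>\<^sup>+u\<in>qb p. ennreal (w u) \<partial>\<nu>)" for p
  define ms where "ms p = (\<integral>\<^sup>+u\<in>qb p. ennreal (1 / w u) \<partial>\<nu>)" for p
  have em: "emeasure (density \<nu> (\<lambda>u. ennreal (w u))) (qb p) = mw p" if "p \<in> balls" for p
    unfolding mw_def using qb_sets[OF that] by (intro emeasure_density) auto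
  have big: "mw (big p) \<le> ennreal (Q * \<Delta>\<^sub>0\<^sup>2) * mw p" if p: "p \<in> balls" for p
  proof (rule ennreal_le_of_mult_le)
    note bp = big_balls[OF p]
    show "0 < ms p" "ms p < \<infinity>" unfolding ms_def using w_int_bounds[OF w' p] by auto
    have "mw (big p) * ms p \<le> mw (big p) * ms (big p)"
      unfolding ms_def using qb_sub_big[OF p]
      by (intro mult_left_mono nn_integral_mono) (auto simp: indicator_def)
    also have "\<dots> \<le> ennreal Q * (emeasure \<nu> (qb (big p)))\<^sup>2"
      unfolding mw_def ms_def by (rule w_A2_int[OF w bp])
    also have "\<dots> \<le> ennreal Q * (ennreal \<Delta>\<^sub>0 * emeasure \<nu> (qb p))\<^sup>2"
      by (intro mult_left_mono power_mono doubling_big p) auto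
    also have "\<dots> = ennreal (Q * \<Delta>\<^sub>0\<^sup>2) * (emeasure \<nu> (qb p))\<^sup>2"
      using Q_nonneg[OF w] \<Delta>\<^sub>0_ge_1 by (simp add: power_mult_distrib ennreal_mult ennreal_power mult.assoc)
    also have "\<dots> \<le> ennreal (Q * \<Delta>\<^sub>0\<^sup>2) * (mw p * ms p)"
      unfolding mw_def ms_def by (intro mult_left_mono w_Cauchy_Schwarz[OF w p]) auto
    finally show "mw (big p) * ms p \<le> ennreal (Q * \<Delta>\<^sub>0\<^sup>2) * mw p * ms p" by (simp add: mult.assoc)
  qed
  have "sigma_finite_measure (density \<nu> (\<lambda>u. ennreal (w u)))"
    by (subst sigma_finite_iff_density_finite) auto
  moreover have "0 \<le> Q * \<Delta>\<^sub>0\<^sup>2" using Q_nonneg[OF w] by simp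
  ultimately show ?thesis
    unfolding doubling_measure_def
  proof (intro conjI ballI)
    fix p assume p: "p \<in> balls"
    show "0 < emeasure (density \<nu> (\<lambda>u. ennreal (w u))) (qb p)"
      "emeasure (density \<nu> (\<lambda>u. ennreal (w u))) (qb p) < \<infinity>"
      unfolding em[OF p] mw_def using w_int_bounds[OF w p] by auto
    show "emeasure (density \<nu> (\<lambda>u. ennreal (w u))) (qb (big p)) \<le>
        ennreal (Q * \<Delta>\<^sub>0\<^sup>2) * emeasure (density \<nu> (\<lambda>u. ennreal (w u))) (qb p)"
      unfolding em[OF p] em[OF big_balls[OF p]] by (rule big[OF p])
  qed simp
qed

text \<open>
  Lerner's proof of Muckenhoupt's theorem: for \<open>\<sigma> = 1 / w\<close> and a ball \<open>B\<close> containing \<open>x\<close>,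
  the average of \<open>h\<close> over \<open>B\<close> is \<open>w(B) \<sigma>(B) / \<nu>(B)\<^sup>2\<close> times an average with respect to \<open>w\<close> of
  a function bounded by \<open>\<sigma> M\<^sub>\<sigma>(h w)\<close>.
\<close>

lemma maxop_le_iterated:
  assumes w: "A2_weight w Q" and I: "countable I" "I \<subseteq> balls"
    and h [measurable]: "h \<in> borel_measurable \<nu>"
  defines "mw \<equiv> density \<nu> (\<lambda>u. ennreal (w u))" and "ms \<equiv> density \<nu> (\<lambda>u. ennreal (1 / w u))"
  shows "maxop I \<nu> h x \<le> ennreal Q *
    maxop I mw (\<lambda>u. maxop I ms (\<lambda>v. h v * ennreal (w v)) u * ennreal (1 / w u)) x"
  unfolding maxop_def[of I \<nu>]
proof (rule SUP_least)
  note wm [measurable] = w_meas[OF w]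
  fix p assume pI: "p \<in> I"
  then have p: "p \<in> balls" using I by auto
  note [measurable] = qb_sets[OF p]
  define G where "G = maxop I ms (\<lambda>v. h v * ennreal (w v))"
  have G_meas [measurable]: "G \<in> borel_measurable \<nu>"
    using maxop_measurable_m[OF A2_weight_doubling[OF A2_weight_inverse[OF w]] I]
    unfolding G_def ms_def by simp
  define R where "R = maxop I mw (\<lambda>u. G u * ennreal (1 / w u)) x"
  define W where "W = (\<integral>\<^sup>+u\<in>qb p. ennreal (w u) \<partial>\<nu>)"
  define S where "S = (\<integral>\<^sup>+u\<in>qb p. ennreal (1 / w u) \<partial>\<nu>)"
  have emW: "emeasure mw (qb p) = W" "0 < W" "W < \<infinity>"
    unfolding mw_def W_def using w_int_bounds[OF w p] by (auto simp: emeasure_density)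
  have emS: "emeasure ms (qb p) = S" "0 < S" "S < \<infinity>"
    unfolding ms_def S_def using w_int_bounds[OF A2_weight_inverse[OF w] p] by (auto simp: emeasure_density)
  show "average \<nu> (qb p) h * indicator (qb p) x \<le> ennreal Q *
    maxop I mw (\<lambda>u. maxop I ms (\<lambda>v. h v * ennreal (w v)) u * ennreal (1 / w u)) x"
  proof (cases "x \<in> qb p")
    case True
    define s where "s = average ms (qb p) (\<lambda>v. h v * ennreal (w v))"
    \<comment> \<open>The density \<open>1 / w\<close> of \<open>ms\<close> cancels the factor
      \<open>w\<close>: the \<open>ms\<close>-average of \<open>h w\<close> and the
      \<open>\<nu>\<close>-average of \<open>h\<close> differ only by the ratio of the two masses of
      the ball.\<close>
    have "s * S = (\<integral>\<^sup>+v\<in>qb p. h v * ennreal (w v) \<partial>ms)"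
      unfolding s_def using average_times[of ms "qb p"] emS by simp
    also have "\<dots> = (\<integral>\<^sup>+v. ennreal (1 / w v) * (h v * ennreal (w v) * indicator (qb p) v) \<partial>\<nu>)"
      unfolding ms_def by (intro nn_integral_density) measurable
    also have "\<dots> = (\<integral>\<^sup>+v\<in>qb p. h v \<partial>\<nu>)"
    proof (intro nn_integral_cong)
      fix v
      have "ennreal (1 / w v) * (h v * ennreal (w v) * indicator (qb p) v) =
        (ennreal (1 / w v) * ennreal (w v)) * (h v * indicator (qb p) v)" by (simp only: ac_simps)
      then show "ennreal (1 / w v) * (h v * ennreal (w v) * indicator (qb p) v) = h v * indicator (qb p) v"
        unfolding w_inv[OF w] by simp
    qed
    also have "\<dots> = average \<nu> (qb p) h * emeasure \<nu> (qb p)"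
      by (rule average_times[OF qb_pos[OF p] qb_fin[OF p], symmetric])
    finally have 1: "average \<nu> (qb p) h * emeasure \<nu> (qb p) = s * S" ..
    have s_le: "s \<le> G u" if "u \<in> qb p" for u
      unfolding G_def maxop_def s_def by (rule SUP_upper2[OF pI]) (use that in simp)
    have "s * emeasure \<nu> (qb p) = (\<integral>\<^sup>+u. s * indicator (qb p) u \<partial>\<nu>)" by (simp add: nn_integral_cmult_indicator)
    also have "\<dots> \<le> (\<integral>\<^sup>+u. G u * indicator (qb p) u \<partial>\<nu>)"
      using s_le by (intro nn_integral_mono) (auto simp: indicator_def)
    also have "\<dots> = (\<integral>\<^sup>+u. ennreal (w u) * (G u * ennreal (1 / w u) * indicator (qb p) u) \<partial>\<nu>)"
    proof (intro nn_integral_cong)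
      fix u
      have "ennreal (w u) * (G u * ennreal (1 / w u) * indicator (qb p) u) =
        (ennreal (1 / w u) * ennreal (w u)) * (G u * indicator (qb p) u)" by (simp only: ac_simps)
      then show "G u * indicator (qb p) u = ennreal (w u) * (G u * ennreal (1 / w u) * indicator (qb p) u)"
        unfolding w_inv[OF w] by simp
    qed
    also have "\<dots> = (\<integral>\<^sup>+u\<in>qb p. G u * ennreal (1 / w u) \<partial>mw)"
      unfolding mw_def by (intro nn_integral_density[symmetric]) measurable
    also have "\<dots> = average mw (qb p) (\<lambda>u. G u * ennreal (1 / w u)) * W"
      using average_times[of mw "qb p"] emW by simp
    also have "\<dots> \<le> R * W"
    proof (rule mult_right_mono)
      show "average mw (qb p) (\<lambda>u. G u * ennreal (1 / w u)) \<le> R"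
        unfolding R_def maxop_def[of I mw] by (rule SUP_upper2[OF pI]) (use True in simp)
    qed simp
    finally have 2: "s * emeasure \<nu> (qb p) \<le> R * W" .
    \<comment> \<open>Multiplied by the squared \<open>\<nu>\<close>-measure of the ball, relations
      \<open>1\<close> and \<open>2\<close> combine to a bound by \<open>R * (W * S)\<close>, to
      which the A_2 condition applies.\<close>
    have "average \<nu> (qb p) h \<le> ennreal Q * R"
    proof (rule ennreal_le_of_mult_le)
      show "0 < (emeasure \<nu> (qb p))\<^sup>2" using qb_pos[OF p] by (simp add: power2_eq_square ennreal_zero_less_mult_iff)
      show "(emeasure \<nu> (qb p))\<^sup>2 < \<infinity>" using qb_fin[OF p] by (simp add: power2_eq_square ennreal_mult_less_top)
      have "average \<nu> (qb p) h * (emeasure \<nu> (qb p))\<^sup>2 = (average \<nu> (qb p) h * emeasure \<nu> (qb p)) * emeasure \<nu> (qb p)"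
        by (simp only: power2_eq_square mult.assoc)
      also have "\<dots> = s * emeasure \<nu> (qb p) * S" unfolding 1 by (simp only: ac_simps)
      also have "\<dots> \<le> R * W * S" by (rule mult_right_mono[OF 2]) simp
      also have "\<dots> = R * (W * S)" by (rule mult.assoc)
      also have "\<dots> \<le> R * (ennreal Q * (emeasure \<nu> (qb p))\<^sup>2)"
        unfolding W_def S_def by (rule mult_left_mono[OF w_A2_int[OF w p]]) simp
      finally show "average \<nu> (qb p) h * (emeasure \<nu> (qb p))\<^sup>2 \<le> ennreal Q * R * (emeasure \<nu> (qb p))\<^sup>2"
        by (simp add: ac_simps)
    qed
    then show ?thesis using True unfolding R_def G_def by simp
  qed simp
qed

text \<open>After \<open>maxop_le_iterated\<close> two maximal theorems remain, for the measures
  \<open>mw\<close> and \<open>ms\<close>. Multiplication by \<open>1 / w\<close> is an isometry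
  from \<open>L_2(ms)\<close> to \<open>L_2(mw)\<close>, and multiplication by \<open>w\<close> is
  one from \<open>L_2(mw)\<close> to \<open>L_2(ms)\<close>. Hence the factor \<open>Q^2\<close> and
  two factors \<open>8 * (Q * \<Delta>\<^sub>0^2)\<close>.\<close>

lemma A2_maximal:
  assumes w: "A2_weight w Q" and I: "countable I" "I \<subseteq> balls"
    and h [measurable]: "h \<in> borel_measurable \<nu>"
  shows "(\<integral>\<^sup>+x. (maxop I \<nu> h x)\<^sup>2 * ennreal (w x) \<partial>\<nu>) \<le>
    ennreal (Q\<^sup>2 * (8 * (Q * \<Delta>\<^sub>0\<^sup>2))\<^sup>2) * (\<integral>\<^sup>+x. (h x)\<^sup>2 * ennreal (w x) \<partial>\<nu>)"
proof -
  note wm [measurable] = w_meas[OF w]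
  note w' = A2_weight_inverse[OF w]
  define mw where "mw = density \<nu> (\<lambda>u. ennreal (w u))"
  define ms where "ms = density \<nu> (\<lambda>u. ennreal (1 / w u))"
  define \<Delta> where "\<Delta> = 8 * (Q * \<Delta>\<^sub>0\<^sup>2)"
  have \<Delta>: "0 \<le> \<Delta>" unfolding \<Delta>_def using Q_nonneg[OF w] by simp
  have dw: "doubling_measure mw (Q * \<Delta>\<^sub>0\<^sup>2)" unfolding mw_def by (rule A2_weight_doubling[OF w])
  have ds: "doubling_measure ms (Q * \<Delta>\<^sub>0\<^sup>2)" unfolding ms_def by (rule A2_weight_doubling[OF w'])
  define G where "G = maxop I ms (\<lambda>v. h v * ennreal (w v))"
  have G_meas [measurable]: "G \<in> borel_measurable \<nu>"
    using maxop_measurable_m[OF ds I] unfolding G_def ms_def by simp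
  define R where "R = maxop I mw (\<lambda>u. G u * ennreal (1 / w u))"
  have R_meas [measurable]: "R \<in> borel_measurable \<nu>"
    using maxop_measurable_m[OF dw I] unfolding R_def mw_def by simp
  have "(\<integral>\<^sup>+x. (maxop I \<nu> h x)\<^sup>2 * ennreal (w x) \<partial>\<nu>) \<le> (\<integral>\<^sup>+x. ennreal (Q\<^sup>2) * (ennreal (w x) * (R x)\<^sup>2) \<partial>\<nu>)"
  proof (rule nn_integral_mono)
    fix x
    have "maxop I \<nu> h x \<le> ennreal Q * R x"
      unfolding R_def G_def mw_def ms_def by (rule maxop_le_iterated[OF w I h])
    then have "(maxop I \<nu> h x)\<^sup>2 \<le> (ennreal Q * R x)\<^sup>2" by (rule power_mono) simp
    also have "\<dots> = ennreal (Q\<^sup>2) * (R x)\<^sup>2" using Q_nonneg[OF w] by (simp add: power_mult_distrib ennreal_power)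
    finally have "(maxop I \<nu> h x)\<^sup>2 * ennreal (w x) \<le> ennreal (Q\<^sup>2) * (R x)\<^sup>2 * ennreal (w x)"
      by (rule mult_right_mono) simp
    then show "(maxop I \<nu> h x)\<^sup>2 * ennreal (w x) \<le> ennreal (Q\<^sup>2) * (ennreal (w x) * (R x)\<^sup>2)"
      by (simp add: ac_simps)
  qed
  also have "\<dots> = ennreal (Q\<^sup>2) * (\<integral>\<^sup>+x. (R x)\<^sup>2 \<partial>mw)"
    unfolding mw_def by (subst nn_integral_density) (auto simp: nn_integral_cmult)
  also have "(\<integral>\<^sup>+x. (R x)\<^sup>2 \<partial>mw) \<le> ennreal \<Delta> * (\<integral>\<^sup>+u. (G u * ennreal (1 / w u))\<^sup>2 \<partial>mw)"
    unfolding R_def \<Delta>_def by (rule maximal_strong_type[OF dw I]) (simp add: mw_def)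
  also have "(\<integral>\<^sup>+u. (G u * ennreal (1 / w u))\<^sup>2 \<partial>mw) = (\<integral>\<^sup>+u. ennreal (w u) * (G u * ennreal (1 / w u))\<^sup>2 \<partial>\<nu>)"
    unfolding mw_def by (rule nn_integral_density) measurable
  also have "\<dots> = (\<integral>\<^sup>+u. ennreal (1 / w u) * (G u)\<^sup>2 \<partial>\<nu>)"
  proof (intro nn_integral_cong)
    fix u
    have "ennreal (w u) * (G u * ennreal (1 / w u))\<^sup>2 = (ennreal (w u) * ennreal (1 / w u)) * (ennreal (1 / w u) * (G u)\<^sup>2)"
      by (simp only: power2_eq_square ac_simps)
    then show "ennreal (w u) * (G u * ennreal (1 / w u))\<^sup>2 = ennreal (1 / w u) * (G u)\<^sup>2"
      unfolding w_inv[OF w] by simp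
  qed
  also have "\<dots> = (\<integral>\<^sup>+u. (G u)\<^sup>2 \<partial>ms)"
    unfolding ms_def by (rule nn_integral_density[symmetric]) measurable
  also have "\<dots> \<le> ennreal \<Delta> * (\<integral>\<^sup>+u. (h u * ennreal (w u))\<^sup>2 \<partial>ms)"
    unfolding G_def \<Delta>_def by (rule maximal_strong_type[OF ds I]) (simp add: ms_def)
  also have "(\<integral>\<^sup>+u. (h u * ennreal (w u))\<^sup>2 \<partial>ms) = (\<integral>\<^sup>+u. ennreal (1 / w u) * (h u * ennreal (w u))\<^sup>2 \<partial>\<nu>)"
    unfolding ms_def by (rule nn_integral_density) measurable
  also have "\<dots> = (\<integral>\<^sup>+u. (h u)\<^sup>2 * ennreal (w u) \<partial>\<nu>)"
  proof (intro nn_integral_cong)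
    fix u
    have "ennreal (1 / w u) * (h u * ennreal (w u))\<^sup>2 = (ennreal (w u) * ennreal (1 / w u)) * ((h u)\<^sup>2 * ennreal (w u))"
      by (simp only: power2_eq_square ac_simps)
    then show "ennreal (1 / w u) * (h u * ennreal (w u))\<^sup>2 = (h u)\<^sup>2 * ennreal (w u)"
      unfolding w_inv[OF w] by simp
  qed
  finally have "(\<integral>\<^sup>+x. (maxop I \<nu> h x)\<^sup>2 * ennreal (w x) \<partial>\<nu>) \<le>
    ennreal (Q\<^sup>2) * (ennreal \<Delta> * (ennreal \<Delta> * (\<integral>\<^sup>+u. (h u)\<^sup>2 * ennreal (w u) \<partial>\<nu>)))"
    by (simp add: mult_left_mono)
  also have "\<dots> = ennreal (Q\<^sup>2 * \<Delta>\<^sup>2) * (\<integral>\<^sup>+u. (h u)\<^sup>2 * ennreal (w u) \<partial>\<nu>)"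
    using \<Delta> by (simp add: ennreal_mult power2_eq_square[of \<Delta>] mult.assoc)
  finally show ?thesis unfolding \<Delta>_def .
qed

text \<open>The transpose, for the pairing by \<open>\<nu>\<close>, of the linear operator that
  replaces \<open>G\<close> on each \<open>E i\<close>, at points of the ball \<open>p i\<close>, by
  its average over that ball. For disjoint \<open>E i\<close> this operator is a linearised maximal
  operator.\<close>

definition adjoint :: "nat \<Rightarrow> (nat \<Rightarrow> 's \<times> real) \<Rightarrow> (nat \<Rightarrow> 's set) \<Rightarrow> ('s \<Rightarrow> ennreal) \<Rightarrow> 's \<Rightarrow> ennreal" where
  "adjoint n p E F u = (\<Sum>i<n. indicator (qb (p i)) u * average \<nu> (qb (p i)) (\<lambda>x. indicator (E i) x * F x))"

lemma adjoint_duality: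
  assumes p: "\<And>i. i < n \<Longrightarrow> p i \<in> balls" and E: "\<And>i. i < n \<Longrightarrow> E i \<in> sets \<nu>"
    and F [measurable]: "F \<in> borel_measurable \<nu>" and G [measurable]: "G \<in> borel_measurable \<nu>"
  shows "(\<integral>\<^sup>+u. adjoint n p E F u * G u \<partial>\<nu>) =
    (\<integral>\<^sup>+x. F x * (\<Sum>i<n. indicator (E i) x * (average \<nu> (qb (p i)) G * indicator (qb (p i)) x)) \<partial>\<nu>)"
proof -
  have term_eq: "(\<integral>\<^sup>+u. indicator (qb (p i)) u * average \<nu> (qb (p i)) (\<lambda>x. indicator (E i) x * F x) * G u \<partial>\<nu>) =
    (\<integral>\<^sup>+x. F x * (indicator (E i) x * (average \<nu> (qb (p i)) G * indicator (qb (p i)) x)) \<partial>\<nu>)"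
    if i: "i < n" for i
  proof -
    note [measurable] = qb_sets[OF p[OF i]] E[OF i]
    have "(\<integral>\<^sup>+u. indicator (qb (p i)) u * average \<nu> (qb (p i)) (\<lambda>x. indicator (E i) x * F x) * G u \<partial>\<nu>) =
      (\<integral>\<^sup>+u. average \<nu> (qb (p i)) (\<lambda>x. indicator (E i) x * F x) * (G u * indicator (qb (p i)) u) \<partial>\<nu>)"
      by (intro nn_integral_cong) (simp only: ac_simps)
    also have "\<dots> = average \<nu> (qb (p i)) (\<lambda>x. indicator (E i) x * F x) * (\<integral>\<^sup>+u. G u * indicator (qb (p i)) u \<partial>\<nu>)"
      by (rule nn_integral_cmult) measurable
    also have "\<dots> = average \<nu> (qb (p i)) G * (\<integral>\<^sup>+x. indicator (E i) x * F x * indicator (qb (p i)) x \<partial>\<nu>)"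
      unfolding average_def by (simp add: divide_ennreal_def ac_simps)
    also have "\<dots> = (\<integral>\<^sup>+x. average \<nu> (qb (p i)) G * (indicator (E i) x * F x * indicator (qb (p i)) x) \<partial>\<nu>)"
      by (rule nn_integral_cmult[symmetric]) measurable
    also have "\<dots> = (\<integral>\<^sup>+x. F x * (indicator (E i) x * (average \<nu> (qb (p i)) G * indicator (qb (p i)) x)) \<partial>\<nu>)"
      by (intro nn_integral_cong) (simp only: ac_simps)
    finally show ?thesis .
  qed
  have "(\<integral>\<^sup>+u. adjoint n p E F u * G u \<partial>\<nu>) =
    (\<integral>\<^sup>+u. (\<Sum>i<n. indicator (qb (p i)) u * average \<nu> (qb (p i)) (\<lambda>x. indicator (E i) x * F x) * G u) \<partial>\<nu>)"
    unfolding adjoint_def sum_distrib_right ..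
  also have "\<dots> = (\<Sum>i<n. \<integral>\<^sup>+u. indicator (qb (p i)) u * average \<nu> (qb (p i)) (\<lambda>x. indicator (E i) x * F x) * G u \<partial>\<nu>)"
    using qb_sets[OF p] by (intro nn_integral_sum) (auto intro!: borel_measurable_times_ennreal)
  also have "\<dots> = (\<Sum>i<n. \<integral>\<^sup>+x. F x * (indicator (E i) x * (average \<nu> (qb (p i)) G * indicator (qb (p i)) x)) \<partial>\<nu>)"
    by (intro sum.cong term_eq) auto
  also have "\<dots> = (\<integral>\<^sup>+x. (\<Sum>i<n. F x * (indicator (E i) x * (average \<nu> (qb (p i)) G * indicator (qb (p i)) x))) \<partial>\<nu>)"
    using qb_sets[OF p] E by (intro nn_integral_sum[symmetric]) (auto intro!: borel_measurable_times_ennreal)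
  finally show ?thesis unfolding sum_distrib_left .
qed

text \<open>Duality: the linearised operator lies below \<open>maxop\<close>, which is bounded in
  \<open>L_2\<close> with weight \<open>1 / w\<close> because this weight has the same A_2 constant.
  The transpose is therefore bounded in \<open>L_2\<close> with weight \<open>w\<close>, with the
  same constant.\<close>

lemma adjoint_bounded:
  assumes w: "A2_weight w Q"
    and p: "\<And>i. i < n \<Longrightarrow> p i \<in> balls" and E: "\<And>i. i < n \<Longrightarrow> E i \<in> sets \<nu>" "disjoint_family_on E {..<n}"
    and F [measurable]: "F \<in> borel_measurable \<nu>"
  shows "(\<integral>\<^sup>+u. (adjoint n p E F u)\<^sup>2 * ennreal (w u) \<partial>\<nu>) \<le>
    ennreal (Q\<^sup>2 * (8 * (Q * \<Delta>\<^sub>0\<^sup>2))\<^sup>2) * (\<integral>\<^sup>+x. (F x)\<^sup>2 * ennreal (w x) \<partial>\<nu>)"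
proof -
  note wm [measurable] = w_meas[OF w]
  interpret sigma_finite_measure \<nu> by (rule sigma_finite)
  define C1 where "C1 = ennreal (Q\<^sup>2 * (8 * (Q * \<Delta>\<^sub>0\<^sup>2))\<^sup>2)"
  define h where "h = adjoint n p E F"
  have h_meas [measurable]: "h \<in> borel_measurable \<nu>"
    unfolding h_def adjoint_def[abs_def] using qb_sets[OF p]
    by (intro borel_measurable_sum borel_measurable_times_ennreal) auto
  define I where "I = p ` {..<n}"
  have I: "countable I" "I \<subseteq> balls" unfolding I_def using p by auto
  have L_le: "(\<Sum>i<n. indicator (E i) x * (average \<nu> (qb (p i)) G * indicator (qb (p i)) x)) \<le> maxop I \<nu> G x" for G x
  proof -
    have "(\<Sum>i<n. indicator (E i) x * (average \<nu> (qb (p i)) G * indicator (qb (p i)) x)) \<le>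
        (\<Sum>i<n. indicator (E i) x * maxop I \<nu> G x)"
      unfolding maxop_def I_def by (intro sum_mono mult_left_mono SUP_upper) auto
    also have "\<dots> = indicator (\<Union>i<n. E i) x * maxop I \<nu> G x"
      unfolding sum_distrib_right[symmetric] indicator_UN_disjoint[OF finite_lessThan E(2)] ..
    also have "\<dots> \<le> maxop I \<nu> G x" by (auto simp: indicator_def)
    finally show ?thesis .
  qed
  obtain R :: "nat \<Rightarrow> 's set" where R: "range R \<subseteq> sets \<nu>" "(\<Union>i. R i) = space \<nu>" "\<And>i. emeasure \<nu> (R i) \<noteq> \<infinity>" "incseq R"
    by (rule sigma_finite_incseq) blast
  obtain b where b: "\<And>u. w u \<le> b" using w unfolding A2_weight_def by auto
  \<comment> \<open>Bounded truncations with support of finite measure: the integral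
    \<open>Y\<close> below is then finite and can be cancelled from
    \<open>Y^2 \<le> C1 * X * Y\<close>. Monotone convergence restores \<open>h\<close> at the
    end.\<close>
  define g where "g k u = min (h u) (ennreal (real k)) * indicator (R k) u" for k u
  have Rm [measurable]: "R k \<in> sets \<nu>" for k using R(1) by auto
  have g_meas [measurable]: "g k \<in> borel_measurable \<nu>" for k unfolding g_def by measurable
  have g_le: "g k u \<le> h u" for k u unfolding g_def by (auto simp: indicator_def)
  define X where "X = (\<integral>\<^sup>+x. (F x)\<^sup>2 * ennreal (w x) \<partial>\<nu>)"
  have g_bound: "(\<integral>\<^sup>+u. (g k u)\<^sup>2 * ennreal (w u) \<partial>\<nu>) \<le> C1 * X" for k
  proof -
    define Y where "Y = (\<integral>\<^sup>+u. (g k u)\<^sup>2 * ennreal (w u) \<partial>\<nu>)"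
    have "Y \<le> (\<integral>\<^sup>+u. (ennreal (real k))\<^sup>2 * ennreal b * indicator (R k) u \<partial>\<nu>)"
      unfolding Y_def
    proof (rule nn_integral_mono)
      fix u
      show "(g k u)\<^sup>2 * ennreal (w u) \<le> (ennreal (real k))\<^sup>2 * ennreal b * indicator (R k) u"
        using b[of u] unfolding g_def by (auto simp: indicator_def intro!: mult_mono power_mono ennreal_leI)
    qed
    also have "\<dots> = (ennreal (real k))\<^sup>2 * ennreal b * emeasure \<nu> (R k)" by (simp add: nn_integral_cmult_indicator)
    also have "\<dots> < \<infinity>" using R(3)[of k] by (simp add: ennreal_mult_less_top less_top ennreal_power)
    finally have Y_fin: "Y < \<infinity>" .
    \<comment> \<open>Tested against \<open>\<phi> = g k * w\<close>, the transpose gives at least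
      \<open>Y\<close>; the squared norm of \<open>\<phi>\<close> for the weight
      \<open>1 / w\<close> is \<open>Y\<close> again.\<close>
    define \<phi> where "\<phi> u = g k u * ennreal (w u)" for u
    have \<phi>_meas [measurable]: "\<phi> \<in> borel_measurable \<nu>" unfolding \<phi>_def by measurable
    define m where "m = maxop I \<nu> \<phi>"
    have m_meas [measurable]: "m \<in> borel_measurable \<nu>"
    proof -
      have "(\<lambda>x. average \<nu> (qb p) \<phi> * indicator (qb p) x) \<in> borel_measurable \<nu>" if "p \<in> I" for p
        using qb_sets[of p] that I(2)
        by (intro borel_measurable_times_ennreal borel_measurable_const borel_measurable_indicator) auto
      then show ?thesis unfolding m_def maxop_def by (intro borel_measurable_SUP I(1)) auto
    qed
    have "Y \<le> (\<integral>\<^sup>+u. h u * \<phi> u \<partial>\<nu>)"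
      unfolding Y_def \<phi>_def power2_eq_square mult.assoc
      using g_le by (intro nn_integral_mono mult_right_mono) auto
    also have "\<dots> = (\<integral>\<^sup>+x. F x * (\<Sum>i<n. indicator (E i) x * (average \<nu> (qb (p i)) \<phi> * indicator (qb (p i)) x)) \<partial>\<nu>)"
      unfolding h_def by (rule adjoint_duality[OF p E(1) F \<phi>_meas])
    also have "\<dots> \<le> (\<integral>\<^sup>+x. F x * m x \<partial>\<nu>)"
      unfolding m_def by (intro nn_integral_mono mult_left_mono L_le) auto
    also have "\<dots> = (\<integral>\<^sup>+x. (F x * ennreal (sqrt (w x))) * (m x * ennreal (sqrt (1 / w x))) \<partial>\<nu>)"
    proof (intro nn_integral_cong)
      fix x
      have "ennreal (sqrt (w x)) * ennreal (sqrt (1 / w x)) = ennreal (sqrt (w x) * sqrt (1 / w x))"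
        using w_pos[OF w, of x] by (intro ennreal_mult[symmetric]) auto
      also have "sqrt (w x) * sqrt (1 / w x) = 1" using w_pos[OF w, of x] by (simp flip: real_sqrt_mult)
      finally have e: "ennreal (sqrt (w x)) * ennreal (sqrt (1 / w x)) = 1" by simp
      have "(F x * ennreal (sqrt (w x))) * (m x * ennreal (sqrt (1 / w x))) =
        (ennreal (sqrt (w x)) * ennreal (sqrt (1 / w x))) * (F x * m x)" by (simp only: ac_simps)
      then show "F x * m x = (F x * ennreal (sqrt (w x))) * (m x * ennreal (sqrt (1 / w x)))"
        unfolding e by simp
    qed
    finally have "Y\<^sup>2 \<le> (\<integral>\<^sup>+x. (F x * ennreal (sqrt (w x))) * (m x * ennreal (sqrt (1 / w x))) \<partial>\<nu>)\<^sup>2"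
      by (rule power_mono) simp
    also have "\<dots> \<le> (\<integral>\<^sup>+x. (F x * ennreal (sqrt (w x)))\<^sup>2 \<partial>\<nu>) * (\<integral>\<^sup>+x. (m x * ennreal (sqrt (1 / w x)))\<^sup>2 \<partial>\<nu>)"
      by (rule Cauchy_Schwarz_nn_integral) measurable
    also have "(\<integral>\<^sup>+x. (F x * ennreal (sqrt (w x)))\<^sup>2 \<partial>\<nu>) = X"
      unfolding X_def using w_pos[OF w] by (intro nn_integral_cong) (simp add: power_mult_distrib ennreal_power less_imp_le)
    also have "(\<integral>\<^sup>+x. (m x * ennreal (sqrt (1 / w x)))\<^sup>2 \<partial>\<nu>) = (\<integral>\<^sup>+x. (m x)\<^sup>2 * ennreal (1 / w x) \<partial>\<nu>)"
      using w_pos[OF w] by (intro nn_integral_cong) (simp add: power_mult_distrib ennreal_power less_imp_le)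
    also have "\<dots> \<le> C1 * (\<integral>\<^sup>+x. (\<phi> x)\<^sup>2 * ennreal (1 / w x) \<partial>\<nu>)"
      unfolding m_def C1_def by (rule A2_maximal[OF A2_weight_inverse[OF w] I \<phi>_meas])
    also have "(\<integral>\<^sup>+x. (\<phi> x)\<^sup>2 * ennreal (1 / w x) \<partial>\<nu>) = Y"
      unfolding Y_def
    proof (intro nn_integral_cong)
      fix x
      have "(\<phi> x)\<^sup>2 * ennreal (1 / w x) = (ennreal (w x) * ennreal (1 / w x)) * ((g k x)\<^sup>2 * ennreal (w x))"
        unfolding \<phi>_def by (simp only: power2_eq_square ac_simps)
      then show "(\<phi> x)\<^sup>2 * ennreal (1 / w x) = (g k x)\<^sup>2 * ennreal (w x)" unfolding w_inv[OF w] by simp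
    qed
    finally have "Y\<^sup>2 \<le> X * (C1 * Y)" by (simp add: mult_left_mono)
    then have "Y * Y \<le> C1 * X * Y" by (simp only: power2_eq_square ac_simps)
    then show ?thesis
      unfolding Y_def[symmetric] using Y_fin ennreal_le_of_mult_le[of Y Y "C1 * X"] by (cases "Y = 0") (auto simp: zero_less_iff_neq_zero)
  qed
  have g_inc: "incseq (\<lambda>k. g k u)" for u
    unfolding g_def
    by (intro monotoneI mult_mono min.mono order_refl ennreal_leI)
      (use R(4) in \<open>auto simp: indicator_def incseq_def\<close>)
  have g_sup: "(SUP k. g k u) = h u" if u: "u \<in> space \<nu>" for u
  proof (rule antisym)
    show "(SUP k. g k u) \<le> h u" using g_le by (intro SUP_least)
    show "h u \<le> (SUP k. g k u)"
    proof (rule dense_le)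
      fix y assume y: "y < h u"
      then obtain r where r: "y = ennreal r" "0 \<le> r" by (cases y) auto
      obtain j :: nat where j: "r \<le> real j" using real_arch_simple by blast
      obtain i where i: "u \<in> R i" using R(2) u by auto
      define k where "k = max i j"
      have "u \<in> R k" using i monoD[OF R(4), of i k] unfolding k_def by auto
      moreover have "y \<le> ennreal (real k)" unfolding r k_def using j by (intro ennreal_leI) simp
      ultimately have "y \<le> g k u" unfolding g_def using y by simp
      then show "y \<le> (SUP k. g k u)" by (rule SUP_upper2[rotated]) simp
    qed
  qed
  have "(\<integral>\<^sup>+u. (h u)\<^sup>2 * ennreal (w u) \<partial>\<nu>) = (\<integral>\<^sup>+u. (SUP k. (g k u)\<^sup>2 * ennreal (w u)) \<partial>\<nu>)"
    by (intro nn_integral_cong)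
      (simp add: SUP_mult_right_ennreal[symmetric] ennreal_SUP_square[OF g_inc, symmetric] g_sup)
  also have "\<dots> = (SUP k. \<integral>\<^sup>+u. (g k u)\<^sup>2 * ennreal (w u) \<partial>\<nu>)"
  proof (rule nn_integral_monotone_convergence_SUP)
    show "incseq (\<lambda>k u. (g k u)\<^sup>2 * ennreal (w u))"
      using g_inc unfolding incseq_def le_fun_def by (intro allI impI mult_right_mono power_mono) auto
  qed measurable
  also have "\<dots> \<le> C1 * X" by (intro SUP_least g_bound)
  finally show ?thesis unfolding h_def C1_def X_def .
qed

end

section \<open>The maximal operator in the lattice and in its order dual\<close>

context convex_lattice
begin

text \<open>The Fatou property concerns finite-valued limits, so \<open>H = \<infinity>\<close> has
  to be excluded first. On the set \<open>Z\<close> where it occurs, every multiple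
  \<open>real j\<close> of the indicator is a limit of truncations of the \<open>g k\<close> and has
  norm at most \<open>B\<close>; hence the indicator has norm zero and \<open>Z\<close> is
  null.\<close>

lemma fatou_increasing:
  fixes g :: "nat \<Rightarrow> 'a \<Rightarrow> 'k" and H :: "'a \<Rightarrow> ennreal"
  assumes g: "\<And>k. g k \<in> X" "\<And>k. N (g k) \<le> B" and H [measurable]: "H \<in> borel_measurable M"
    and inc: "AE z in M. incseq (\<lambda>k. norm (g k z))" and sup: "AE z in M. H z = (SUP k. ennreal (norm (g k z)))"
  shows "\<exists>h\<in>X. (AE z in M. H z = ennreal (norm (h z))) \<and> N h \<le> B"
proof -
  have B: "0 \<le> B" using g(2)[of 0] N_nonneg[OF g(1)[of 0]] by simp
  have lim: "AE z in M. (\<lambda>k. ennreal (norm (g k z))) \<longlonglongrightarrow> H z"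
    using inc sup
  proof eventually_elim
    case (elim z)
    have "(\<lambda>k. ennreal (norm (g k z))) \<longlonglongrightarrow> (SUP k. ennreal (norm (g k z)))"
      using elim(1) by (intro LIMSEQ_SUP) (auto simp: incseq_def intro: ennreal_leI)
    then show ?case using elim(2) by simp
  qed
  have gm: "g k \<in> borel_measurable M" for k by (rule X_measurable[OF g(1)])
  define Z where "Z = {z \<in> space M. H z = \<infinity>}"
  have Z [measurable]: "Z \<in> sets M" unfolding Z_def by measurable
  have Zj: "(\<lambda>z. of_real (real j * indicator Z z)) \<in> X \<and> N (\<lambda>z. of_real (real j * indicator Z z)) \<le> B" for j :: nat
  proof -
    define r where "r k z = (of_real (min (norm (g k z)) (real j) * indicator Z z) :: 'k)" for k z
    have r_meas: "r k \<in> borel_measurable M" for k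
      unfolding r_def using gm by measurable
    have r_le: "norm (r k z) \<le> norm (g k z)" for k z
      unfolding r_def norm_of_real by (auto simp: indicator_def)
    have r_X: "r k \<in> X" "N (r k) \<le> B" for k
    proof -
      show "r k \<in> X" by (rule X_ideal[OF g(1)[of k] r_meas]) (use r_le in simp)
      have "N (r k) \<le> N (g k)" by (rule N_mono[OF g(1)[of k] r_meas]) (use r_le in simp)
      then show "N (r k) \<le> B" using g(2)[of k] by simp
    qed
    have "AE z in M. (\<lambda>k. r k z) \<longlonglongrightarrow> of_real (real j * indicator Z z)"
      using lim
    proof eventually_elim
      case (elim z)
      show ?case
      proof (cases "z \<in> Z")
        case True
        then have "ennreal (real j) < H z" unfolding Z_def by simp
        with elim have "\<forall>\<^sub>F k in sequentially. ennreal (real j) < ennreal (norm (g k z))"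
          by (rule order_tendstoD)
        then have "\<forall>\<^sub>F k in sequentially. r k z = of_real (real j * indicator Z z)"
          by eventually_elim (use True in \<open>auto simp: r_def ennreal_less_iff\<close>)
        then show ?thesis by (rule tendsto_eventually)
      qed (simp add: r_def)
    qed
    moreover have "(\<lambda>z. of_real (real j * indicator Z z) :: 'k) \<in> borel_measurable M" by measurable
    ultimately show ?thesis using fatou_bound[of r B "\<lambda>z. of_real (real j * indicator Z z)"] r_X by blast
  qed
  have ZX: "(\<lambda>z. of_real (indicator Z z)) \<in> X" using Zj[of 1] by simp
  have "real j * N (\<lambda>z. of_real (indicator Z z)) \<le> B" for j :: nat
    using conjunct2[OF Zj[of j]] N_scale[OF ZX, of "of_real (real j)"] by simp
  then have "N (\<lambda>z. of_real (indicator Z z)) \<le> 0"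
    using N_nonneg[OF ZX] ex_less_of_nat_mult[of "N (\<lambda>z. of_real (indicator Z z))" B] by (force simp: not_less[symmetric])
  then have "AE z in M. (of_real (indicator Z z) :: 'k) = 0" using N_eq_0[OF ZX] N_nonneg[OF ZX] by simp
  then have fin: "AE z in M. H z < \<infinity>"
    using AE_space by eventually_elim (auto simp: Z_def indicator_def less_top split: if_splits)
  define h where "h z = (of_real (enn2real (H z)) :: 'k)" for z
  have hm: "h \<in> borel_measurable M" unfolding h_def by measurable
  have "AE z in M. (\<lambda>k. of_real (norm (g k z)) :: 'k) \<longlonglongrightarrow> h z"
    using lim fin
  proof eventually_elim
    case (elim z)
    then have "(\<lambda>k. ennreal (norm (g k z))) \<longlonglongrightarrow> ennreal (enn2real (H z))" by simp
    then have "(\<lambda>k. norm (g k z)) \<longlonglongrightarrow> enn2real (H z)" by (simp add: tendsto_ennreal_iff)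
    then show ?case unfolding h_def by (rule tendsto_of_real)
  qed
  then have "h \<in> X" "N h \<le> B"
    using fatou_bound[where B = B and g = h, OF X_norm[OF g(1)]] hm g(2) by (simp_all add: N_norm[OF g(1)])
  moreover have "AE z in M. H z = ennreal (norm (h z))"
    using fin by eventually_elim (simp add: h_def)
  ultimately show ?thesis by blast
qed

end

context homogeneous
begin

lemma maxop_SUP:
  fixes h :: "nat \<Rightarrow> 's \<Rightarrow> ennreal"
  assumes I: "I \<subseteq> balls" and h: "\<And>k. h k \<in> borel_measurable \<nu>" "incseq h"
  shows "maxop I \<nu> (\<lambda>u. SUP k. h k u) x = (SUP k. maxop I \<nu> (h k) x)"
proof -
  have "average \<nu> (qb p) (\<lambda>u. SUP k. h k u) * indicator (qb p) x = (SUP k. average \<nu> (qb p) (h k) * indicator (qb p) x)"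
    if "p \<in> I" for p
  proof -
    have [measurable]: "qb p \<in> sets \<nu>" using that I by (intro qb_sets) auto
    have "(\<integral>\<^sup>+u\<in>qb p. (SUP k. h k u) \<partial>\<nu>) = (SUP k. \<integral>\<^sup>+u\<in>qb p. h k u \<partial>\<nu>)"
      unfolding SUP_mult_right_ennreal
    proof (rule nn_integral_monotone_convergence_SUP)
      show "incseq (\<lambda>k u. h k u * indicator (qb p) u)"
        using h(2) unfolding incseq_def le_fun_def by (auto intro!: mult_right_mono)
      show "(\<lambda>u. h k u * indicator (qb p) u) \<in> borel_measurable \<nu>" for k using h(1)[of k] by measurable
    qed
    then show ?thesis unfolding average_def by (simp add: SUP_divide_ennreal SUP_mult_right_ennreal)
  qed
  then have "maxop I \<nu> (\<lambda>u. SUP k. h k u) x = (SUP p\<in>I. SUP k. average \<nu> (qb p) (h k) * indicator (qb p) x)"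
    unfolding maxop_def by (intro SUP_cong) auto
  also have "\<dots> = (SUP k. maxop I \<nu> (h k) x)" unfolding maxop_def by (rule SUP_commute)
  finally show ?thesis .
qed

end

locale nondegenerate_operator =
  fixes \<nu> :: "'s measure" and d :: "'s \<Rightarrow> 's \<Rightarrow> real" and \<kappa> D :: real and \<mu> :: "'w measure"
    and X :: "('s \<times> 'w \<Rightarrow> 'k::{real_normed_field,euclidean_space}) set" and N T and c A a :: real
    and \<Phi> :: "real \<Rightarrow> real"
  assumes homogeneous: "homogeneous_type \<nu> d \<kappa> D"
    and \<mu>: "sigma_finite_measure \<mu>"
    and lattice: "banach_lattice (\<nu> \<Otimes>\<^sub>M \<mu>) X N"
    and convex: "two_convex X N c"
    and oc_norm: "order_continuous_norm (\<nu> \<Otimes>\<^sub>M \<mu>) X N"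
    and fatou: "fatou_property (\<nu> \<Otimes>\<^sub>M \<mu>) X N"
    and T_L2: "linear_operator_L2 (\<nu> \<Otimes>\<^sub>M \<mu>) T A"
    and nondegenerate: "A2_nondegenerate \<nu> d \<mu> T \<Phi>"
    and T_X: "acts_boundedly (\<nu> \<Otimes>\<^sub>M \<mu>) T X N a"
begin

sublocale H: homogeneous \<nu> d \<kappa> D
  by unfold_locales (rule homogeneous)

sublocale P: pair_sigma_finite \<nu> \<mu>
  by (intro pair_sigma_finite.intro H.sigma_finite \<mu>)

sublocale L: lattice_operator "\<nu> \<Otimes>\<^sub>M \<mu>" X N "max c 1" T A a
proof unfold_locales
  show "two_convex X N (max c 1)"
    unfolding two_convex_def
  proof (intro allI impI)
    fix f :: "nat \<Rightarrow> 's \<times> 'w \<Rightarrow> 'k" and n :: nat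
    assume f: "\<forall>j<n. f j \<in> X"
    have "N (\<lambda>z. of_real (sqrt (\<Sum>j<n. (norm (f j z))\<^sup>2))) \<le> c * sqrt (\<Sum>j<n. (N (f j))\<^sup>2)"
      using convex f unfolding two_convex_def by blast
    also have "\<dots> \<le> max c 1 * sqrt (\<Sum>j<n. (N (f j))\<^sup>2)"
      by (intro mult_right_mono) (auto simp: sum_nonneg)
    finally show "N (\<lambda>z. of_real (sqrt (\<Sum>j<n. (norm (f j z))\<^sup>2))) \<le> max c 1 * sqrt (\<Sum>j<n. (N (f j))\<^sup>2)" .
  qed
qed (use lattice oc_norm fatou T_L2 T_X in simp_all)

text \<open>Strictly above the bound given by \<open>\<Phi>\<close>: an element of the set whose
  infimum is \<open>A2_const\<close> can then be picked below \<open>Q\<close>, without showing that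
  the infimum is attained. The maximum with 0 guards against negative values of
  \<open>\<Phi>\<close>.\<close>

definition Q :: real where "Q = max (\<Phi> L.c\<^sub>0) 0 + 1"

definition C\<^sub>1 :: real where "C\<^sub>1 = Q\<^sup>2 * (8 * (Q * H.\<Delta>\<^sub>0\<^sup>2))\<^sup>2"

definition C\<^sub>2 :: real where "C\<^sub>2 = max c 1 * sqrt (2 * C\<^sub>1)"

lemma Q_pos: "0 < Q"
  unfolding Q_def by simp

lemma C\<^sub>1_pos: "0 < C\<^sub>1"
  unfolding C\<^sub>1_def using Q_pos H.\<Delta>\<^sub>0_ge_1 by simp

lemma C\<^sub>2_pos: "0 < C\<^sub>2"
  unfolding C\<^sub>2_def using C\<^sub>1_pos by (simp add: less_max_iff_disj)

lemma admissible_A2_weight: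
  assumes w: "L.admissible w"
  shows "AE \<omega> in \<mu>. H.A2_weight (\<lambda>u. w (u, \<omega>)) Q"
proof -
  from w obtain e b where wm [measurable]: "w \<in> borel_measurable (\<nu> \<Otimes>\<^sub>M \<mu>)" and e: "0 < e" "\<And>z. e \<le> w z" "\<And>z. w z \<le> b"
    and T: "acts_boundedly (\<nu> \<Otimes>\<^sub>M \<mu>) T (wL2 (\<nu> \<Otimes>\<^sub>M \<mu>) w) (wL2_norm (\<nu> \<Otimes>\<^sub>M \<mu>) w) L.c\<^sub>0"
    unfolding L.admissible_def by blast
  have w_pos: "0 < w z" for z using e(1,2) by (rule less_le_trans)
  have "A2_const \<nu> d \<mu> w \<le> ennreal (\<Phi> L.c\<^sub>0)"
    using nondegenerate wm T w_pos unfolding A2_nondegenerate_def by simp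
  also have "\<dots> < ennreal Q"
    using Q_pos by (intro ennreal_lessI) (auto simp: Q_def)
  finally obtain J where J: "J < ennreal Q" "AE \<omega> in \<mu>.
     (SUP (y, r) \<in> space \<nu> \<times> {0<..}.
        average \<nu> (qball \<nu> d y r) (\<lambda>u. ennreal (w (u, \<omega>))) *
        average \<nu> (qball \<nu> d y r) (\<lambda>u. inverse (ennreal (w (u, \<omega>))))) \<le> J"
    unfolding A2_const_def Inf_less_iff by blast
  from J(2) AE_space show ?thesis
  proof eventually_elim
    case (elim \<omega>)
    have "(\<lambda>u. w (u, \<omega>)) \<in> borel_measurable \<nu>" using elim(2) by measurable
    moreover have "average \<nu> (H.qb p) (\<lambda>u. ennreal (w (u, \<omega>))) * average \<nu> (H.qb p) (\<lambda>u. ennreal (1 / w (u, \<omega>))) \<le> ennreal Q"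
      if p: "p \<in> H.balls" for p
    proof -
      have inv: "ennreal (1 / w z) = inverse (ennreal (w z))" for z
        using w_pos[of z] by (simp add: inverse_ennreal inverse_eq_divide)
      have "(case p of (y, r) \<Rightarrow> average \<nu> (qball \<nu> d y r) (\<lambda>u. ennreal (w (u, \<omega>))) *
        average \<nu> (qball \<nu> d y r) (\<lambda>u. inverse (ennreal (w (u, \<omega>))))) \<le>
        (SUP (y, r) \<in> space \<nu> \<times> {0<..}. average \<nu> (qball \<nu> d y r) (\<lambda>u. ennreal (w (u, \<omega>))) *
        average \<nu> (qball \<nu> d y r) (\<lambda>u. inverse (ennreal (w (u, \<omega>)))))"
        by (rule SUP_upper) (use p in \<open>simp add: H.balls_def\<close>)
      then show ?thesis unfolding inv using elim(1) J(1) by (simp add: case_prod_beta)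
    qed
    moreover have "\<exists>e b. 0 < e \<and> (\<forall>u. e \<le> w (u, \<omega>) \<and> w (u, \<omega>) \<le> b)" using e by blast
    ultimately show ?case unfolding H.A2_weight_def using Q_pos by simp
  qed
qed

text \<open>The maximal operator and the A_2 condition concern the first variable only: for a.e.
  \<open>\<omega>\<close> the one-variable inequality holds on the fibre, with one constant for all,
  and Tonelli's theorem integrates it over \<open>\<omega>\<close>.\<close>

lemma fibrewise_bound:
  assumes w: "L.admissible w" and h [measurable]: "h \<in> borel_measurable (\<nu> \<Otimes>\<^sub>M \<mu>)"
    and f [measurable]: "f \<in> borel_measurable (\<nu> \<Otimes>\<^sub>M \<mu>)"
    and bound: "\<And>\<omega>. \<omega> \<in> space \<mu> \<Longrightarrow> H.A2_weight (\<lambda>u. w (u, \<omega>)) Q \<Longrightarrow>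
      (\<integral>\<^sup>+x. (h (x, \<omega>))\<^sup>2 * ennreal (w (x, \<omega>)) \<partial>\<nu>) \<le>
      ennreal C\<^sub>1 * (\<integral>\<^sup>+x. (ennreal (norm (f (x, \<omega>))))\<^sup>2 * ennreal (w (x, \<omega>)) \<partial>\<nu>)"
  shows "(\<integral>\<^sup>+z. (h z)\<^sup>2 * ennreal (w z) \<partial>(\<nu> \<Otimes>\<^sub>M \<mu>)) \<le> ennreal C\<^sub>1 * L.sqint (\<lambda>z. ennreal (w z)) f"
proof -
  have wm [measurable]: "w \<in> borel_measurable (\<nu> \<Otimes>\<^sub>M \<mu>)" using w unfolding L.admissible_def by blast
  have "(\<integral>\<^sup>+z. (h z)\<^sup>2 * ennreal (w z) \<partial>(\<nu> \<Otimes>\<^sub>M \<mu>)) = (\<integral>\<^sup>+\<omega>. (\<integral>\<^sup>+x. (h (x, \<omega>))\<^sup>2 * ennreal (w (x, \<omega>)) \<partial>\<nu>) \<partial>\<mu>)"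
    by (rule P.nn_integral_snd[symmetric]) measurable
  also have "\<dots> \<le> (\<integral>\<^sup>+\<omega>. ennreal C\<^sub>1 * (\<integral>\<^sup>+x. (ennreal (norm (f (x, \<omega>))))\<^sup>2 * ennreal (w (x, \<omega>)) \<partial>\<nu>) \<partial>\<mu>)"
    by (rule nn_integral_mono_AE, use admissible_A2_weight[OF w] AE_space in eventually_elim) (rule bound)
  also have "\<dots> = ennreal C\<^sub>1 * (\<integral>\<^sup>+\<omega>. (\<integral>\<^sup>+x. (ennreal (norm (f (x, \<omega>))))\<^sup>2 * ennreal (w (x, \<omega>)) \<partial>\<nu>) \<partial>\<mu>)"
    by (rule nn_integral_cmult) measurable
  also have "(\<integral>\<^sup>+\<omega>. (\<integral>\<^sup>+x. (ennreal (norm (f (x, \<omega>))))\<^sup>2 * ennreal (w (x, \<omega>)) \<partial>\<nu>) \<partial>\<mu>) =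
      (\<integral>\<^sup>+z. (ennreal (norm (f z)))\<^sup>2 * ennreal (w z) \<partial>(\<nu> \<Otimes>\<^sub>M \<mu>))"
    by (rule P.nn_integral_snd) measurable
  finally show ?thesis by (simp add: ennreal_power)
qed

lemma fibre_measurable:
  fixes f :: "'s \<times> 'w \<Rightarrow> 'k"
  assumes [measurable]: "f \<in> borel_measurable (\<nu> \<Otimes>\<^sub>M \<mu>)" "\<omega> \<in> space \<mu>"
  shows "(\<lambda>u. ennreal (norm (f (u, \<omega>)))) \<in> borel_measurable \<nu>"
  by measurable

lemma maximal_L2_part:
  assumes f: "f \<in> X" "f \<in> L.LL"
  shows "\<exists>h\<in>X. (AE z in \<nu> \<Otimes>\<^sub>M \<mu>. maximal \<nu> d f z = ennreal (norm (h z))) \<and> N h \<le> C\<^sub>2 * N f"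
  unfolding C\<^sub>2_def
proof (rule L.extrapolation[OF f _ less_imp_le[OF C\<^sub>1_pos]])
  have fm: "f \<in> borel_measurable (\<nu> \<Otimes>\<^sub>M \<mu>)" by (rule L.X_measurable[OF f(1)])
  show Mm: "maximal \<nu> d f \<in> borel_measurable (\<nu> \<Otimes>\<^sub>M \<mu>)" by (rule H.maximal_measurable[OF fm])
  fix w assume w: "L.admissible w"
  show "(\<integral>\<^sup>+z. (maximal \<nu> d f z)\<^sup>2 * ennreal (w z) \<partial>(\<nu> \<Otimes>\<^sub>M \<mu>)) \<le> ennreal C\<^sub>1 * L.sqint (\<lambda>z. ennreal (w z)) f"
  proof (rule fibrewise_bound[OF w Mm fm])
    fix \<omega> assume \<omega>: "\<omega> \<in> space \<mu>" and A2: "H.A2_weight (\<lambda>u. w (u, \<omega>)) Q"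
    note fibre = fibre_measurable[OF fm \<omega>]
    have "(\<integral>\<^sup>+x. (maximal \<nu> d f (x, \<omega>))\<^sup>2 * ennreal (w (x, \<omega>)) \<partial>\<nu>) =
      (\<integral>\<^sup>+x. (H.maxop H.ball_family \<nu> (\<lambda>u. ennreal (norm (f (u, \<omega>)))) x)\<^sup>2 * ennreal (w (x, \<omega>)) \<partial>\<nu>)"
      by (intro nn_integral_cong) (simp add: H.maximal_eq_maxop[OF fibre])
    also have "\<dots> \<le> ennreal C\<^sub>1 * (\<integral>\<^sup>+x. (ennreal (norm (f (x, \<omega>))))\<^sup>2 * ennreal (w (x, \<omega>)) \<partial>\<nu>)"
      unfolding C\<^sub>1_def by (rule H.A2_maximal[OF A2 H.ball_family fibre])
    finally show "(\<integral>\<^sup>+x. (maximal \<nu> d f (x, \<omega>))\<^sup>2 * ennreal (w (x, \<omega>)) \<partial>\<nu>) \<le>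
      ennreal C\<^sub>1 * (\<integral>\<^sup>+x. (ennreal (norm (f (x, \<omega>))))\<^sup>2 * ennreal (w (x, \<omega>)) \<partial>\<nu>)" .
  qed
qed

text \<open>Extrapolation applies to functions in \<open>X \<inter> L_2\<close>; these increasing
  truncations carry its consequences over to \<open>X\<close>.\<close>

lemma L2_approximation:
  assumes f: "f \<in> X"
  obtains g :: "nat \<Rightarrow> 's \<times> 'w \<Rightarrow> 'k" where "\<And>k. g k \<in> X" "\<And>k. g k \<in> L.LL" "\<And>k. N (g k) \<le> N f"
    "\<And>z. incseq (\<lambda>k. ennreal (norm (g k z)))"
    "\<And>z. z \<in> space (\<nu> \<Otimes>\<^sub>M \<mu>) \<Longrightarrow> (SUP k. ennreal (norm (g k z))) = ennreal (norm (f z))"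
proof -
  let ?M = "\<nu> \<Otimes>\<^sub>M \<mu>"
  obtain B where B: "incseq B" "\<And>n. B n \<in> sets ?M" "\<And>n. emeasure ?M (B n) < \<infinity>"
    "\<And>n. (\<lambda>z. of_real (indicator (B n) z)) \<in> X"
    "\<And>f. f \<in> X \<Longrightarrow> AE z in ?M. z \<notin> (\<Union>n. B n) \<longrightarrow> f z = 0"
    by (rule L.exhaustion) blast
  note fm [measurable] = L.X_measurable[OF f]
  note Bm [measurable] = B(2)
  define E where "E = (\<Union>n. B n)"
  have [measurable]: "E \<in> sets ?M" unfolding E_def by measurable
  \<comment> \<open>Points off the support \<open>E\<close> are included although \<open>f\<close>
    vanishes a.e. there. In this way the supremum equals \<open>norm (f z)\<close> at every point,
    as needed for arguments on each single fibre.\<close>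
  define S where "S k = {z \<in> space ?M. norm (f z) \<le> real k \<and> (z \<in> B k \<or> z \<notin> E)}" for k
  have S [measurable]: "S k \<in> sets ?M" for k unfolding S_def by measurable
  have S_inc: "S i \<subseteq> S j" if "i \<le> j" for i j
    using that monoD[OF B(1) that] unfolding S_def by auto
  define g where "g k z = of_real (indicator (S k) z) * f z" for k z
  have gm [measurable]: "g k \<in> borel_measurable ?M" for k unfolding g_def by measurable
  have g_le: "norm (g k z) \<le> norm (f z)" for k z unfolding g_def by (auto simp: indicator_def)
  show thesis
  proof (rule that[of g])
    show "g k \<in> X" for k by (rule L.X_ideal[OF f gm]) (use g_le in simp)
    show "N (g k) \<le> N f" for k by (rule L.N_mono[OF f gm]) (use g_le in simp)
    show "g k \<in> L.LL" for k
    proof (rule L.L2_ideal[OF _ gm])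
      have "L.sqint (\<lambda>_. 1) (\<lambda>z. of_real (real k * indicator (B k) z)) =
        (\<integral>\<^sup>+z. ennreal ((real k)\<^sup>2) * indicator (B k) z \<partial>?M)"
        by (intro nn_integral_cong) (auto simp: indicator_def)
      also have "\<dots> = ennreal ((real k)\<^sup>2) * emeasure ?M (B k)" by (rule nn_integral_cmult_indicator) measurable
      also have "\<dots> < \<infinity>" using B(3)[of k] by (simp add: ennreal_mult_less_top)
      finally show "(\<lambda>z. of_real (real k * indicator (B k) z)) \<in> L.LL"
        unfolding L.L2_iff by (auto intro!: measurable_compose[OF _ borel_measurable_of_real])
      show "AE z in ?M. norm (g k z) \<le> norm (of_real (real k * indicator (B k) z) :: 'k)"
        using B(5)[OF f] unfolding E_def[symmetric]
      proof eventually_elim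
        case (elim z)
        have "norm (g k z) \<le> real k * indicator (B k) z"
        proof (cases "z \<in> S k")
          case True
          then have g_eq: "g k z = f z" unfolding g_def by simp
          show ?thesis
          proof (cases "z \<in> B k")
            case True
            then show ?thesis using \<open>z \<in> S k\<close> unfolding g_eq S_def by simp
          next
            case False
            then have "f z = 0" using \<open>z \<in> S k\<close> elim unfolding S_def by blast
            then show ?thesis unfolding g_eq by simp
          qed
        next
          case False
          then show ?thesis unfolding g_def by (simp add: indicator_def)
        qed
        then show ?case unfolding norm_of_real by simp
      qed
    qed
    show "incseq (\<lambda>k. ennreal (norm (g k z)))" for z
    proof (rule monotoneI)
      fix i j :: nat assume "i \<le> j"
      then have "norm (g i z) \<le> norm (g j z)" using S_inc unfolding g_def by (auto simp: indicator_def)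
      then show "ennreal (norm (g i z)) \<le> ennreal (norm (g j z))" by (rule ennreal_leI)
    qed
    show "(SUP k. ennreal (norm (g k z))) = ennreal (norm (f z))" if z: "z \<in> space ?M" for z
    proof (rule antisym)
      show "(SUP k. ennreal (norm (g k z))) \<le> ennreal (norm (f z))" by (intro SUP_least ennreal_leI g_le)
      obtain j :: nat where j: "norm (f z) \<le> real j" using real_arch_simple by blast
      obtain i where i: "z \<in> B i \<or> z \<notin> E" unfolding E_def by blast
      have "z \<in> S (max i j)" using i j z monoD[OF B(1), of i "max i j"] unfolding S_def by auto
      then have "g (max i j) z = f z" unfolding g_def by simp
      then show "ennreal (norm (f z)) \<le> (SUP k. ennreal (norm (g k z)))"
        by (intro SUP_upper2[of "max i j"]) auto
    qed
  qed
qed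

text \<open>Monotone convergence inside the averages makes the maximal functions of the
  \<open>L_2\<close> truncations increase to that of \<open>f\<close>, and
  \<open>fatou_increasing\<close> passes the uniform bound to the limit.\<close>

lemma maximal_bounded_X: "maximal_bounded \<nu> d \<mu> X N C\<^sub>2"
  unfolding maximal_bounded_def
proof
  let ?M = "\<nu> \<Otimes>\<^sub>M \<mu>"
  fix f assume f: "f \<in> X"
  note fm = L.X_measurable[OF f]
  obtain g :: "nat \<Rightarrow> 's \<times> 'w \<Rightarrow> 'k" where g: "\<And>k. g k \<in> X" "\<And>k. g k \<in> L.LL" "\<And>k. N (g k) \<le> N f"
    "\<And>z. incseq (\<lambda>k. ennreal (norm (g k z)))"
    "\<And>z. z \<in> space ?M \<Longrightarrow> (SUP k. ennreal (norm (g k z))) = ennreal (norm (f z))"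
    using L2_approximation[OF f] by blast
  have gm: "g k \<in> borel_measurable ?M" for k by (rule L.X_measurable[OF g(1)])
  obtain h where h: "\<And>k. h k \<in> X" "\<And>k. AE z in ?M. maximal \<nu> d (g k) z = ennreal (norm (h k z))"
    "\<And>k. N (h k) \<le> C\<^sub>2 * N (g k)"
    using maximal_L2_part[OF g(1,2)] by metis
  have hB: "N (h k) \<le> C\<^sub>2 * N f" for k
    using h(3)[of k] mult_left_mono[OF g(3)[of k] less_imp_le[OF C\<^sub>2_pos]] by simp
  have inc: "maximal \<nu> d (g i) z \<le> maximal \<nu> d (g j) z" if "i \<le> j" for i j z
  proof -
    have "ennreal (norm (g i z)) \<le> ennreal (norm (g j z))" for z using monoD[OF g(4) that] .
    then show ?thesis
      unfolding maximal_def case_prod_beta by (intro SUP_mono' H.average_mono)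
  qed
  have sup: "maximal \<nu> d f z = (SUP k. maximal \<nu> d (g k) z)" if z: "z \<in> space ?M" for z
  proof -
    obtain x \<omega> where x: "z = (x, \<omega>)" "x \<in> space \<nu>" "\<omega> \<in> space \<mu>" using z by (auto simp: space_pair_measure)
    have "maximal \<nu> d f (x, \<omega>) = H.maxop H.ball_family \<nu> (\<lambda>u. ennreal (norm (f (u, \<omega>)))) x"
      by (rule H.maximal_eq_maxop[OF fibre_measurable[OF fm x(3)] x(2)])
    also have "\<dots> = H.maxop H.ball_family \<nu> (\<lambda>u. SUP k. ennreal (norm (g k (u, \<omega>)))) x"
    proof -
      have "average \<nu> (H.qb p) (\<lambda>u. ennreal (norm (f (u, \<omega>)))) = average \<nu> (H.qb p) (\<lambda>u. SUP k. ennreal (norm (g k (u, \<omega>))))" for p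
        unfolding average_def using g(5) x(3)
        by (intro arg_cong2[where f = "(/)"] nn_integral_cong) (auto simp: space_pair_measure)
      then show ?thesis unfolding H.maxop_def by simp
    qed
    also have "\<dots> = (SUP k. H.maxop H.ball_family \<nu> (\<lambda>u. ennreal (norm (g k (u, \<omega>)))) x)"
      using g(4) by (intro H.maxop_SUP H.ball_family fibre_measurable gm x) (auto simp: incseq_def le_fun_def)
    also have "\<dots> = (SUP k. maximal \<nu> d (g k) (x, \<omega>))"
      by (intro SUP_cong H.maximal_eq_maxop[symmetric] fibre_measurable gm x) auto
    finally show ?thesis unfolding x(1) .
  qed
  have AEh: "AE z in ?M. \<forall>k. maximal \<nu> d (g k) z = ennreal (norm (h k z))"
    unfolding AE_all_countable using h(2) by blast
  show "\<exists>h\<in>X. (AE z in ?M. maximal \<nu> d f z = ennreal (norm (h z))) \<and> N h \<le> C\<^sub>2 * N f"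
  proof (rule L.fatou_increasing[OF h(1) hB H.maximal_measurable[OF fm]])
    show "AE z in ?M. incseq (\<lambda>k. norm (h k z))"
      using AEh
    proof eventually_elim
      case (elim z)
      have "ennreal (norm (h i z)) \<le> ennreal (norm (h j z))" if "i \<le> j" for i j
        using inc[OF that, of z] elim by simp
      then show ?case by (intro monotoneI) simp
    qed
    show "AE z in ?M. maximal \<nu> d f z = (SUP k. ennreal (norm (h k z)))"
      using AEh AE_space by eventually_elim (simp add: sup)
  qed
qed

lemma dual_norm_pairing:
  assumes h: "h \<in> X" "N h \<le> C\<^sub>2" and g [measurable]: "g \<in> borel_measurable (\<nu> \<Otimes>\<^sub>M \<mu>)"
  shows "(\<integral>\<^sup>+z. ennreal (norm (h z)) * g z \<partial>(\<nu> \<Otimes>\<^sub>M \<mu>)) \<le> ennreal C\<^sub>2 * dual_norm (\<nu> \<Otimes>\<^sub>M \<mu>) X N g"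
proof -
  define h' where "h' z = of_real (1 / C\<^sub>2) * h z" for z
  have "N h' = 1 / C\<^sub>2 * N h"
    unfolding h'_def L.N_scale[OF h(1)] norm_of_real using C\<^sub>2_pos by simp
  also have "\<dots> \<le> 1" using h(2) C\<^sub>2_pos by simp
  finally have "N h' \<le> 1" .
  moreover have "h' \<in> X" unfolding h'_def by (rule L.X_scale[OF h(1)])
  ultimately have h': "h' \<in> {f \<in> X. N f \<le> 1}" by simp
  have "norm (h' z) = 1 / C\<^sub>2 * norm (h z)" for z
    unfolding h'_def norm_mult norm_of_real using C\<^sub>2_pos by simp
  then have "norm (h z) = C\<^sub>2 * norm (h' z)" for z
    using C\<^sub>2_pos by simp
  then have eq: "ennreal (norm (h z)) = ennreal C\<^sub>2 * ennreal (norm (h' z))" for z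
    using C\<^sub>2_pos by (simp add: ennreal_mult)
  have "(\<integral>\<^sup>+z. ennreal (norm (h z)) * g z \<partial>(\<nu> \<Otimes>\<^sub>M \<mu>)) = (\<integral>\<^sup>+z. ennreal C\<^sub>2 * (ennreal (norm (h' z)) * g z) \<partial>(\<nu> \<Otimes>\<^sub>M \<mu>))"
    unfolding eq by (simp add: mult.assoc)
  also have "\<dots> = ennreal C\<^sub>2 * (\<integral>\<^sup>+z. ennreal (norm (h' z)) * g z \<partial>(\<nu> \<Otimes>\<^sub>M \<mu>))"
    using L.X_measurable[of h'] h' by (intro nn_integral_cmult) auto
  also have "\<dots> \<le> ennreal C\<^sub>2 * dual_norm (\<nu> \<Otimes>\<^sub>M \<mu>) X N g"
    unfolding dual_norm_def by (intro mult_left_mono SUP_upper h') simp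
  finally show ?thesis .
qed

text \<open>With finitely many balls the supremum is attained, so that the maximal function
  \<open>m\<close> of \<open>g\<close> is an average over a ball selected at each point. The
  selection is moved to the other side: \<open>\<integral>|f| m = \<integral>h |g|\<close>, where
  \<open>h\<close> is the fibrewise adjoint applied to \<open>|f|\<close>. By extrapolation
  \<open>h\<close> has norm at most \<open>C\<^sub>2\<close> in \<open>X\<close>, so the dual norm
  of \<open>g\<close> bounds the pairing.\<close>

lemma finite_maximal_pairing:
  fixes f g :: "'s \<times> 'w \<Rightarrow> 'k" and p :: "nat \<Rightarrow> 's \<times> real" and n :: nat
  assumes f: "f \<in> X" "f \<in> L.LL" "N f \<le> 1" and gm [measurable]: "g \<in> borel_measurable (\<nu> \<Otimes>\<^sub>M \<mu>)"
    and p: "\<And>i. p i \<in> H.balls"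
  shows "(\<integral>\<^sup>+(x, \<omega>). ennreal (norm (f (x, \<omega>))) * H.maxop (p ` {..<n}) \<nu> (\<lambda>u. ennreal (norm (g (u, \<omega>)))) x \<partial>(\<nu> \<Otimes>\<^sub>M \<mu>)) \<le>
    ennreal C\<^sub>2 * dual_norm (\<nu> \<Otimes>\<^sub>M \<mu>) X N (\<lambda>z. ennreal (norm (g z)))"
proof -
  let ?M = "\<nu> \<Otimes>\<^sub>M \<mu>"
  note fm [measurable] = L.X_measurable[OF f(1)]
  define G where "G \<omega> u = ennreal (norm (g (u, \<omega>)))" for \<omega> u
  define F where "F \<omega> u = ennreal (norm (f (u, \<omega>)))" for \<omega> u
  have qbm [measurable]: "H.qb (p i) \<in> sets \<nu>" for i by (rule H.qb_sets[OF p])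
  define \<alpha> where "\<alpha> i = (\<lambda>(x, \<omega>). average \<nu> (H.qb (p i)) (G \<omega>) * indicator (H.qb (p i)) x)" for i
  define m where "m = (\<lambda>(x, \<omega>). H.maxop (p ` {..<n}) \<nu> (G \<omega>) x)"
  have \<alpha>_meas [measurable]: "\<alpha> i \<in> borel_measurable ?M" for i
    unfolding \<alpha>_def average_def G_def by measurable
  have m_eq: "m z = (SUP i\<in>{..<n}. \<alpha> i z)" for z
    unfolding m_def \<alpha>_def H.maxop_def by (cases z) (simp add: image_image)
  have m_meas [measurable]: "m \<in> borel_measurable ?M"
    unfolding m_eq[abs_def] by (intro borel_measurable_SUP) auto
  \<comment> \<open>Choosing the least index that attains the maximum makes these sets disjoint and
    keeps them jointly measurable in both variables.\<close>
  define E where "E i = {z \<in> space ?M. \<alpha> i z = m z \<and> (\<forall>j<i. \<alpha> j z \<noteq> m z)}" for i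
  have E_meas [measurable]: "E i \<in> sets ?M" for i
    unfolding E_def by measurable
  have E_disj: "i = j" if "z \<in> E i" "z \<in> E j" for i j z
    using that unfolding E_def by (metis (mono_tags, lifting) linorder_neqE_nat mem_Collect_eq)
  have m_sum: "(\<Sum>i<n. indicator (E i) z * \<alpha> i z) = m z" if z: "z \<in> space ?M" for z
  proof (cases "n = 0")
    case True
    then show ?thesis unfolding m_eq by (simp add: bot_ennreal)
  next
    case False
    have "m z \<in> (\<lambda>i. \<alpha> i z) ` {..<n}"
      unfolding m_eq using False by (subst Max_Sup[symmetric]) (auto intro!: Max_in)
    then obtain j where j: "j < n" "\<alpha> j z = m z" by auto
    define i where "i = (LEAST i. \<alpha> i z = m z)"
    have i: "\<alpha> i z = m z" "i \<le> j"
      unfolding i_def by (rule LeastI[where P = "\<lambda>i. \<alpha> i z = m z", OF j(2)],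
        rule Least_le[where P = "\<lambda>i. \<alpha> i z = m z", OF j(2)])
    have "\<alpha> k z \<noteq> m z" if "k < i" for k
      using not_less_Least[of k "\<lambda>i. \<alpha> i z = m z"] that unfolding i_def by blast
    with i(1) z have zi: "z \<in> E i" unfolding E_def by blast
    have "indicator (E k) z * \<alpha> k z = (if k = i then m z else 0)" for k
    proof (cases "k = i")
      case True
      then show ?thesis using zi i(1) by simp
    next
      case False
      then have "z \<notin> E k" using E_disj[OF zi, of k] by blast
      then show ?thesis using False by simp
    qed
    then have "(\<Sum>k<n. indicator (E k) z * \<alpha> k z) = (\<Sum>k<n. if k = i then m z else 0)" by simp
    also have "\<dots> = m z" using i(2) j(1) by simp
    finally show ?thesis .
  qed
  define E' where "E' \<omega> i = {x \<in> space \<nu>. (x, \<omega>) \<in> E i}" for \<omega> i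
  have E'_meas: "E' \<omega> i \<in> sets \<nu>" if "\<omega> \<in> space \<mu>" for \<omega> i
    unfolding E'_def using that by measurable
  have E'_disj: "disjoint_family_on (E' \<omega>) {..<n}" for \<omega>
    using E_disj unfolding disjoint_family_on_def E'_def by blast
  have F_meas: "F \<omega> \<in> borel_measurable \<nu>" and G_meas: "G \<omega> \<in> borel_measurable \<nu>" if "\<omega> \<in> space \<mu>" for \<omega>
    unfolding F_def G_def by (intro fibre_measurable fm gm that)+
  define h where "h = (\<lambda>(u, \<omega>). \<Sum>i<n. indicator (H.qb (p i)) u * average \<nu> (H.qb (p i)) (\<lambda>x. indicator (E i) (x, \<omega>) * F \<omega> x))"
  have h_meas [measurable]: "h \<in> borel_measurable ?M"
    unfolding h_def average_def F_def by measurable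
  have h_eq: "h (u, \<omega>) = H.adjoint n p (E' \<omega>) (F \<omega>) u" for u \<omega>
  proof -
    have "average \<nu> (H.qb (p i)) (\<lambda>x. indicator (E i) (x, \<omega>) * F \<omega> x) = average \<nu> (H.qb (p i)) (\<lambda>x. indicator (E' \<omega> i) x * F \<omega> x)" for i
      unfolding average_def E'_def
      by (intro arg_cong2[where f = "(/)"] nn_integral_cong) (auto simp: indicator_def)
    then show ?thesis unfolding h_def H.adjoint_def by simp
  qed
  have "\<exists>k\<in>X. (AE z in ?M. h z = ennreal (norm (k z))) \<and> N k \<le> C\<^sub>2 * N f"
    unfolding C\<^sub>2_def
  proof (rule L.extrapolation[OF f(1,2) h_meas less_imp_le[OF C\<^sub>1_pos]])
    fix w assume w: "L.admissible w"
    show "(\<integral>\<^sup>+z. (h z)\<^sup>2 * ennreal (w z) \<partial>?M) \<le> ennreal C\<^sub>1 * L.sqint (\<lambda>z. ennreal (w z)) f"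
    proof (rule fibrewise_bound[OF w h_meas fm])
      fix \<omega> assume \<omega>: "\<omega> \<in> space \<mu>" and A2: "H.A2_weight (\<lambda>u. w (u, \<omega>)) Q"
      show "(\<integral>\<^sup>+x. (h (x, \<omega>))\<^sup>2 * ennreal (w (x, \<omega>)) \<partial>\<nu>) \<le>
        ennreal C\<^sub>1 * (\<integral>\<^sup>+x. (ennreal (norm (f (x, \<omega>))))\<^sup>2 * ennreal (w (x, \<omega>)) \<partial>\<nu>)"
        unfolding h_eq C\<^sub>1_def F_def[symmetric]
        by (rule H.adjoint_bounded[OF A2 p E'_meas[OF \<omega>] E'_disj F_meas[OF \<omega>]])
    qed
  qed
  then obtain k where k: "k \<in> X" "AE z in ?M. h z = ennreal (norm (k z))" "N k \<le> C\<^sub>2 * N f" by blast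
  have Nk: "N k \<le> C\<^sub>2"
    using k(3) mult_left_mono[OF f(3) less_imp_le[OF C\<^sub>2_pos]] by simp
  have "(\<integral>\<^sup>+(x, \<omega>). ennreal (norm (f (x, \<omega>))) * H.maxop (p ` {..<n}) \<nu> (\<lambda>u. ennreal (norm (g (u, \<omega>)))) x \<partial>?M) =
      (\<integral>\<^sup>+z. ennreal (norm (f z)) * m z \<partial>?M)"
    by (intro nn_integral_cong) (simp add: m_def G_def[abs_def] case_prod_beta)
  also have "\<dots> = (\<integral>\<^sup>+\<omega>. (\<integral>\<^sup>+x. F \<omega> x * m (x, \<omega>) \<partial>\<nu>) \<partial>\<mu>)"
    unfolding F_def by (rule P.nn_integral_snd[symmetric]) measurable
  also have "\<dots> = (\<integral>\<^sup>+\<omega>. (\<integral>\<^sup>+u. h (u, \<omega>) * G \<omega> u \<partial>\<nu>) \<partial>\<mu>)"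
  proof (rule nn_integral_cong)
    fix \<omega> assume \<omega>: "\<omega> \<in> space \<mu>"
    have "(\<integral>\<^sup>+u. h (u, \<omega>) * G \<omega> u \<partial>\<nu>) =
      (\<integral>\<^sup>+x. F \<omega> x * (\<Sum>i<n. indicator (E' \<omega> i) x * (average \<nu> (H.qb (p i)) (G \<omega>) * indicator (H.qb (p i)) x)) \<partial>\<nu>)"
      unfolding h_eq by (rule H.adjoint_duality[OF p E'_meas[OF \<omega>] F_meas[OF \<omega>] G_meas[OF \<omega>]])
    also have "\<dots> = (\<integral>\<^sup>+x. F \<omega> x * m (x, \<omega>) \<partial>\<nu>)"
    proof (rule nn_integral_cong)
      fix x assume x: "x \<in> space \<nu>"
      have "(\<Sum>i<n. indicator (E' \<omega> i) x * (average \<nu> (H.qb (p i)) (G \<omega>) * indicator (H.qb (p i)) x)) =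
        (\<Sum>i<n. indicator (E i) (x, \<omega>) * \<alpha> i (x, \<omega>))"
        using x by (intro sum.cong) (auto simp: \<alpha>_def E'_def indicator_def)
      also have "\<dots> = m (x, \<omega>)" using x \<omega> by (intro m_sum) (simp add: space_pair_measure)
      finally show "F \<omega> x * (\<Sum>i<n. indicator (E' \<omega> i) x * (average \<nu> (H.qb (p i)) (G \<omega>) * indicator (H.qb (p i)) x)) =
        F \<omega> x * m (x, \<omega>)" by simp
    qed
    finally show "(\<integral>\<^sup>+x. F \<omega> x * m (x, \<omega>) \<partial>\<nu>) = (\<integral>\<^sup>+u. h (u, \<omega>) * G \<omega> u \<partial>\<nu>)" ..
  qed
  also have "\<dots> = (\<integral>\<^sup>+z. h z * ennreal (norm (g z)) \<partial>?M)"
    unfolding G_def by (rule P.nn_integral_snd) measurable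
  also have "\<dots> = (\<integral>\<^sup>+z. ennreal (norm (k z)) * ennreal (norm (g z)) \<partial>?M)"
    using k(2) by (intro nn_integral_cong_AE) (auto elim: eventually_mono)
  also have "\<dots> \<le> ennreal C\<^sub>2 * dual_norm ?M X N (\<lambda>z. ennreal (norm (g z)))"
    by (rule dual_norm_pairing[OF k(1) Nk]) measurable
  finally show ?thesis .
qed

text \<open>For a fixed test function \<open>f\<close>, its \<open>L_2\<close> truncations and the
  initial segments of an enumeration of \<open>ball_family\<close> grow along the same index.
  \<open>finite_maximal_pairing\<close> bounds every stage, and monotone convergence bounds the
  limit.\<close>

lemma maximal_bounded_X_dual: "maximal_bounded_dual \<nu> d \<mu> X N C\<^sub>2"
  unfolding maximal_bounded_dual_def
proof (intro ballI conjI)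
  let ?M = "\<nu> \<Otimes>\<^sub>M \<mu>"
  fix g assume "g \<in> order_dual ?M X N"
  then have gm [measurable]: "g \<in> borel_measurable ?M" unfolding order_dual_def by simp
  show "maximal \<nu> d g \<in> borel_measurable ?M" by (rule H.maximal_measurable[OF gm])
  have "(\<integral>\<^sup>+z. ennreal (norm (f z)) * maximal \<nu> d g z \<partial>?M) \<le>
      ennreal C\<^sub>2 * dual_norm ?M X N (\<lambda>z. ennreal (norm (g z)))" if f: "f \<in> X" "N f \<le> 1" for f
  proof (cases "H.ball_family = {}")
    case True
    have "maximal \<nu> d g z = 0" if "z \<in> space ?M" for z
    proof -
      obtain x \<omega> where x: "z = (x, \<omega>)" "x \<in> space \<nu>" "\<omega> \<in> space \<mu>"
        using \<open>z \<in> space ?M\<close> by (auto simp: space_pair_measure)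
      show ?thesis
        unfolding x(1) H.maximal_eq_maxop[OF fibre_measurable[OF gm x(3)] x(2)] H.maxop_def True
        by (simp add: bot_ennreal)
    qed
    then have "(\<integral>\<^sup>+z. ennreal (norm (f z)) * maximal \<nu> d g z \<partial>?M) = (\<integral>\<^sup>+z. 0 \<partial>?M)"
      by (intro nn_integral_cong) simp
    then show ?thesis by simp
  next
    case False
    define p where "p = from_nat_into H.ball_family"
    have p: "p i \<in> H.balls" for i using from_nat_into[OF False] H.ball_family(2) unfolding p_def by blast
    have pm [measurable]: "H.qb (p i) \<in> sets \<nu>" for i by (rule H.qb_sets[OF p])
    have family_eq: "H.ball_family = (\<Union>n. p ` {..<n})"
    proof -
      have "(\<Union>n. p ` {..<n}) = range p" by blast
      then show ?thesis unfolding p_def using range_from_nat_into[OF False H.ball_family(1)] by simp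
    qed
    obtain F :: "nat \<Rightarrow> 's \<times> 'w \<Rightarrow> 'k" where F: "\<And>k. F k \<in> X" "\<And>k. F k \<in> L.LL" "\<And>k. N (F k) \<le> N f"
      "\<And>z. incseq (\<lambda>k. ennreal (norm (F k z)))"
      "\<And>z. z \<in> space ?M \<Longrightarrow> (SUP k. ennreal (norm (F k z))) = ennreal (norm (f z))"
      using L2_approximation[OF f(1)] by blast
    note Fm [measurable] = L.X_measurable[OF F(1)]
    define m where "m n = (\<lambda>(x, \<omega>). H.maxop (p ` {..<n}) \<nu> (\<lambda>u. ennreal (norm (g (u, \<omega>)))) x)" for n
    have m_meas [measurable]: "m n \<in> borel_measurable ?M" for n
      unfolding m_def by (rule H.maxop_measurable) (use p in auto)
    have m_inc: "incseq (\<lambda>n. m n z)" for z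
      unfolding m_def H.maxop_def by (intro monotoneI) (auto split: prod.splits intro!: SUP_subset_mono)
    have m_sup: "maximal \<nu> d g z = (SUP n. m n z)" if "z \<in> space ?M" for z
    proof -
      obtain x \<omega> where x: "z = (x, \<omega>)" "x \<in> space \<nu>" "\<omega> \<in> space \<mu>"
        using \<open>z \<in> space ?M\<close> by (auto simp: space_pair_measure)
      show ?thesis
        unfolding x(1) H.maximal_eq_maxop[OF fibre_measurable[OF gm x(3)] x(2)] m_def prod.case H.maxop_def
        by (subst family_eq) (rule SUP_UNION)
    qed
    have "(\<integral>\<^sup>+z. ennreal (norm (f z)) * maximal \<nu> d g z \<partial>?M) = (\<integral>\<^sup>+z. (SUP n. ennreal (norm (F n z)) * m n z) \<partial>?M)"
      by (intro nn_integral_cong) (simp add: F(5)[symmetric] m_sup ennreal_SUP_times[OF F(4) m_inc])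
    also have "\<dots> = (SUP n. \<integral>\<^sup>+z. ennreal (norm (F n z)) * m n z \<partial>?M)"
    proof (rule nn_integral_monotone_convergence_SUP)
      show "incseq (\<lambda>n z. ennreal (norm (F n z)) * m n z)"
        by (intro monotoneI le_funI mult_mono monoD[OF F(4)] monoD[OF m_inc]) auto
    qed measurable
    also have "\<dots> \<le> ennreal C\<^sub>2 * dual_norm ?M X N (\<lambda>z. ennreal (norm (g z)))"
    proof (rule SUP_least)
      fix n
      have "N (F n) \<le> 1" using F(3)[of n] f(2) by simp
      from finite_maximal_pairing[where n = n and p = p, OF F(1,2) this gm p]
      show "(\<integral>\<^sup>+z. ennreal (norm (F n z)) * m n z \<partial>?M) \<le> ennreal C\<^sub>2 * dual_norm ?M X N (\<lambda>z. ennreal (norm (g z)))"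
        unfolding m_def by (simp add: case_prod_beta')
    qed
    finally show ?thesis .
  qed
  then show "dual_norm ?M X N (maximal \<nu> d g) \<le> ennreal C\<^sub>2 * dual_norm ?M X N (\<lambda>z. ennreal (norm (g z)))"
    unfolding dual_norm_def[of ?M X N "maximal \<nu> d g"] by (intro SUP_least) auto
qed

end

theorem theorem4:
  fixes \<kappa> D c A a :: real and \<Phi> :: "real \<Rightarrow> real"
  shows "\<exists>C\<ge>0. \<forall>(\<nu> :: 's measure) (d :: 's \<Rightarrow> 's \<Rightarrow> real) (\<mu> :: 'w measure)
            (X :: ('s \<times> 'w \<Rightarrow> 'k::{real_normed_field,euclidean_space}) set) N T.
          homogeneous_type \<nu> d \<kappa> D \<longrightarrow>
          sigma_finite_measure \<mu> \<longrightarrow>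
          banach_lattice (\<nu> \<Otimes>\<^sub>M \<mu>) X N \<longrightarrow>
          two_convex X N c \<longrightarrow>
          order_continuous_norm (\<nu> \<Otimes>\<^sub>M \<mu>) X N \<longrightarrow>
          fatou_property (\<nu> \<Otimes>\<^sub>M \<mu>) X N \<longrightarrow>
          linear_operator_L2 (\<nu> \<Otimes>\<^sub>M \<mu>) T A \<longrightarrow>
          A2_nondegenerate \<nu> d \<mu> T \<Phi> \<longrightarrow>
          acts_boundedly (\<nu> \<Otimes>\<^sub>M \<mu>) T X N a \<longrightarrow>
          maximal_bounded \<nu> d \<mu> X N C \<and> maximal_bounded_dual \<nu> d \<mu> X N C"
\<comment> \<open>\<open>C\<^sub>2\<close> is a function of the listed parameters alone, which gives
  uniformity over all spaces, lattices and operators. Its positivity is established only under the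
  hypotheses, hence the absolute value.\<close>
proof (intro exI[of _ "\<bar>nondegenerate_operator.C\<^sub>2 \<kappa> D c A a \<Phi>\<bar>"] conjI allI impI)
  fix \<nu> :: "'s measure" and d :: "'s \<Rightarrow> 's \<Rightarrow> real" and \<mu> :: "'w measure"
    and X :: "('s \<times> 'w \<Rightarrow> 'k) set" and N T
  assume "homogeneous_type \<nu> d \<kappa> D" "sigma_finite_measure \<mu>" "banach_lattice (\<nu> \<Otimes>\<^sub>M \<mu>) X N"
    "two_convex X N c" "order_continuous_norm (\<nu> \<Otimes>\<^sub>M \<mu>) X N" "fatou_property (\<nu> \<Otimes>\<^sub>M \<mu>) X N"
    "linear_operator_L2 (\<nu> \<Otimes>\<^sub>M \<mu>) T A" "A2_nondegenerate \<nu> d \<mu> T \<Phi>" "acts_boundedly (\<nu> \<Otimes>\<^sub>M \<mu>) T X N a"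
  then interpret nondegenerate_operator \<nu> d \<kappa> D \<mu> X N T c A a \<Phi> by (rule nondegenerate_operator.intro)
  have "\<bar>C\<^sub>2\<bar> = C\<^sub>2" using C\<^sub>2_pos by simp
  then show "maximal_bounded \<nu> d \<mu> X N \<bar>C\<^sub>2\<bar>" "maximal_bounded_dual \<nu> d \<mu> X N \<bar>C\<^sub>2\<bar>"
    using maximal_bounded_X maximal_bounded_X_dual by simp_all
qed simp

end
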